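(* Let $B=2^{k_1}C_1\perp\cdots\perp2^{k_r}C_r\in\mathcal H_n(\mathfrak o)$ be a pre-optimal form and $n_r=\deg C_r$. Then there is an optimal basis $\{\phi_1,\ldots,\phi_n\}$ of $L_B$ such that $\{\phi_1,\ldots,\phi_{n-n_r}\}$ is an optimal basis of $L_{B^{[r-1]}}$.
   Context: Let $F$ be a finite unramified extension of $\mathbb Q_2$ with ring of integers $\mathfrak o$, $\mathrm{ord}$ the valuation with $\mathrm{ord}(2)=1$, $\mathrm{ord}(0)=+\infty$. $\mathcal H_n(\mathfrak o)$ is the set of symmetric $B=(b_{ij})\in M_n(F)$ with $b_{ii}\in\mathfrak o$, $2b_{ij}\in\mathfrak o$. $\perp$ is block-diagonal sum. For nondegenerate $B$ of degree $n$: $D_B=(-4)^{[n/2]}\det B$; $\xi_B=1,-1,0$ according as $D_B\in F^{\times2}$, $F(\sqrt{D_B})/F$ unramified quadratic, or ramified. $S_2(\mathfrak o)_e$: symmetric $2\times2$ matrices over $\mathfrak o$ with diagonal in $2\mathfrak o$; unimodular diagonal: diagonal with unit entries. GK invariant: $S(B)$ = set of non-decreasing $(a_i)\in\mathbb Z_{\ge0}^n$ with $\mathrm{ord}(b_{ii})\ge a_i$, $\mathrm{ord}(2b_{ij})\ge(a_i+a_j)/2$ ($1\le i\le j\le n$); $\mathrm{GK}(B)$ = lexicographically greatest element of $\bigcup_{U\in GL_n(\mathfrak o)}S({}^tUBU)$; $B$ optimal if $\mathrm{GK}(B)\in S(B)$. Quadratic modules: for $B\in\mathcal H_n(\mathfrak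 o)$, $L_B$ is a free $\mathfrak o$-module with basis $\psi_1,\dots,\psi_n$ and quadratic form $Q$ whose bilinear form $(x,y)=Q(x+y)-Q(x)-Q(y)$ satisfies $\frac12(\psi_i,\psi_j)=b_{ij}$. A basis $u_1,\dots,u_n$ is optimal if $(\frac12(u_i,u_j))$ is optimal. For $B=B_1\perp B_2$ with $\deg B_1=n_1$, $L_{B_1}$ is the submodule spanned by $\psi_1,\dots,\psi_{n_1}$. Pre-optimal forms: $B=2^{k_1}C_1\perp\cdots\perp2^{k_r}C_r$ with $k_i\ge0$, each $C_i$ unimodular diagonal or in $\frac12(S_2(\mathfrak o)_e\cap GL_2(\mathfrak o))$; $B^{[j]}=2^{k_1}C_1\perp\cdots\perp2^{k_j}C_j$; $\mathcal D_m=\{j:k_j=m,C_j\text{ diagonal}\}$, $\mathcal E_m=\{j:k_j=m,C_j\text{ not diagonal}\}$. Pre-optimal means: (PO1) $\sum_{j\in\mathcal D_m}\deg C_j\le2$ and $\mathcal E_m$ is a (possibly empty) set of consecutive integers, for each $m$; (PO2) for $i<j$: $i\in\mathcal D_{m_1},j\in\mathcal D_{m_2}\Rightarrow m_1\le m_2$; $i\in\mathcal E_{m_1},j\in\mathcal E_{m_2}\Rightarrow m_1\le m_2$; $i\in\mathcal D_{m_1},j\in\mathcal E_{m_2}\Rightarrow m_1\le m_2-1$; $i\in\mathcal E_{m_1},j\in\mathcal D_{m_2}\Rightarrow m_1\le m_2+1$; (PO3) if $C_i$ is unimodular diagonal of degree 2 then $i\ge2$ and either ($\deg B^{[i]}$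 even and $\xi_{B^{[i-1]}}=\xi_{B^{[i]}}=0$) or ($\deg B^{[i-1]}$ odd and $\mathrm{ord}\det B^{[i-1]}+k_i$ even); (PO4) if $k_i=k_{i-1}-1$, $C_i$ diagonal, $C_{i-1}$ not diagonal, then $\deg C_i=2$, or $\deg C_i=1$ and either ($\deg B^{[i]}$ and $\mathrm{ord}\det B^{[i]}$ even) or ($\deg B^{[i]}$ odd and $\xi_{B^{[i-1]}}=0$); (PO5) if $C_i$ diagonal, $C_{i+1}$ not diagonal, $k_i=k_{i+1}-1$, then $\deg C_i=1$ and either ($\deg B^{[i]}$ even and $\mathrm{ord}\det B^{[i]}$ odd) or ($\deg B^{[i]}$ odd and $\xi_{B^{[i-1]}}\ne0$ if $i\ge2$); (PO6) if $\deg B^{[i]}$ even, $C_i,C_{i+1}$ unimodular diagonal, $k_{i+1}=k_i+1$, then $\xi_{B^{[i]}}=0$. *)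

theory Defs
  imports "HOL-Analysis.Analysis" "Jordan_Normal_Form.Determinant"
begin

text \<open>The valuation is a function ord :: 'a => int; its value at 0 is irrelevant
  (ord 0 = +infinity is encoded by always writing conditions through ordge).\<close>

definition ordge :: "('a::field \<Rightarrow> int) \<Rightarrow> 'a \<Rightarrow> int \<Rightarrow> bool" where
  "ordge ord x a \<longleftrightarrow> x = 0 \<or> a \<le> ord x"

definition in_o :: "('a::field \<Rightarrow> int) \<Rightarrow> 'a \<Rightarrow> bool" where
  "in_o ord x \<longleftrightarrow> ordge ord x 0"

definition is_unit_o :: "('a::field \<Rightarrow> int) \<Rightarrow> 'a \<Rightarrow> bool" where
  "is_unit_o ord x \<longleftrightarrow> x \<noteq> 0 \<and> ord x = 0"

text \<open>A complete discretely valued field of characteristic 0 with finite residue field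
  and normalized valuation with ord 2 = 1 (i.e. a finite unramified extension of Q_2).\<close>
definition unram_ext_Q2 :: "('a::field_char_0 \<Rightarrow> int) \<Rightarrow> bool" where
  "unram_ext_Q2 ord \<longleftrightarrow>
     (\<forall>x y. x \<noteq> 0 \<longrightarrow> y \<noteq> 0 \<longrightarrow> ord (x * y) = ord x + ord y) \<and>
     (\<forall>x y. x \<noteq> 0 \<longrightarrow> y \<noteq> 0 \<longrightarrow> x + y \<noteq> 0 \<longrightarrow> min (ord x) (ord y) \<le> ord (x + y)) \<and>
     ord 2 = 1 \<and>
     (\<exists>R. finite R \<and> (\<forall>r\<in>R. in_o ord r) \<and>
          (\<forall>x. in_o ord x \<longrightarrow> (\<exists>r\<in>R. ordge ord (x - r) 1))) \<and>
     (\<forall>X :: nat \<Rightarrow> 'a.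
        (\<forall>M. \<exists>N. \<forall>m\<ge>N. \<forall>l\<ge>N. ordge ord (X m - X l) M) \<longrightarrow>
        (\<exists>L. \<forall>M. \<exists>N. \<forall>m\<ge>N. ordge ord (X m - L) M))"

definition GL_o :: "('a::field \<Rightarrow> int) \<Rightarrow> nat \<Rightarrow> 'a mat set" where
  "GL_o ord n = {U. U \<in> carrier_mat n n \<and> (\<forall>i<n. \<forall>j<n. in_o ord (U $$ (i, j)))
                      \<and> is_unit_o ord (det U)}"

definition half_integral :: "('a::field \<Rightarrow> int) \<Rightarrow> nat \<Rightarrow> 'a mat \<Rightarrow> bool" where
  "half_integral ord n B \<longleftrightarrow> B \<in> carrier_mat n n \<and> transpose_mat B = B \<and>
     (\<forall>i<n. in_o ord (B $$ (i, i))) \<and> (\<forall>i<n. \<forall>j<n. in_o ord (2 * B $$ (i, j)))"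

definition GK_S :: "('a::field \<Rightarrow> int) \<Rightarrow> nat \<Rightarrow> 'a mat \<Rightarrow> nat list set" where
  "GK_S ord n B = {a. length a = n \<and> sorted a \<and>
      (\<forall>i<n. ordge ord (B $$ (i, i)) (int (a ! i))) \<and>
      (\<forall>i<n. \<forall>j<n. i \<le> j \<longrightarrow>
          (2 * B $$ (i, j) = 0 \<or> int (a ! i) + int (a ! j) \<le> 2 * ord (2 * B $$ (i, j))))}"

definition lex_le :: "nat list \<Rightarrow> nat list \<Rightarrow> bool" where
  "lex_le b a \<longleftrightarrow> b = a \<or> (\<exists>i < length a. take i b = take i a \<and> b ! i < a ! i)"

definition GK_union :: "('a::field \<Rightarrow> int) \<Rightarrow> nat \<Rightarrow> 'a mat \<Rightarrow> nat list set" where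
  "GK_union ord n B = (\<Union>U \<in> GL_o ord n. GK_S ord n (transpose_mat U * B * U))"

definition is_GK :: "('a::field \<Rightarrow> int) \<Rightarrow> nat \<Rightarrow> 'a mat \<Rightarrow> nat list \<Rightarrow> bool" where
  "is_GK ord n B a \<longleftrightarrow> a \<in> GK_union ord n B \<and> (\<forall>b \<in> GK_union ord n B. lex_le b a)"

definition optimal :: "('a::field \<Rightarrow> int) \<Rightarrow> nat \<Rightarrow> 'a mat \<Rightarrow> bool" where
  "optimal ord n B \<longleftrightarrow> (\<exists>a. is_GK ord n B a \<and> a \<in> GK_S ord n B)"

definition D_inv :: "nat \<Rightarrow> 'a::field mat \<Rightarrow> 'a" where
  "D_inv n B = (- 4) ^ (n div 2) * det B"

text \<open>For nonzero non-square D, K = F(sqrt D) is ramified over F iff the extension of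
  the valuation (ord_K(x + y sqrt D) = ord_F(x^2 - D y^2) / 2) takes a value outside Z,
  i.e. iff some nonzero norm x^2 - D y^2 has odd valuation (ramification index 2).\<close>
definition is_square :: "'a::field \<Rightarrow> bool" where
  "is_square D \<longleftrightarrow> (\<exists>x. D = x * x)"

definition ramified_sqrt :: "('a::field \<Rightarrow> int) \<Rightarrow> 'a \<Rightarrow> bool" where
  "ramified_sqrt ord D \<longleftrightarrow> (\<exists>x y. x * x - D * y * y \<noteq> 0 \<and> odd (ord (x * x - D * y * y)))"

definition xi :: "('a::field \<Rightarrow> int) \<Rightarrow> nat \<Rightarrow> 'a mat \<Rightarrow> int" where
  "xi ord n B = (let D = D_inv n B in
      if D \<noteq> 0 \<and> is_square D then 1
      else if D \<noteq> 0 \<and> \<not> ramified_sqrt ord D then -1 else 0)"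

definition unimod_diag :: "('a::field \<Rightarrow> int) \<Rightarrow> 'a mat \<Rightarrow> bool" where
  "unimod_diag ord C \<longleftrightarrow> (\<exists>m\<ge>1. C \<in> carrier_mat m m \<and>
      (\<forall>i<m. \<forall>j<m. i \<noteq> j \<longrightarrow> C $$ (i, j) = 0) \<and> (\<forall>i<m. is_unit_o ord (C $$ (i, i))))"

definition half_even_unimod :: "('a::field \<Rightarrow> int) \<Rightarrow> 'a mat \<Rightarrow> bool" where
  "half_even_unimod ord C \<longleftrightarrow> C \<in> carrier_mat 2 2 \<and>
     (let S = 2 \<cdot>\<^sub>m C in transpose_mat S = S \<and>
        (\<forall>i<2. \<forall>j<2. in_o ord (S $$ (i, j))) \<and>
        (\<forall>i<2. ordge ord (S $$ (i, i)) 1) \<and> is_unit_o ord (det S))"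

fun blockdiag :: "'a::zero mat list \<Rightarrow> 'a mat" where
  "blockdiag [] = 0\<^sub>m 0 0"
| "blockdiag (A # As) = (let R = blockdiag As in
     four_block_mat A (0\<^sub>m (dim_row A) (dim_col R)) (0\<^sub>m (dim_row R) (dim_col A)) R)"

text \<open>A form is given by the list bs = [(k_1, C_1), ..., (k_r, C_r)]; we use 1-based
  indices i as in the paper.\<close>
definition kk :: "(nat \<times> 'a mat) list \<Rightarrow> nat \<Rightarrow> nat" where
  "kk bs i = fst (bs ! (i - 1))"

definition CC :: "(nat \<times> 'a mat) list \<Rightarrow> nat \<Rightarrow> 'a mat" where
  "CC bs i = snd (bs ! (i - 1))"

definition Bpart :: "(nat \<times> 'a::field mat) list \<Rightarrow> nat \<Rightarrow> 'a mat" where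
  "Bpart bs j = blockdiag (map (\<lambda>(k, C). (2 ^ k) \<cdot>\<^sub>m C) (take j bs))"

definition degB :: "(nat \<times> 'a::field mat) list \<Rightarrow> nat \<Rightarrow> nat" where
  "degB bs j = dim_row (Bpart bs j)"

definition xiB :: "('a::field \<Rightarrow> int) \<Rightarrow> (nat \<times> 'a mat) list \<Rightarrow> nat \<Rightarrow> int" where
  "xiB ord bs j = xi ord (degB bs j) (Bpart bs j)"

definition orddetB :: "('a::field \<Rightarrow> int) \<Rightarrow> (nat \<times> 'a mat) list \<Rightarrow> nat \<Rightarrow> int" where
  "orddetB ord bs j = ord (det (Bpart bs j))"

definition isdiag :: "('a::field \<Rightarrow> int) \<Rightarrow> (nat \<times> 'a mat) list \<Rightarrow> nat \<Rightarrow> bool" where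
  "isdiag ord bs i \<longleftrightarrow> unimod_diag ord (CC bs i)"

definition Dset :: "('a::field \<Rightarrow> int) \<Rightarrow> (nat \<times> 'a mat) list \<Rightarrow> nat \<Rightarrow> nat set" where
  "Dset ord bs m = {j. 1 \<le> j \<and> j \<le> length bs \<and> kk bs j = m \<and> isdiag ord bs j}"

definition Eset :: "('a::field \<Rightarrow> int) \<Rightarrow> (nat \<times> 'a mat) list \<Rightarrow> nat \<Rightarrow> nat set" where
  "Eset ord bs m = {j. 1 \<le> j \<and> j \<le> length bs \<and> kk bs j = m \<and> \<not> isdiag ord bs j}"

definition block_form :: "('a::field \<Rightarrow> int) \<Rightarrow> (nat \<times> 'a mat) list \<Rightarrow> bool" where
  "block_form ord bs \<longleftrightarrow> (\<forall>(k, C) \<in> set bs. unimod_diag ord C \<or> half_even_unimod ord C)"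

definition PO1 :: "('a::field \<Rightarrow> int) \<Rightarrow> (nat \<times> 'a mat) list \<Rightarrow> bool" where
  "PO1 ord bs \<longleftrightarrow> (\<forall>m. (\<Sum>j\<in>Dset ord bs m. dim_row (CC bs j)) \<le> 2 \<and>
      (\<forall>i j l. i \<in> Eset ord bs m \<longrightarrow> j \<in> Eset ord bs m \<longrightarrow> i \<le> l \<longrightarrow> l \<le> j
               \<longrightarrow> l \<in> Eset ord bs m))"

definition PO2 :: "('a::field \<Rightarrow> int) \<Rightarrow> (nat \<times> 'a mat) list \<Rightarrow> bool" where
  "PO2 ord bs \<longleftrightarrow> (\<forall>i j m1 m2. i < j \<longrightarrow>
      (i \<in> Dset ord bs m1 \<longrightarrow> j \<in> Dset ord bs m2 \<longrightarrow> m1 \<le> m2) \<and>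
      (i \<in> Eset ord bs m1 \<longrightarrow> j \<in> Eset ord bs m2 \<longrightarrow> m1 \<le> m2) \<and>
      (i \<in> Dset ord bs m1 \<longrightarrow> j \<in> Eset ord bs m2 \<longrightarrow> int m1 \<le> int m2 - 1) \<and>
      (i \<in> Eset ord bs m1 \<longrightarrow> j \<in> Dset ord bs m2 \<longrightarrow> m1 \<le> m2 + 1))"

definition PO3 :: "('a::field \<Rightarrow> int) \<Rightarrow> (nat \<times> 'a mat) list \<Rightarrow> bool" where
  "PO3 ord bs \<longleftrightarrow> (\<forall>i. 1 \<le> i \<and> i \<le> length bs \<and> isdiag ord bs i \<and> dim_row (CC bs i) = 2 \<longrightarrow>
      i \<ge> 2 \<and>
      ((even (degB bs i) \<and> xiB ord bs (i - 1) = 0 \<and> xiB ord bs i = 0) \<or>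
       (odd (degB bs (i - 1)) \<and> even (orddetB ord bs (i - 1) + int (kk bs i)))))"

definition PO4 :: "('a::field \<Rightarrow> int) \<Rightarrow> (nat \<times> 'a mat) list \<Rightarrow> bool" where
  "PO4 ord bs \<longleftrightarrow> (\<forall>i. 2 \<le> i \<and> i \<le> length bs \<and> int (kk bs i) = int (kk bs (i - 1)) - 1 \<and>
        isdiag ord bs i \<and> \<not> isdiag ord bs (i - 1) \<longrightarrow>
      dim_row (CC bs i) = 2 \<or>
      (dim_row (CC bs i) = 1 \<and>
        ((even (degB bs i) \<and> even (orddetB ord bs i)) \<or>
         (odd (degB bs i) \<and> xiB ord bs (i - 1) = 0))))"

definition PO5 :: "('a::field \<Rightarrow> int) \<Rightarrow> (nat \<times> 'a mat) list \<Rightarrow> bool" where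
  "PO5 ord bs \<longleftrightarrow> (\<forall>i. 1 \<le> i \<and> i + 1 \<le> length bs \<and> isdiag ord bs i \<and>
        \<not> isdiag ord bs (i + 1) \<and> int (kk bs i) = int (kk bs (i + 1)) - 1 \<longrightarrow>
      dim_row (CC bs i) = 1 \<and>
        ((even (degB bs i) \<and> odd (orddetB ord bs i)) \<or>
         (odd (degB bs i) \<and> (i \<ge> 2 \<longrightarrow> xiB ord bs (i - 1) \<noteq> 0))))"

definition PO6 :: "('a::field \<Rightarrow> int) \<Rightarrow> (nat \<times> 'a mat) list \<Rightarrow> bool" where
  "PO6 ord bs \<longleftrightarrow> (\<forall>i. 1 \<le> i \<and> i + 1 \<le> length bs \<and> even (degB bs i) \<and>
        isdiag ord bs i \<and> isdiag ord bs (i + 1) \<and> kk bs (i + 1) = kk bs i + 1 \<longrightarrow>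
      xiB ord bs i = 0)"

definition pre_optimal :: "('a::field \<Rightarrow> int) \<Rightarrow> (nat \<times> 'a mat) list \<Rightarrow> bool" where
  "pre_optimal ord bs \<longleftrightarrow> block_form ord bs \<and>
     PO1 ord bs \<and> PO2 ord bs \<and> PO3 ord bs \<and> PO4 ord bs \<and> PO5 ord bs \<and> PO6 ord bs"

text \<open>A basis phi_1..phi_n of L_B (free o-module with basis psi_1..psi_n) is given by
  U in GL_n(o) via phi_j = sum_i U_ij psi_i; its Gram matrix (1/2)(phi_i, phi_j) is U^t B U.\<close>
definition optimal_basis :: "('a::field \<Rightarrow> int) \<Rightarrow> nat \<Rightarrow> 'a mat \<Rightarrow> 'a mat \<Rightarrow> bool" where
  "optimal_basis ord n B U \<longleftrightarrow> U \<in> GL_o ord n \<and> optimal ord n (transpose_mat U * B * U)"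

text \<open>The first m basis vectors lie in (and form a basis of) the span of psi_1..psi_m:
  U is block upper triangular and its top-left m x m block is in GL_m(o).\<close>
definition top_left :: "nat \<Rightarrow> 'a mat \<Rightarrow> 'a mat" where
  "top_left m U = mat m m (\<lambda>(i, j). U $$ (i, j))"

end

theory Submission
  imports Defs "HOL-Library.Function_Algebras"
begin

text \<open>
  A vector \<open>a\<close> in \<open>S(B)\<close> is the same as a norm \<open>N(\<Sum> x\<^sub>i e\<^sub>i) = min (a\<^sub>i + 2 ord x\<^sub>i)\<close> with
  \<open>ord Q(x) \<ge> N(x)\<close> and \<open>2 ord b(x, y) \<ge> N(x) + N(y)\<close>. The basis is optimal as soon as for every
  integer \<open>c\<close> the reduction of \<open>Q\<close> on the span of the \<open>e\<^sub>i\<close> with \<open>a\<^sub>i \<le> c\<close> has no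
  quadratic radical in degree \<open>c\<close>: a basis with a lexicographically larger vector would, level by
  level, generate the same truncated norms, until at the first difference its base change matrix has
  a non-unit determinant.

  Such a basis is built block by block, always of the form \<open>\<psi>\<^sub>j\<close> plus an integral combination of
  earlier vectors. The space with its norm splits orthogonally into a unimodular part and at most
  two lines, one of even and one of odd order. Zero, one or two lines correspond to \<open>\<xi> \<noteq> 0\<close>, to
  odd degree (the parity of the line being that of \<open>ord det\<close>), and to \<open>\<xi> = 0\<close>. A block
  \<open>2\<^sup>k C\<close> with \<open>C\<close> even just enlarges the unimodular part. A vector \<open>z\<close> of
  order \<open>k\<close> is corrected by the lines and receives the weight \<open>k\<close>, \<open>k + 1\<close> or \<open>k + 2\<close>; if it received
  \<open>k + 2\<close> and a second vector of order \<open>k\<close> follows, both get the weight \<open>k + 1\<close>. The conditions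
  (PO1)--(PO6) ensure that the weights stay non-decreasing.
\<close>

text \<open>Every unit is a square modulo 2, so the leading term of \<open>Q z\<close> can be
  cancelled by a multiple \<alpha> w of an earlier line exactly when \<open>Q z\<close> and
  \<open>Q w\<close> have orders of equal parity. This is why two lines of different parity are the
  most that can persist. The cancellation raises the order, but the cross term
  \<open>2 * \<alpha> * Q w\<close> has a fixed order, the 2 contributing exactly 1, and it caps the
  weight of \<open>z + \<alpha> \<cdot> w\<close> at \<open>k + 2\<close>. At this cap the new
  vector pairs perfectly with \<open>w\<close>, and both disappear into the unimodular part. The
  obstacle is a second vector of the same order \<open>k\<close>. Corrected along the same line, the
  two vectors have a product of order exactly \<open>k + 1\<close>, so their weights add up to at
  most \<open>2 * (k + 1)\<close>, and the weight \<open>k + 2\<close> already given to the first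
  one has to be lowered. Vectors are never changed afterwards, but weights may be. Hence the
  induction remembers, besides the current state, what can still be done from the state before the
  last vector. The discriminant is tracked only modulo squares and unramified classes: exactly as
  much as \<xi> and the parity of the determinant can see.\<close>

locale dyadic_field =
  fixes ord :: "'a::field_char_0 \<Rightarrow> int"
  assumes unram: "unram_ext_Q2 ord"
begin

text \<open>Orders are doubled, so that the bounds \<open>(a\<^sub>i + a\<^sub>j) / 2\<close> stay integral.\<close>

definition hge :: "'a \<Rightarrow> int \<Rightarrow> bool" where
  "hge x c \<longleftrightarrow> x = 0 \<or> c \<le> 2 * ord x"

section \<open>Arithmetic of the valuation and of doubled bounds\<close>

lemma ord_mult: "x \<noteq> 0 \<Longrightarrow> y \<noteq> 0 \<Longrightarrow> ord (x * y) = ord x + ord y"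
  using unram unfolding unram_ext_Q2_def by blast

lemma ord_add: "x \<noteq> 0 \<Longrightarrow> y \<noteq> 0 \<Longrightarrow> x + y \<noteq> 0 \<Longrightarrow> min (ord x) (ord y) \<le> ord (x + y)"
  using unram unfolding unram_ext_Q2_def by blast

lemma ord_2 [simp]: "ord 2 = 1"
  using unram unfolding unram_ext_Q2_def by blast

lemma ord_1 [simp]: "ord 1 = 0"
  using ord_mult[of 1 1] by simp

lemma ord_minus [simp]: "ord (- x) = ord x"
proof (cases "x = 0")
  case False
  have "ord (-1) + ord (-1) = 0"
    using ord_mult[of "-1" "-1"] by simp
  then show ?thesis
    using False ord_mult[of "-1" x] by simp
qed simp

lemma ord_power: "x \<noteq> 0 \<Longrightarrow> ord (x ^ n) = int n * ord x"
  by (induction n) (auto simp: ord_mult algebra_simps)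

lemma ord_4 [simp]: "ord 4 = 2"
  using ord_power[of 2 2] by simp

lemma ord_inverse: "x \<noteq> 0 \<Longrightarrow> ord (inverse x) = - ord x"
  using ord_mult[of x "inverse x"] by simp

lemma ord_divide: "x \<noteq> 0 \<Longrightarrow> y \<noteq> 0 \<Longrightarrow> ord (x / y) = ord x - ord y"
  by (simp add: divide_inverse ord_mult ord_inverse)

lemma ord_powi: "ord (2 powi e) = e"
  using ord_inverse[of "2 ^ nat (- e)"] by (cases "e \<ge> 0") (auto simp: power_int_def ord_power simp del: inverse_eq_divide simp flip: power_inverse)

lemma ordge_iff: "ordge ord x c \<longleftrightarrow> hge x (2 * c)"
  by (auto simp: ordge_def hge_def)

lemma hge_0 [simp]: "hge 0 c"
  by (simp add: hge_def)

lemma hge_refl [simp]: "hge x (2 * ord x)"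
  by (simp add: hge_def)

lemma hge_mono: "hge x c \<Longrightarrow> d \<le> c \<Longrightarrow> hge x d"
  by (auto simp: hge_def)

lemma hge_round: "hge x (2 * c - 1) \<Longrightarrow> hge x (2 * c)"
  by (auto simp: hge_def)

lemma hge_round_even: "hge x (c - 1) \<Longrightarrow> even c \<Longrightarrow> hge x c"
  by (auto simp: hge_def elim!: evenE)

lemma hge_minus [simp]: "hge (- x) c \<longleftrightarrow> hge x c"
  by (simp add: hge_def)

lemma hge_add: "hge x c \<Longrightarrow> hge y c \<Longrightarrow> hge (x + y) c"
  unfolding hge_def using ord_add[of x y] by fastforce

lemma hge_diff: "hge x c \<Longrightarrow> hge y c \<Longrightarrow> hge (x - y) c"
  using hge_add[of x c "- y"] by simp

lemma hge_sum: "(\<And>i. i \<in> A \<Longrightarrow> hge (f i) c) \<Longrightarrow> hge (sum f A) c"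
  by (induction A rule: infinite_finite_induct) (auto intro: hge_add)

lemma hge_mult: "hge x c \<Longrightarrow> hge y d \<Longrightarrow> hge (x * y) (c + d)"
  by (cases "x = 0 \<or> y = 0") (auto simp: hge_def ord_mult)

lemma hge_mult_0: "hge x 0 \<Longrightarrow> hge y 0 \<Longrightarrow> hge (x * y) 0"
  using hge_mult[of x 0 y 0] by simp

lemma hge_mult_le: "hge x c \<Longrightarrow> hge y d \<Longrightarrow> e \<le> c + d \<Longrightarrow> hge (x * y) e"
  using hge_mult hge_mono by blast

lemma hge_divide: "hge x c \<Longrightarrow> y \<noteq> 0 \<Longrightarrow> hge (x / y) (c - 2 * ord y)"
  by (cases "x = 0") (auto simp: hge_def ord_divide)

lemma hge_prod: "finite A \<Longrightarrow> (\<And>i. i \<in> A \<Longrightarrow> hge (f i) (c i)) \<Longrightarrow> hge (prod f A) (sum c A)"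
  by (induction A rule: finite_induct) (auto intro: hge_mult simp: hge_def[of 1])

lemma hge_numerals [simp]: "hge 2 2" "hge 4 4" "hge 1 0"
  by (auto simp: hge_def)

lemma hge_square: "hge (x * x) (2 * c) \<longleftrightarrow> hge x c"
  by (cases "x = 0") (auto simp: hge_def ord_mult)

lemma hge_mult_cancel: "x \<noteq> 0 \<Longrightarrow> hge (x * y) c \<longleftrightarrow> hge y (c - 2 * ord x)"
  by (cases "y = 0") (auto simp: hge_def ord_mult)

lemma ord_add_dominant:
  assumes "x \<noteq> 0" "hge y (2 * ord x + 1)"
  shows "x + y \<noteq> 0" "ord (x + y) = ord x"
proof -
  show nz: "x + y \<noteq> 0"
    using assms by (auto simp: hge_def eq_neg_iff_add_eq_0 [symmetric])
  show "ord (x + y) = ord x"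
  proof (cases "y = 0")
    case False
    then have y: "ord y > ord x" using assms by (auto simp: hge_def)
    then have "ord (x + y) \<ge> ord x" using ord_add[of x y] assms nz False by auto
    moreover have "ord x \<ge> min (ord (x + y)) (ord y)"
      using ord_add[of "x + y" "- y"] nz False assms by simp
    ultimately show ?thesis using y by auto
  qed simp
qed

text \<open>The residue field is finite, so the iterated Frobenius powers of \<open>u\<close> repeat
  modulo 2. Frobenius is injective there, and cancelling the common power makes \<open>u\<close>
  congruent to one of its own powers with even exponent.\<close>

lemma residue_square_root:
  assumes u: "hge u 0"
  shows "\<exists>\<alpha>. hge \<alpha> 0 \<and> hge (\<alpha> * \<alpha> - u) 2"
proof -
  have "\<exists>R. finite R \<and> (\<forall>r\<in>R. in_o ord r) \<and>
      (\<forall>x. in_o ord x \<longrightarrow> (\<exists>r\<in>R. ordge ord (x - r) 1))"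
    using unram unfolding unram_ext_Q2_def by (elim conjE)
  then obtain R where R: "finite R" "\<And>x. hge x 0 \<Longrightarrow> \<exists>r\<in>R. hge (x - r) 2"
    by (auto simp: in_o_def ordge_iff)
  define f where "f i = (SOME r. r \<in> R \<and> hge (u ^ (2 ^ i) - r) 2)" for i :: nat
  have upow: "hge (u ^ n) 0" for n
    using u by (induction n) (auto intro: hge_mult_0)
  have f: "f i \<in> R \<and> hge (u ^ (2 ^ i) - f i) 2" for i
    unfolding f_def using R(2)[OF upow[of "2 ^ i"]] by (rule_tac someI_ex) auto
  have "\<not> inj f"
    using f R(1) by (metis finite_imageD finite_subset image_subsetI infinite_UNIV_nat inj_def inj_on_def)
  then obtain i j where ij: "i < j" "f i = f j"
    by (metis injI linorder_neqE_nat)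
  have diff: "hge (u ^ (2 ^ i) - u ^ (2 ^ j)) 2"
    using hge_diff[OF conjunct2[OF f[of i]] conjunct2[OF f[of j]]] ij by simp
  \<comment> \<open>One application of Frobenius: \<open>(x - y) * (x - y)\<close> agrees with the
    difference of squares modulo 2, and an element whose square has positive order has positive
    order itself.\<close>
  have frob: "hge (x - y) 2" if "hge x 0" "hge y 0" "hge (x ^ (2 ^ i) - y ^ (2 ^ i)) 2" for x y i
    using that
  proof (induction i arbitrary: x y)
    case (Suc i)
    have "hge (x\<^sup>2 - y\<^sup>2) 2"
    proof (rule Suc.IH)
      show "hge (x\<^sup>2) 0" "hge (y\<^sup>2) 0"
        using Suc.prems by (auto simp: power2_eq_square intro: hge_mult_0)
      show "hge ((x\<^sup>2) ^ 2 ^ i - (y\<^sup>2) ^ 2 ^ i) 2"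
        using Suc.prems by (simp add: power_mult)
    qed
    moreover have "hge (2 * (y * (x - y))) 2"
      using Suc.prems by (intro hge_mult_le[of _ 2 _ 0] hge_mult_le[of _ 0 _ 0] hge_diff) auto
    ultimately have "hge ((x\<^sup>2 - y\<^sup>2) - 2 * (y * (x - y))) 2"
      by (rule hge_diff)
    moreover have "(x\<^sup>2 - y\<^sup>2) - 2 * (y * (x - y)) = (x - y) * (x - y)"
      by (simp add: power2_eq_square algebra_simps)
    ultimately have "hge (x - y) 1"
      using hge_square[of "x - y" 1] by simp
    then show ?case using hge_round[of "x - y" 1] by simp
  qed simp
  have e: "u ^ (2 ^ j) = (u ^ (2 ^ (j - i))) ^ (2 ^ i)"
    using ij by (simp flip: power_mult power_add)
  have "hge (u - u ^ (2 ^ (j - i))) 2"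
    by (rule frob[of _ _ i]) (use u upow diff e in auto)
  moreover have "u ^ (2 ^ (j - i)) = u ^ (2 ^ (j - i - 1)) * u ^ (2 ^ (j - i - 1))"
  proof -
    have "(2::nat) ^ (j - i) = 2 ^ (j - i - 1) + 2 ^ (j - i - 1)"
      using ij by (cases "j - i") auto
    then show ?thesis by (simp add: power_add)
  qed
  ultimately have "hge (u ^ (2 ^ (j - i - 1)) * u ^ (2 ^ (j - i - 1)) - u) 2"
    by (metis hge_minus minus_diff_eq)
  then show ?thesis using upow by blast
qed

text \<open>Equal parity allows a scaling by a power of 2 to reduce to units, where
  \<open>- y / x\<close> is a square modulo 2.\<close>

lemma square_cancel:
  assumes "x \<noteq> 0" "y \<noteq> 0" "even (ord x + ord y)"
  shows "\<exists>\<alpha>. \<alpha> \<noteq> 0 \<and> 2 * ord \<alpha> = ord y - ord x \<and> hge (y + \<alpha> * \<alpha> * x) (2 * ord y + 2)"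
proof -
  obtain e where e: "ord y - ord x = 2 * e"
    using assms(3) by (metis even_add even_diff evenE)
  define p :: 'a where "p = 2 powi e"
  have p: "p \<noteq> 0" "ord p = e" by (auto simp: p_def ord_powi)
  define u where "u = - y / (p * p * x)"
  have u: "u \<noteq> 0" "ord u = 0"
    using assms p e by (auto simp: u_def ord_divide ord_mult)
  obtain \<beta> where \<beta>: "hge \<beta> 0" "hge (\<beta> * \<beta> - u) 2"
    using residue_square_root[of u] u by (auto simp: hge_def)
  have "u + (\<beta> * \<beta> - u) \<noteq> 0" "ord (u + (\<beta> * \<beta> - u)) = ord u"
    by (rule ord_add_dominant; use u \<beta> hge_mono in force)+
  then have b: "\<beta> \<noteq> 0" "ord \<beta> = 0"
    using u by (auto simp: ord_mult)
  have "hge (p * p * x * (\<beta> * \<beta> - u)) (2 * ord (p * p * x) + 2)"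
    using \<beta>(2) hge_mult[OF hge_refl] by blast
  moreover have "p * p * x * (\<beta> * \<beta> - u) = y + (p * \<beta>) * (p * \<beta>) * x"
    using p assms by (simp add: u_def field_simps)
  moreover have "ord (p * p * x) = ord y"
    using p assms e by (simp add: ord_mult)
  ultimately show ?thesis
    using b p e by (intro exI[of _ "p * \<beta>"]) (auto simp: ord_mult)
qed

section \<open>Unramified and ramified discriminants\<close>

text \<open>\<open>1 + 4 * y\<close> is the discriminant of the Artin-Schreier polynomial t^2 + t -
  y, so these are the D for which F(sqrt D) is F itself or the unramified quadratic
  extension.\<close>

definition unramified_class :: "'a set" where
  "unramified_class = {s * s * (1 + 4 * y) | s y. s \<noteq> 0 \<and> hge y 0}"

lemma unit_1_4: "hge y 0 \<Longrightarrow> 1 + 4 * y \<noteq> 0 \<and> ord (1 + 4 * y) = 0"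
  using ord_add_dominant[of 1 "4 * y"] hge_mult_le[of 4 4 y 0 1] by auto

lemma unramified_classI: "s \<noteq> 0 \<Longrightarrow> hge y 0 \<Longrightarrow> x = s * s * (1 + 4 * y) \<Longrightarrow> x \<in> unramified_class"
  by (auto simp: unramified_class_def)

lemma unramified_class_mult:
  assumes "x \<in> unramified_class" "y \<in> unramified_class"
  shows "x * y \<in> unramified_class"
proof -
  obtain s t p q where *: "s \<noteq> 0" "hge p 0" "x = s * s * (1 + 4 * p)"
    "t \<noteq> 0" "hge q 0" "y = t * t * (1 + 4 * q)"
    using assms by (auto simp: unramified_class_def)
  show ?thesis
  proof (rule unramified_classI)
    show "hge (p + q + 4 * (p * q)) 0"
      using * by (intro hge_add hge_mult_0) (auto simp: hge_def[of 4])
    show "s * t \<noteq> 0" using * by simp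
    show "x * y = s * t * (s * t) * (1 + 4 * (p + q + 4 * (p * q)))"
      using * by (simp add: algebra_simps)
  qed
qed

lemma unramified_class_inverse:
  assumes "x \<in> unramified_class"
  shows "inverse x \<in> unramified_class"
proof -
  obtain s p where *: "s \<noteq> 0" "hge p 0" "x = s * s * (1 + 4 * p)"
    using assms by (auto simp: unramified_class_def)
  have u: "1 + 4 * p \<noteq> 0" "ord (1 + 4 * p) = 0" using unit_1_4[OF *(2)] by auto
  show ?thesis
  proof (rule unramified_classI)
    show "hge (- p / (1 + 4 * p)) 0"
      using hge_divide[of "- p" 0 "1 + 4 * p"] * u by simp
    show "inverse s \<noteq> 0" using * by simp
    show "inverse x = inverse s * inverse s * (1 + 4 * (- p / (1 + 4 * p)))"
      using * u by (simp add: field_simps)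
  qed
qed

lemma unramified_class_square: "s \<noteq> 0 \<Longrightarrow> s * s \<in> unramified_class"
  by (rule unramified_classI[of s 0]) auto

lemma unramified_class_ord:
  assumes "x \<in> unramified_class"
  shows "x \<noteq> 0" "even (ord x)"
  using assms unit_1_4 by (auto simp: unramified_class_def ord_mult)

text \<open>The derivative 2t + 1 is congruent to 1, so Newton's iteration converges even with the
  derivative replaced by 1; completeness supplies the limit.\<close>

lemma artin_schreier_root:
  assumes "hge m 0" "hge t 0" "hge (t * t + t - m) 2"
  shows "\<exists>r. r * r + r = m"
proof -
  define f where "f t = t * t + t - m" for t
  define X where "X = rec_nat t (\<lambda>_ x. x - f x)"
  have X0: "X 0 = t" and XS: "\<And>n. X (Suc n) = X n - f (X n)" by (auto simp: X_def)
  have inv: "hge (X n) 0 \<and> hge (f (X n)) (2 * int (Suc n))" for n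
  proof (induction n)
    case 0
    then show ?case using assms by (simp add: X0 f_def)
  next
    case (Suc n)
    \<comment> \<open>The second factor has positive order, so each iteration gains at least one
      order of precision.\<close>
    have e: "f (X (Suc n)) = f (X n) * (f (X n) - 2 * X n)"
      by (simp add: XS f_def algebra_simps)
    have "hge (f (X n)) 2" using Suc hge_mono by fastforce
    moreover have "hge (2 * X n) 2" using Suc by (intro hge_mult_le[of 2 2 _ 0]) auto
    ultimately have "hge (f (X (Suc n))) (2 * int (Suc n) + 2)"
      unfolding e using Suc by (intro hge_mult hge_diff) auto
    moreover have "hge (X (Suc n)) 0"
      unfolding XS using Suc by (intro hge_diff) (auto intro: hge_mono)
    ultimately show ?case by (simp add: algebra_simps)
  qed
  have step: "hge (X (n + k) - X n) (2 * int (Suc n))" for n k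
  proof (induction k)
    case (Suc k)
    have "hge (f (X (n + k))) (2 * int (Suc n))"
      using inv[of "n + k"] by (auto intro: hge_mono)
    then have "hge ((X (n + k) - X n) - f (X (n + k))) (2 * int (Suc n))"
      using hge_diff[OF Suc] by blast
    then show ?case by (simp add: XS algebra_simps)
  qed simp
  have cauchy: "\<exists>N. \<forall>m\<ge>N. \<forall>l\<ge>N. ordge ord (X m - X l) M" for M
  proof (intro exI allI impI)
    fix m l assume ml: "m \<ge> nat M" "l \<ge> nat M"
    have "hge ((X m - X (nat M)) - (X l - X (nat M))) (2 * int (Suc (nat M)))"
      using hge_diff[OF step[of "nat M" "m - nat M"] step[of "nat M" "l - nat M"]] ml by simp
    then show "ordge ord (X m - X l) M"
      unfolding ordge_iff by (auto elim!: hge_mono)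
  qed
  have "\<forall>X :: nat \<Rightarrow> 'a. (\<forall>M. \<exists>N. \<forall>m\<ge>N. \<forall>l\<ge>N. ordge ord (X m - X l) M) \<longrightarrow>
      (\<exists>L. \<forall>M. \<exists>N. \<forall>m\<ge>N. ordge ord (X m - L) M)"
    using unram unfolding unram_ext_Q2_def by (elim conjE)
  from this[THEN spec, THEN mp, of X] cauchy
  obtain L where L: "\<And>M. \<exists>N. \<forall>m\<ge>N. ordge ord (X m - L) M"
    by fast
  have "hge (f L) (2 * M)" if "M \<ge> 0" for M
  proof -
    obtain N where N: "\<And>m. m \<ge> N \<Longrightarrow> hge (X m - L) (2 * M)"
      using L[of M] by (auto simp: ordge_iff)
    define n where "n = max N (nat M)"
    have d: "hge (X n - L) (2 * M)" using N by (simp add: n_def)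
    then have d0: "hge (X n - L) 0" using that hge_mono by fastforce
    have L0: "hge L 0" using hge_diff[OF _ d0, of "X n"] inv[of n] by simp
    have "hge ((X n - L) * (X n + L + 1)) (2 * M)"
      using d L0 inv[of n] by (intro hge_mult_le[of _ _ _ 0]) (auto intro!: hge_add)
    moreover have "hge (f (X n)) (2 * M)"
      using inv[of n] by (auto simp: n_def elim!: hge_mono)
    ultimately have "hge (f (X n) - (X n - L) * (X n + L + 1)) (2 * M)"
      by (rule hge_diff[rotated])
    then show ?thesis by (simp add: f_def algebra_simps)
  qed
  \<comment> \<open>A nonzero \<open>f L\<close> would have an order larger than its own absolute
    value.\<close>
  from this[of "\<bar>ord (f L)\<bar> + 1"] have "f L = 0"
    by (auto simp: hge_def)
  then show ?thesis unfolding f_def by (intro exI[of _ L]) simp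
qed

text \<open>A norm from F(sqrt D) is a square times t^2 + t - m. If t is not integral, t^2 dominates
  and the order is even; if t is integral, an odd order makes t a root modulo 2, which lifts to a
  root, and then D is a square.\<close>

lemma unramified_class_not_ramified:
  assumes D: "D \<in> unramified_class" and ns: "\<not> is_square D"
  shows "\<not> ramified_sqrt ord D"
proof
  assume "ramified_sqrt ord D"
  then obtain x y where xy: "x * x - D * y * y \<noteq> 0" "odd (ord (x * x - D * y * y))"
    by (auto simp: ramified_sqrt_def)
  obtain s m where s: "s \<noteq> 0" "hge m 0" "D = s * s * (1 + 4 * m)"
    using D by (auto simp: unramified_class_def)
  \<comment> \<open>Coordinates in which the norm form becomes p^2 + pq - mq^2, without
    denominators.\<close>
  define p where "p = x - s * y"
  define q where "q = 2 * (s * y)"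
  have e: "x * x - D * y * y = p * p + p * q - m * q * q"
    by (simp add: s p_def q_def algebra_simps)
  have q0: "q \<noteq> 0"
  proof
    assume "q = 0"
    then have "x * x - D * y * y = p * p" by (simp add: e)
    then show False using xy by (auto simp: ord_mult)
  qed
  define t where "t = p / q"
  have e2: "x * x - D * y * y = q * q * (t * t + t - m)"
    unfolding e t_def using q0 by (simp add: field_simps)
  define g where "g = t * t + t - m"
  have g: "g \<noteq> 0" "odd (ord g)"
    using xy q0 unfolding e2 g_def[symmetric] by (auto simp: ord_mult)
  have t0: "hge t 0"
  proof (rule ccontr)
    assume "\<not> hge t 0"
    then have t: "t \<noteq> 0" "ord t < 0" by (auto simp: hge_def)
    have "hge (t - m) (2 * ord (t * t) + 1)"
      using t s by (intro hge_diff) (auto simp: hge_def ord_mult)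
    then have "ord (t * t + (t - m)) = ord (t * t)"
      using t by (intro ord_add_dominant) auto
    then have "ord g = 2 * ord t" using t by (simp add: g_def ord_mult algebra_simps)
    then show False using g by simp
  qed
  have "hge g 0" unfolding g_def using t0 s by (intro hge_add hge_diff) (auto intro: hge_mult_0)
  then have "hge g 2" using g by (auto simp: hge_def elim!: oddE)
  then obtain r where "r * r + r = m"
    using artin_schreier_root[OF s(2) t0] by (auto simp: g_def)
  then have "D = (s * (2 * r + 1)) * (s * (2 * r + 1))"
    using s(3) by (auto simp: algebra_simps)
  then show False using ns by (auto simp: is_square_def)
qed

definition ramified_class :: "'a \<Rightarrow> bool" where
  "ramified_class D \<longleftrightarrow> D \<noteq> 0 \<and> \<not> is_square D \<and> ramified_sqrt ord D"

lemma ramified_class_odd: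
  assumes "D \<noteq> 0" "odd (ord D)"
  shows "ramified_class D"
proof -
  have "ramified_sqrt ord D"
    unfolding ramified_sqrt_def using assms by (intro exI[of _ 0] exI[of _ 1]) simp
  moreover have "\<not> is_square D"
    using assms by (auto simp: is_square_def ord_mult)
  ultimately show ?thesis using assms by (simp add: ramified_class_def)
qed

text \<open>Scaling by \<open>s\<close>, the element 1 - (1 + t) = -t is a norm of odd order. A
  square root of \<open>1 + t\<close> would factor \<open>t\<close> into two numbers differing by 2:
  either both have positive order, or their orders agree, and neither fits the total order
  1.\<close>

lemma ramified_class_unit:
  assumes "s \<noteq> 0" "D = s * s * (1 + t)" "t \<noteq> 0" "ord t = 1"
  shows "ramified_class D"
proof -
  have u: "1 + t \<noteq> 0" "ord (1 + t) = 0"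
    using ord_add_dominant[of 1 t] assms by (auto simp: hge_def)
  have "1 * 1 - D * inverse s * inverse s = - t"
    using assms by (simp add: field_simps)
  then have "ramified_sqrt ord D"
    unfolding ramified_sqrt_def using assms
    by (intro exI[of _ 1] exI[of _ "inverse s"]) auto
  moreover have "\<not> is_square D"
  proof
    assume "is_square D"
    then obtain x where "D = x * x" by (auto simp: is_square_def)
    define y where "y = x / s"
    have y: "y * y = 1 + t"
      using assms \<open>D = x * x\<close> by (simp add: y_def field_simps)
    have f: "(y - 1) * (y + 1) = t" using y by (simp add: algebra_simps)
    then have nz: "y - 1 \<noteq> 0" "y + 1 \<noteq> 0" using assms by auto
    have o: "ord (y - 1) + ord (y + 1) = 1" using f assms nz by (metis ord_mult)
    consider "ord (y - 1) \<ge> 1" | "ord (y - 1) \<le> 0" by linarith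
    then show False
    proof cases
      case 1
      then have "hge ((y - 1) + 2) 2"
        by (intro hge_add) (auto simp: hge_def)
      then have "hge (y + 1) 2" by (simp add: algebra_simps)
      then show False using nz o 1 by (auto simp: hge_def)
    next
      case 2
      then have "ord ((y - 1) + 2) = ord (y - 1)"
        using nz by (intro ord_add_dominant) (auto simp: hge_def)
      then have "ord (y + 1) = ord (y - 1)" by (simp add: algebra_simps)
      then show False using o by presburger
    qed
  qed
  ultimately show ?thesis using assms u by (auto simp: ramified_class_def)
qed

lemma xi_unramified: "D_inv n B \<in> unramified_class \<Longrightarrow> xi ord n B \<noteq> 0"
  using unramified_class_not_ramified unramified_class_ord by (auto simp: xi_def Let_def)

lemma xi_ramified: "ramified_class (D_inv n B) \<Longrightarrow> xi ord n B = 0"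
  by (auto simp: xi_def Let_def ramified_class_def)

section \<open>Determinants and adjugates under weighted bounds\<close>

text \<open>Every term of the Leibniz expansion meets each row and each column once, so all terms
  obey the same bound.\<close>

lemma det_bound:
  assumes M: "M \<in> carrier_mat n n"
    and bd: "\<And>i j. i < n \<Longrightarrow> j < n \<Longrightarrow> hge (M $$ (i, j)) (g j - f i)"
  shows "hge (det M) (sum g {0..<n} - sum f {0..<n})"
  unfolding det_def'[OF M]
proof (rule hge_sum)
  fix p assume "p \<in> {p. p permutes {0..<n}}"
  then have p: "p permutes {0..<n}" by simp
  have "hge (\<Prod>i = 0..<n. M $$ (i, p i)) (\<Sum>i = 0..<n. g (p i) - f i)"
    using permutes_in_image[OF p] by (intro hge_prod bd) auto
  moreover have "(\<Sum>i = 0..<n. g (p i) - f i) = sum g {0..<n} - sum f {0..<n}"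
    using sum.permute[OF p, of g] by (simp add: sum_subtractf comp_def)
  moreover have "hge (signof p :: 'a) 0"
    by (simp add: sign_def hge_def)
  ultimately show "hge (signof p * (\<Prod>i = 0..<n. M $$ (i, p i))) (sum g {0..<n} - sum f {0..<n})"
    using hge_mult[of "signof p" 0] by auto
qed

lemma sum_insert_index:
  fixes s :: "nat \<Rightarrow> int"
  assumes "i < n"
  shows "(\<Sum>j = 0..<n - 1. s (insert_index i j)) = sum s {0..<n} - s i"
proof -
  have "insert_index i ` {0..<n - 1} = {0..<n} - {i}"
    using insert_index_image[of i "n - 1"] assms by (simp add: lessThan_atLeast0)
  then have "(\<Sum>j = 0..<n - 1. s (insert_index i j)) = sum s ({0..<n} - {i})"
    using sum.reindex[OF insert_index_inj_on, of s i "{0..<n - 1}"] by simp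
  then show ?thesis using assms by (simp add: sum_diff1)
qed

text \<open>Deleting row \<open>j\<close> and column \<open>i\<close> removes \<open>s j\<close>
  from the row sum and \<open>s i\<close> from the column sum. Thus the inverse of a unimodular
  matrix respecting the weights \<open>s\<close> respects them too.\<close>

lemma adj_bound:
  assumes U: "U \<in> carrier_mat n n"
    and bd: "\<And>i j. i < n \<Longrightarrow> j < n \<Longrightarrow> hge (U $$ (i, j)) (s j - s i)"
    and ij: "i < n" "j < n"
  shows "hge (adj_mat U $$ (i, j)) (s j - s i)"
proof -
  have M: "mat_delete U j i \<in> carrier_mat (n - 1) (n - 1)"
    by (rule mat_delete_carrier) (use U in simp)
  have "hge (det (mat_delete U j i))
    ((\<Sum>l = 0..<n - 1. s (insert_index i l)) - (\<Sum>l = 0..<n - 1. s (insert_index j l)))"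
  proof (rule det_bound[OF M])
    fix k l assume kl: "k < n - 1" "l < n - 1"
    have "mat_delete U j i $$ (k, l) = U $$ (insert_index j k, insert_index i l)"
      by (rule mat_delete_index[symmetric, of _ "n - 1"]) (use kl U ij in simp_all)
    moreover have "insert_index j k < n" "insert_index i l < n"
      using kl by (auto simp: insert_index_def)
    ultimately show "hge (mat_delete U j i $$ (k, l)) (s (insert_index i l) - s (insert_index j k))"
      using bd by simp
  qed
  then have "hge (det (mat_delete U j i)) (s j - s i)"
    unfolding sum_insert_index[OF ij(1)] sum_insert_index[OF ij(2)] by simp
  then have "hge ((- 1) ^ (j + i) * det (mat_delete U j i)) (0 + (s j - s i))"
    by (rule hge_mult[rotated]) (simp add: hge_def ord_power)
  then show ?thesis
    using U ij by (simp add: adj_mat_def cofactor_def)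
qed

end

section \<open>Quadratic spaces with a norm\<close>

locale dyadic_quadratic_space = dyadic_field ord + vector_space scale
  for ord :: "'a::field_char_0 \<Rightarrow> int" and scale :: "'a \<Rightarrow> 'v::ab_group_add \<Rightarrow> 'v" (infixr \<open>\<cdot>\<close> 75) +
  fixes b :: "'v \<Rightarrow> 'v \<Rightarrow> 'a"
  assumes b_sym: "b x y = b y x"
    and b_add_left: "b (x + y) z = b x z + b y z"
    and b_scale_left: "b (t \<cdot> x) y = t * b x y"
begin

lemma b_add_right: "b z (x + y) = b z x + b z y"
  by (metis b_add_left b_sym)

lemma b_scale_right: "b x (t \<cdot> y) = t * b x y"
  by (metis b_scale_left b_sym)

lemma b_zero [simp]: "b 0 x = 0" "b x 0 = 0"
  using b_scale_left[of 0 0 x] b_scale_right[of x 0 0] by auto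

lemma b_minus: "b (- x) y = - b x y" "b x (- y) = - b x y"
  using b_scale_left[of "-1" x y] b_scale_right[of x "-1" y] by auto

lemma b_diff: "b (x - y) z = b x z - b y z" "b z (x - y) = b z x - b z y"
  using b_add_left[of x "- y" z] b_add_right[of z x "- y"] by (auto simp: b_minus)

lemmas b_simps = b_add_left b_add_right b_scale_left b_scale_right b_minus b_diff

definition Q :: "'v \<Rightarrow> 'a" where "Q x = b x x / 2"

lemma b_self: "b x x = 2 * Q x"
  by (simp add: Q_def)

lemma Q_add: "Q (x + y) = Q x + Q y + b x y"
  by (simp add: Q_def b_simps b_sym[of y x] field_simps)

lemma Q_scale: "Q (t \<cdot> x) = t * t * Q x"
  by (simp add: Q_def b_simps)

lemma Q_0 [simp]: "Q 0 = 0"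
  by (simp add: Q_def)

text \<open>The norm is encoded by its superlevel sets: \<open>N x c\<close> says that the norm of
  \<open>x\<close> is at least \<open>c\<close>. This spares the value infinity at 0 and any minimum
  or supremum when norms are extended.\<close>

definition is_norm :: "('v \<Rightarrow> int \<Rightarrow> bool) \<Rightarrow> bool" where
  "is_norm N \<longleftrightarrow> (\<forall>c. N 0 c) \<and> (\<forall>x y c. N x c \<longrightarrow> N y c \<longrightarrow> N (x + y) c) \<and>
     (\<forall>x c t d. N x c \<longrightarrow> hge t d \<longrightarrow> N (t \<cdot> x) (c + d)) \<and>
     (\<forall>x c d. N x c \<longrightarrow> d \<le> c \<longrightarrow> N x d) \<and>
     (\<forall>x c. N x c \<longrightarrow> hge (Q x) (2 * c)) \<and>
     (\<forall>x y c d. N x c \<longrightarrow> N y d \<longrightarrow> hge (b x y) (c + d))"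

lemma norm_0: "is_norm N \<Longrightarrow> N 0 c"
  and norm_add: "is_norm N \<Longrightarrow> N x c \<Longrightarrow> N y c \<Longrightarrow> N (x + y) c"
  and norm_scale: "is_norm N \<Longrightarrow> N x c \<Longrightarrow> hge t d \<Longrightarrow> N (t \<cdot> x) (c + d)"
  and norm_Q: "is_norm N \<Longrightarrow> N x c \<Longrightarrow> hge (Q x) (2 * c)"
  and norm_b: "is_norm N \<Longrightarrow> N x c \<Longrightarrow> N y d \<Longrightarrow> hge (b x y) (c + d)"
  by (simp_all add: is_norm_def)

lemma norm_mono: "is_norm N \<Longrightarrow> N x c \<Longrightarrow> d \<le> c \<Longrightarrow> N x d"
  unfolding is_norm_def by (elim conjE) metis

lemma norm_scale': "is_norm N \<Longrightarrow> N x c \<Longrightarrow> hge t (d - c) \<Longrightarrow> N (t \<cdot> x) d"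
  using norm_scale[of N x c t "d - c"] by simp

lemma norm_minus: "is_norm N \<Longrightarrow> N x c \<Longrightarrow> N (- x) c"
  using norm_scale'[of N x c "-1" c] by (simp add: hge_def)

lemma norm_diff: "is_norm N \<Longrightarrow> N x c \<Longrightarrow> N y c \<Longrightarrow> N (x - y) c"
  using norm_add[of N x c "- y"] norm_minus[of N y c] by simp

definition ext :: "('v \<Rightarrow> int \<Rightarrow> bool) \<Rightarrow> 'v \<Rightarrow> int \<Rightarrow> 'v \<Rightarrow> int \<Rightarrow> bool" where
  "ext N z k x c \<longleftrightarrow> (\<exists>x' t. x = x' + t \<cdot> z \<and> N x' c \<and> hge t (c - k))"

lemma ext_base: "N x c \<Longrightarrow> ext N z k x c"
  unfolding ext_def by (rule exI[of _ x], rule exI[of _ 0]) auto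

lemma ext_new: "is_norm N \<Longrightarrow> hge t (c - k) \<Longrightarrow> ext N z k (t \<cdot> z) c"
  unfolding ext_def by (rule exI[of _ 0], rule exI[of _ t]) (auto simp: norm_0)

lemma ext_new_1: "is_norm N \<Longrightarrow> ext N z k z k"
  using ext_new[of N 1 k k z] by simp

lemma bound_ext:
  assumes "\<And>x d. N x d \<Longrightarrow> hge (b x q) (d + a)" "hge (b z q) (k + a)" "ext N z k x d"
  shows "hge (b x q) (d + a)"
proof -
  obtain x' t where x: "x = x' + t \<cdot> z" "N x' d" "hge t (d - k)"
    using assms(3) by (auto simp: ext_def)
  have "hge (t * b z q) (d + a)"
    using x assms(2) by (intro hge_mult_le[of t "d - k" _ "k + a"]) auto
  then show ?thesis using assms(1)[OF x(2)] by (simp add: x b_simps hge_add)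
qed

lemma is_norm_ext:
  assumes N: "is_norm N" and Qz: "hge (Q z) (2 * k)"
    and bz: "\<And>x d. N x d \<Longrightarrow> hge (b x z) (d + k)"
  shows "is_norm (ext N z k)"
proof -
  have bzz: "hge (b z z) (k + k)"
    unfolding b_self using Qz by (intro hge_mult_le[of _ 2 _ "2 * k"]) auto
  have bz': "hge (b x z) (d + k)" if "ext N z k x d" for x d
    using bound_ext[OF bz bzz that] by blast
  have add: "ext N z k (x + y) c" if xy: "ext N z k x c" "ext N z k y c" for x y c
  proof -
    obtain x' t where x: "x = x' + t \<cdot> z" "N x' c" "hge t (c - k)"
      using xy(1) by (auto simp: ext_def)
    obtain y' s where y: "y = y' + s \<cdot> z" "N y' c" "hge s (c - k)"
      using xy(2) by (auto simp: ext_def)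
    show ?thesis unfolding ext_def
      by (intro exI[of _ "x' + y'"] exI[of _ "t + s"])
        (use x y N in \<open>auto simp: scale_left_distrib norm_add hge_add\<close>)
  qed
  have sc: "ext N z k (s \<cdot> x) (c + d)" if x: "ext N z k x c" and s: "hge s d" for x c s d
  proof -
    obtain x' t where x: "x = x' + t \<cdot> z" "N x' c" "hge t (c - k)"
      using x by (auto simp: ext_def)
    have "hge (s * t) (c + d - k)"
      using s x by (intro hge_mult_le[of s d t "c - k"]) auto
    then show ?thesis unfolding ext_def
      by (intro exI[of _ "s \<cdot> x'"] exI[of _ "s * t"])
        (use x s N in \<open>auto simp: scale_right_distrib norm_scale\<close>)
  qed
  have bb: "hge (b x y) (c + d)" if x: "ext N z k x c" and y: "ext N z k y d" for x y c d
  proof -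
    obtain y' s where y: "y = y' + s \<cdot> z" "N y' d" "hge s (d - k)"
      using y by (auto simp: ext_def)
    have "hge (b x y') (c + d)"
    proof -
      obtain x' t where x: "x = x' + t \<cdot> z" "N x' c" "hge t (c - k)"
        using x by (auto simp: ext_def)
      have "hge (t * b z y') (c + d)"
        using x bz[OF y(2)] by (intro hge_mult_le[of t "c - k" _ "d + k"]) (auto simp: b_sym[of z])
      then show ?thesis using norm_b[OF N x(2) y(2)] by (simp add: x b_simps hge_add)
    qed
    moreover have "hge (s * b x z) (c + d)"
      using y bz'[OF x] by (intro hge_mult_le[of s "d - k" _ "c + k"]) auto
    ultimately show ?thesis by (simp add: y b_simps hge_add)
  qed
  have q: "hge (Q x) (2 * c)" if x: "ext N z k x c" for x c
  proof -
    obtain x' t where x': "x = x' + t \<cdot> z" "N x' c" "hge t (c - k)"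
      using x by (auto simp: ext_def)
    have "hge (t * t * Q z) (2 * c)"
      using x' Qz by (intro hge_mult_le[of "t * t" "(c - k) + (c - k)" _ "2 * k"] hge_mult) auto
    moreover have "hge (t * b x' z) (2 * c)"
      using x' bz[OF x'(2)] by (intro hge_mult_le[of t "c - k" _ "c + k"]) auto
    ultimately show ?thesis using norm_Q[OF N x'(2)]
      by (simp add: x' Q_add Q_scale b_simps hge_add)
  qed
  have mono: "ext N z k x d" if x: "ext N z k x c" and d: "d \<le> c" for x c d
    using x d norm_mono[OF N] hge_mono unfolding ext_def
    by (metis diff_right_mono)
  show ?thesis
    unfolding is_norm_def
  proof (intro conjI allI impI)
    show "ext N z k 0 c" for c
      using norm_0[OF N] by (rule ext_base)
  qed (rule add sc mono q bb; assumption)+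
qed

text \<open>The weight is attained by the order of \<open>Q u\<close>, so on the line through
  \<open>u\<close> the norm can be read off from \<open>Q\<close>.\<close>

definition isT :: "('v \<Rightarrow> int \<Rightarrow> bool) \<Rightarrow> 'v \<Rightarrow> int \<Rightarrow> bool" where
  "isT N u \<kappa> \<longleftrightarrow> N u \<kappa> \<and> Q u \<noteq> 0 \<and> ord (Q u) = \<kappa>"

lemma isT_coeff:
  assumes "is_norm N" "isT N u \<kappa>" "N (t \<cdot> u) c"
  shows "hge t (c - \<kappa>)"
proof -
  have "hge (Q u * (t * t)) (2 * c)"
    using norm_Q[OF assms(1,3)] by (simp add: Q_scale ac_simps)
  moreover have "Q u \<noteq> 0" "ord (Q u) = \<kappa>"
    using assms(2) by (auto simp: isT_def)
  ultimately have "hge (t * t) (2 * c - 2 * \<kappa>)"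
    by (simp add: hge_mult_cancel)
  then have "hge (t * t) (2 * (c - \<kappa>))"
    by (simp add: right_diff_distrib)
  then show ?thesis by (simp only: hge_square)
qed

lemma isT_ext: "isT N u \<kappa> \<Longrightarrow> isT (ext N z k) u \<kappa>"
  by (auto simp: isT_def ext_base)

section \<open>Splitting into a unimodular part and lines\<close>

text \<open>The bound is demanded of each summand, which is what makes a decomposition along
  \<open>T\<close> compatible with the norm.\<close>

fun in_span :: "('v \<Rightarrow> int \<Rightarrow> bool) \<Rightarrow> 'v list \<Rightarrow> 'v \<Rightarrow> int \<Rightarrow> bool" where
  "in_span N [] x c = (x = 0)"
| "in_span N (u # us) x c = (\<exists>t y. x = t \<cdot> u + y \<and> N (t \<cdot> u) c \<and> in_span N us y c)"

lemma in_span_ext: "in_span N T x c \<Longrightarrow> in_span (ext N z k) T x c"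
  by (induction T arbitrary: x) (auto intro: ext_base)

lemma in_span_swap:
  assumes "in_span N (u # v # T) x c"
  shows "in_span N (v # u # T) x c"
proof -
  obtain t s y where "x = t \<cdot> u + (s \<cdot> v + y)" "N (t \<cdot> u) c" "N (s \<cdot> v) c" "in_span N T y c"
    using assms by auto
  then have "x = s \<cdot> v + (t \<cdot> u + y) \<and> N (s \<cdot> v) c \<and> in_span N (u # T) (t \<cdot> u + y) c"
    by (auto simp: algebra_simps)
  then show ?thesis by (metis in_span.simps(2))
qed

text \<open>The space splits orthogonally, compatibly with the norm, into the part \<open>R\<close>, on which the
  bilinear form is unimodular with respect to the norm, and the lines spanned by \<open>T\<close>.\<close>

definition NF :: "('v \<Rightarrow> int \<Rightarrow> bool) \<Rightarrow> ('v \<Rightarrow> bool) \<Rightarrow> 'v list \<Rightarrow> bool" where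
  "NF N R T \<longleftrightarrow> R 0 \<and> (\<forall>y. R y \<longrightarrow> (\<exists>c. N y c)) \<and> (\<forall>y u. R y \<longrightarrow> u \<in> set T \<longrightarrow> b y u = 0) \<and>
     (\<forall>x c. N x c \<longrightarrow> (\<exists>y \<tau>. x = y + \<tau> \<and> R y \<and> N y c \<and> in_span N T \<tau> c)) \<and>
     (\<forall>y c. R y \<longrightarrow> (\<forall>x d. R x \<longrightarrow> N x d \<longrightarrow> hge (b y x) (c + d)) \<longrightarrow> N y c)"

lemma NF_props:
  assumes "NF N R T"
  shows "R 0" "\<forall>y. R y \<longrightarrow> (\<exists>c. N y c)" "\<forall>y u. R y \<longrightarrow> u \<in> set T \<longrightarrow> b y u = 0"
    "\<forall>x c. N x c \<longrightarrow> (\<exists>y \<tau>. x = y + \<tau> \<and> R y \<and> N y c \<and> in_span N T \<tau> c)"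
    "\<forall>y c. R y \<longrightarrow> (\<forall>x d. R x \<longrightarrow> N x d \<longrightarrow> hge (b y x) (c + d)) \<longrightarrow> N y c"
  by (insert assms[unfolded NF_def], (elim conjE, assumption)+)

lemmas NF_R0 = NF_props(1)
lemmas NF_dom = NF_props(2)[rule_format]
lemmas NF_orth = NF_props(3)[rule_format]
lemmas NF_split = NF_props(4)[rule_format]
lemmas NF_dual = NF_props(5)[rule_format]

lemma NF_reorder:
  assumes NF: "NF N R T" and "set T' = set T" "\<And>x c. in_span N T x c \<Longrightarrow> in_span N T' x c"
  shows "NF N R T'"
  unfolding NF_def
proof (intro conjI)
  show "\<forall>x c. N x c \<longrightarrow> (\<exists>y \<tau>. x = y + \<tau> \<and> R y \<and> N y c \<and> in_span N T' \<tau> c)"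
  proof (intro allI impI)
    fix x c assume "N x c"
    from NF_split[OF NF this] obtain y \<tau> where "x = y + \<tau>" "R y" "N y c" "in_span N T \<tau> c"
      by blast
    then show "\<exists>y \<tau>. x = y + \<tau> \<and> R y \<and> N y c \<and> in_span N T' \<tau> c"
      using assms(3) by metis
  qed
qed (use NF_props[OF NF] assms(2) in \<open>simp_all only:\<close>)

lemma NF_swap: "NF N R (u # v # T) \<Longrightarrow> NF N R (v # u # T)"
  by (erule NF_reorder) (auto simp del: in_span.simps intro: in_span_swap)

lemma NF_swap2: "NF N R [u, v, w] \<Longrightarrow> NF N R [u, w, v]"
proof (erule NF_reorder)
  show "in_span N [u, w, v] x c" if "in_span N [u, v, w] x c" for x c
    using that in_span_swap[of N v w "[]"] by (metis in_span.simps(2))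
qed auto

text \<open>\<open>NF\<close> asks of the members of \<open>T\<close> only orthogonality to
  \<open>R\<close>, so a new vector can be parked in \<open>T\<close> before it is decided whether
  it remains a line or is paired with another one.\<close>

lemma NF_ext:
  assumes N: "is_norm N" and NF: "NF N R T" and z: "\<And>y. R y \<Longrightarrow> b y z = 0"
  shows "NF (ext N z k) R (z # T)"
  unfolding NF_def
proof (intro conjI allI impI)
  show "R 0" by (rule NF_R0[OF NF])
  show "\<exists>c. ext N z k y c" if "R y" for y
    using NF_dom[OF NF that] ext_base by blast
  show "b y u = 0" if "R y" "u \<in> set (z # T)" for y u
    using NF_orth[OF NF that(1)] z that by auto
  show "\<exists>y \<tau>. x = y + \<tau> \<and> R y \<and> ext N z k y c \<and> in_span (ext N z k) (z # T) \<tau> c"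
    if asm: "ext N z k x c" for x c
  proof -
    obtain x' t where x: "x = x' + t \<cdot> z" "N x' c" "hge t (c - k)"
      using asm by (auto simp: ext_def)
    obtain y \<tau> where y: "x' = y + \<tau>" "R y" "N y c" "in_span N T \<tau> c"
      using NF_split[OF NF x(2)] by blast
    show ?thesis
      by (rule exI[of _ y], rule exI[of _ "t \<cdot> z + \<tau>"])
        (use x y ext_new[OF N x(3)] in \<open>auto intro: ext_base in_span_ext\<close>)
  qed
  show "ext N z k y c"
    if "R y" "\<forall>x d. R x \<longrightarrow> ext N z k x d \<longrightarrow> hge (b y x) (c + d)" for y c
    by (rule ext_base, rule NF_dual[OF NF that(1)]) (use that ext_base in blast)
qed

lemma in_span_bound:
  assumes "is_norm N" "in_span N T x d" "\<And>u. u \<in> set T \<Longrightarrow> \<exists>\<kappa>. isT N u \<kappa> \<and> hge (b u q) (\<kappa> + a)"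
  shows "hge (b x q) (d + a)"
  using assms(2,3)
proof (induction T arbitrary: x)
  case (Cons u T)
  obtain t y where x: "x = t \<cdot> u + y" "N (t \<cdot> u) d" "in_span N T y d"
    using Cons.prems(1) by auto
  obtain \<kappa> where k: "isT N u \<kappa>" "hge (b u q) (\<kappa> + a)"
    using Cons.prems(2)[of u] by auto
  have "hge (t * b u q) (d + a)"
    using isT_coeff[OF assms(1) k(1) x(2)] k(2) by (intro hge_mult_le[of t "d - \<kappa>" _ "\<kappa> + a"]) auto
  moreover have "hge (b y q) (d + a)"
    using Cons x by auto
  ultimately show ?case by (simp add: x b_simps hge_add)
qed simp

lemma NF_bound:
  assumes "is_norm N" "NF N R T" "\<And>y. R y \<Longrightarrow> b y q = 0"
    and "\<And>u. u \<in> set T \<Longrightarrow> \<exists>\<kappa>. isT N u \<kappa> \<and> hge (b u q) (\<kappa> + a)" "N x d"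
  shows "hge (b x q) (d + a)"
proof -
  obtain y \<tau> where y: "x = y + \<tau>" "R y" "N y d" "in_span N T \<tau> d"
    using NF_split[OF assms(2,5)] by blast
  then show ?thesis
    using in_span_bound[OF assms(1) y(4) assms(4)] assms(3) by (simp add: b_simps)
qed

section \<open>Moving a paired plane into the unimodular part\<close>

text \<open>The product has the least order that the weights permit, so the plane of
  \<open>p\<close> and \<open>q\<close> is unimodular with respect to the norm.\<close>

definition pair :: "('v \<Rightarrow> int \<Rightarrow> bool) \<Rightarrow> 'v \<Rightarrow> int \<Rightarrow> 'v \<Rightarrow> int \<Rightarrow> bool" where
  "pair N p \<mu> q \<nu> \<longleftrightarrow> N p \<mu> \<and> N q \<nu> \<and> b p q \<noteq> 0 \<and> 2 * ord (b p q) = \<mu> + \<nu>"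

definition gram :: "'v \<Rightarrow> 'v \<Rightarrow> 'a" where
  "gram p q = 4 * Q p * Q q - b p q * b p q"

text \<open>Cramer's rule for the coefficient at \<open>p\<close> of the orthogonal projection of
  \<open>x\<close> to the plane of \<open>p\<close> and \<open>q\<close>; \<open>gram\<close> is the
  determinant of the system. \<open>proj\<close> below is the complementary component, orthogonal to
  the plane.\<close>

definition cf :: "'v \<Rightarrow> 'v \<Rightarrow> 'v \<Rightarrow> 'a" where
  "cf p q x = (2 * Q q * b x p - b p q * b x q) / gram p q"

definition proj :: "'v \<Rightarrow> 'v \<Rightarrow> 'v \<Rightarrow> 'v" where
  "proj p q x = x - cf p q x \<cdot> p - cf q p x \<cdot> q"

lemma gram_sym: "gram q p = gram p q"
  by (simp add: gram_def b_sym[of q p] ac_simps)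

lemma pair_sym: "pair N p \<mu> q \<nu> \<Longrightarrow> pair N q \<nu> p \<mu>"
  by (simp add: pair_def b_sym[of q p] ac_simps)

text \<open>Dividing by the square of \<open>b p q\<close> leaves 1 - 4y, where y is integral
  because the weights bound the orders of \<open>Q p\<close> and \<open>Q q\<close>.\<close>

lemma pair_gram:
  assumes "is_norm N" "pair N p \<mu> q \<nu>"
  shows "- gram p q \<in> unramified_class" "gram p q \<noteq> 0" "ord (gram p q) = \<mu> + \<nu>"
proof -
  let ?y = "- (Q p * Q q / (b p q * b p q))"
  have nz: "b p q \<noteq> 0" and o: "2 * ord (b p q) = \<mu> + \<nu>" using assms(2) by (auto simp: pair_def)
  have "hge (Q p * Q q) (2 * \<mu> + 2 * \<nu>)"
    using assms norm_Q by (intro hge_mult) (auto simp: pair_def)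
  from hge_divide[OF this, of "b p q * b p q"] have y: "hge ?y 0"
    using nz o by (simp add: ord_mult)
  have e: "- gram p q = b p q * b p q * (1 + 4 * ?y)"
    using nz by (simp add: gram_def field_simps)
  show "- gram p q \<in> unramified_class"
    using nz y e by (rule unramified_classI)
  have "- gram p q \<noteq> 0 \<and> ord (- gram p q) = \<mu> + \<nu>"
    unfolding e using unit_1_4[OF y] nz o by (simp add: ord_mult)
  then show "gram p q \<noteq> 0" "ord (gram p q) = \<mu> + \<nu>" by auto
qed

lemma cf_bound:
  assumes N: "is_norm N" and P: "pair N p \<mu> q \<nu>" and "hge (b x p) (c + \<mu>)" "hge (b x q) (c + \<nu>)"
  shows "hge (cf p q x) (c - \<mu>)"
proof -
  have "hge (2 * Q q) (2 + 2 * \<nu>)"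
    using norm_Q[OF N, of q \<nu>] P by (intro hge_mult) (auto simp: pair_def)
  then have "hge (2 * Q q * b x p) (c + \<mu> + 2 * \<nu>)"
    using assms(3) by (rule hge_mult_le) simp
  moreover have "hge (b p q * b x q) (c + \<mu> + 2 * \<nu>)"
    using norm_b[OF N, of p \<mu> q \<nu>] P assms(4)
    by (intro hge_mult_le[of _ "\<mu> + \<nu>" _ "c + \<nu>"]) (auto simp: pair_def)
  ultimately have "hge (2 * Q q * b x p - b p q * b x q) (c + \<mu> + 2 * \<nu>)"
    by (rule hge_diff)
  from hge_divide[OF this pair_gram(2)[OF N P]] show ?thesis
    by (simp add: cf_def pair_gram(3)[OF N P])
qed

lemma cf_gram:
  assumes "gram p q \<noteq> 0"
  shows "cf p q x * gram p q = 2 * Q q * b x p - b p q * b x q"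
    "cf q p x * gram p q = 2 * Q p * b x q - b p q * b x p"
  using assms by (simp_all add: cf_def gram_sym[of q p] b_sym[of q p])

lemma b_proj:
  assumes "gram p q \<noteq> 0"
  shows "b (proj p q x) p = 0" "b (proj p q x) q = 0"
proof -
  have e: "b (proj p q x) p = b x p - cf p q x * (2 * Q p) - cf q p x * b p q"
    "b (proj p q x) q = b x q - cf p q x * b p q - cf q p x * (2 * Q q)"
    by (simp_all add: proj_def b_simps b_self b_sym[of q p])
  have "b (proj p q x) p * gram p q =
      b x p * gram p q - (cf p q x * gram p q) * (2 * Q p) - (cf q p x * gram p q) * b p q"
    unfolding e by (simp add: algebra_simps)
  also have "\<dots> = 0"
    unfolding cf_gram[OF assms] by (simp add: gram_def algebra_simps)
  finally have "b (proj p q x) p * gram p q = 0" .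
  then show "b (proj p q x) p = 0" using assms by simp
  have "b (proj p q x) q * gram p q =
      b x q * gram p q - (cf p q x * gram p q) * b p q - (cf q p x * gram p q) * (2 * Q q)"
    unfolding e by (simp add: algebra_simps)
  also have "\<dots> = 0"
    unfolding cf_gram[OF assms] by (simp add: gram_def algebra_simps)
  finally have "b (proj p q x) q * gram p q = 0" .
  then show "b (proj p q x) q = 0" using assms by simp
qed

lemma proj_eq: "b x p = 0 \<Longrightarrow> b x q = 0 \<Longrightarrow> proj p q x = x"
  by (simp add: proj_def cf_def)

lemma b_proj_proj:
  assumes "gram p q \<noteq> 0"
  shows "b (proj p q x) (proj p q y) = b x y - cf p q x * b p y - cf q p x * b q y"
proof -
  have "b (proj p q x) (proj p q y) = b (proj p q x) y"
    using b_proj[OF assms, of x] unfolding proj_def[of p q y] by (simp add: b_simps)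
  then show ?thesis by (simp add: proj_def b_simps)
qed

lemma Q_proj:
  assumes "gram p q \<noteq> 0"
  shows "Q (proj p q x) * gram p q =
    Q x * gram p q - (Q q * b x p * b x p - b p q * b x p * b x q + Q p * b x q * b x q)"
proof -
  have "2 * Q (proj p q x) = 2 * Q x - cf p q x * b x p - cf q p x * b x q"
    using b_proj_proj[OF assms, of x x] by (simp add: b_self b_sym[of _ x])
  then have "2 * (Q (proj p q x) * gram p q) =
      2 * Q x * gram p q - (cf p q x * gram p q) * b x p - (cf q p x * gram p q) * b x q"
    by (simp only: left_diff_distrib mult.assoc[symmetric]) (simp add: algebra_simps)
  also have "\<dots> = 2 * (Q x * gram p q -
      (Q q * b x p * b x p - b p q * b x p * b x q + Q p * b x q * b x q))"
    unfolding cf_gram[OF assms] by (simp add: algebra_simps)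
  finally show ?thesis
    unfolding mult_cancel_left by simp
qed

text \<open>The extra 1 in both pairings gives the removed component norm at least
  \<open>\<kappa> + 1\<close>, too much to disturb the leading term of \<open>Q u\<close>.\<close>

lemma proj_isT:
  assumes N: "is_norm N" and P: "pair N p \<mu> q \<nu>" and u: "isT N u \<kappa>"
    and d: "hge (b u p) (\<kappa> + \<mu> + 1)" "hge (b u q) (\<kappa> + \<nu> + 1)"
  shows "isT N (proj p q u) \<kappa>"
proof -
  have s: "hge (cf p q u) (\<kappa> + 1 - \<mu>)" "hge (cf q p u) (\<kappa> + 1 - \<nu>)"
    using cf_bound[OF N P, of u "\<kappa> + 1"] cf_bound[OF N pair_sym[OF P], of u "\<kappa> + 1"] d
    by (auto simp: algebra_simps)
  have "N (cf p q u \<cdot> p + cf q p u \<cdot> q) (\<kappa> + 1)"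
    using s P by (intro norm_add[OF N] norm_scale'[OF N]) (auto simp: pair_def)
  then have y: "N (- (cf p q u \<cdot> p + cf q p u \<cdot> q)) (\<kappa> + 1)" (is "N ?y _")
    by (rule norm_minus[OF N])
  have e: "proj p q u = u + ?y" by (simp add: proj_def)
  have u': "N u \<kappa>" "Q u \<noteq> 0" "ord (Q u) = \<kappa>" using u by (auto simp: isT_def)
  have "hge (Q ?y + b u ?y) (2 * ord (Q u) + 1)"
    using norm_Q[OF N y] norm_b[OF N u'(1) y] u'(3)
    by (intro hge_add) (auto elim!: hge_mono)
  from ord_add_dominant[OF u'(2) this]
  have "Q (proj p q u) \<noteq> 0" "ord (Q (proj p q u)) = \<kappa>"
    unfolding e Q_add using u'(3) by (auto simp: algebra_simps)
  moreover have "N (proj p q u) \<kappa>"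
    unfolding e using u' norm_mono[OF N y] by (intro norm_add[OF N]) auto
  ultimately show ?thesis by (simp add: isT_def)
qed

lemma in_span_proj:
  assumes N: "is_norm N" and P: "pair N p \<mu> q \<nu>" and "in_span N T \<tau> c"
    and "\<And>u. u \<in> set T \<Longrightarrow> \<exists>\<kappa>. isT N u \<kappa>"
  shows "\<exists>s t \<tau>'. \<tau> = s \<cdot> p + t \<cdot> q + \<tau>' \<and> hge s (c - \<mu>) \<and> hge t (c - \<nu>) \<and>
    in_span N (map (proj p q) T) \<tau>' c"
  using assms(3,4)
proof (induction T arbitrary: \<tau>)
  case Nil
  then show ?case by (intro exI[of _ 0]) auto
next
  case (Cons u T)
  obtain r y where y: "\<tau> = r \<cdot> u + y" "N (r \<cdot> u) c" "in_span N T y c"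
    using Cons.prems(1) by auto
  obtain \<kappa> where k: "isT N u \<kappa>" using Cons.prems(2) by auto
  obtain s t \<tau>' where st: "y = s \<cdot> p + t \<cdot> q + \<tau>'" "hge s (c - \<mu>)" "hge t (c - \<nu>)"
    "in_span N (map (proj p q) T) \<tau>' c"
    using Cons.IH[OF y(3)] Cons.prems(2) by auto
  have r: "hge r (c - \<kappa>)" by (rule isT_coeff[OF N k y(2)])
  have u: "N u \<kappa>" using k by (simp add: isT_def)
  have "hge (cf p q u) (\<kappa> - \<mu>)" "hge (cf q p u) (\<kappa> - \<nu>)"
    using norm_b[OF N u] P cf_bound[OF N P, of u \<kappa>] cf_bound[OF N pair_sym[OF P], of u \<kappa>]
    by (auto simp: pair_def)
  then have rs: "hge (r * cf p q u) (c - \<mu>)" "hge (r * cf q p u) (c - \<nu>)"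
    using r by (auto intro: hge_mult_le[of r "c - \<kappa>"])
  have "N (r \<cdot> proj p q u) c"
    using y(2) rs P unfolding proj_def scale_right_diff_distrib
    by (intro norm_diff[OF N]) (auto simp: pair_def intro: norm_scale'[OF N])
  moreover have "\<tau> = (s + r * cf p q u) \<cdot> p + (t + r * cf q p u) \<cdot> q + (r \<cdot> proj p q u + \<tau>')"
    unfolding y st proj_def by (simp add: algebra_simps)
  ultimately show ?case
    using st rs
    by (intro exI[of _ "s + r * cf p q u"] exI[of _ "t + r * cf q p u"]
        exI[of _ "r \<cdot> proj p q u + \<tau>'"]) (auto intro!: hge_add)
qed

text \<open>The plane of \<open>p\<close> and \<open>q\<close> joins \<open>R\<close>, and the other
  vectors are replaced by their components orthogonal to it. For the duality on the larger part, the
  coefficients along \<open>p\<close> and \<open>q\<close> are recovered from the products with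
  \<open>p\<close> and \<open>q\<close> by Cramer's rule, without loss since the plane is
  unimodular.\<close>

lemma NF_pair:
  assumes N: "is_norm N" and NF: "NF N R (p # q # T)" and P: "pair N p \<mu> q \<nu>"
    and T: "\<And>u. u \<in> set T \<Longrightarrow> \<exists>\<kappa>. isT N u \<kappa>"
  shows "\<exists>R'. NF N R' (map (proj p q) T)"
proof -
  define R' where "R' y \<longleftrightarrow> (\<exists>y0 s t. R y0 \<and> y = y0 + (s \<cdot> p + t \<cdot> q))" for y
  note g = pair_gram[OF N P]
  have pq: "N p \<mu>" "N q \<nu>" using P by (auto simp: pair_def)
  have Rpq: "b y p = 0" "b y q = 0" if "R y" for y
    using NF_orth[OF NF that] by auto
  have cf: "s = cf p q (y0 + (s \<cdot> p + t \<cdot> q))" "t = cf q p (y0 + (s \<cdot> p + t \<cdot> q))"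
    if y0: "R y0" for y0 s t
  proof -
    let ?y = "y0 + (s \<cdot> p + t \<cdot> q)"
    have e: "b ?y p = s * (2 * Q p) + t * b p q" "b ?y q = s * b p q + t * (2 * Q q)"
      using Rpq[OF y0] by (simp_all add: b_simps b_self b_sym[of q p])
    have "s * gram p q = cf p q ?y * gram p q" "t * gram p q = cf q p ?y * gram p q"
      unfolding cf_gram[OF g(2)] unfolding e gram_def by (simp_all add: algebra_simps)
    then show "s = cf p q ?y" "t = cf q p ?y" using g(2) by auto
  qed
  have split: "\<exists>y \<tau>. x = y + \<tau> \<and> R' y \<and> N y c \<and> in_span N (map (proj p q) T) \<tau> c" if x: "N x c" for x c
  proof -
    obtain y \<tau> where y: "x = y + \<tau>" "R y" "N y c" "in_span N (p # q # T) \<tau> c"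
      using NF_split[OF NF x] by blast
    then obtain s t \<tau>1 where t1: "\<tau> = s \<cdot> p + (t \<cdot> q + \<tau>1)" "N (s \<cdot> p) c" "N (t \<cdot> q) c"
      "in_span N T \<tau>1 c" by auto
    obtain s' t' \<tau>2 where t2: "\<tau>1 = s' \<cdot> p + t' \<cdot> q + \<tau>2" "hge s' (c - \<mu>)" "hge t' (c - \<nu>)"
      "in_span N (map (proj p q) T) \<tau>2 c"
      using in_span_proj[OF N P t1(4) T] by blast
    have "N (y + ((s \<cdot> p + t \<cdot> q) + (s' \<cdot> p + t' \<cdot> q))) c"
      using y t1 t2 pq by (intro norm_add[OF N]) (auto intro: norm_scale'[OF N])
    moreover have "R' (y + ((s \<cdot> p + t \<cdot> q) + (s' \<cdot> p + t' \<cdot> q)))"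
      unfolding R'_def using y
      by (intro exI[of _ y] exI[of _ "s + s'"] exI[of _ "t + t'"]) (simp add: algebra_simps)
    ultimately show ?thesis
      using y t1 t2
      by (intro exI[of _ "y + ((s \<cdot> p + t \<cdot> q) + (s' \<cdot> p + t' \<cdot> q))"] exI[of _ \<tau>2])
        (simp add: algebra_simps)
  qed
  have "NF N R' (map (proj p q) T)"
    unfolding NF_def
  proof (intro conjI allI impI)
    show "R' 0" unfolding R'_def
      using NF_R0[OF NF] by (intro exI[of _ 0]) simp
    show "\<exists>c. N y c" if R': "R' y" for y
    proof -
      obtain y0 s t where y: "R y0" "y = y0 + (s \<cdot> p + t \<cdot> q)"
        using R' by (auto simp: R'_def)
      obtain c where c: "N y0 c" using NF_dom[OF NF y(1)] by blast
      define d where "d = min c (min (\<mu> + 2 * ord s) (\<nu> + 2 * ord t))"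
      have "N y d"
        unfolding y using norm_mono[OF N c, of d] pq
        by (intro norm_add[OF N] norm_scale'[OF N, of p \<mu>] norm_scale'[OF N, of q \<nu>])
          (auto simp: d_def hge_def)
      then show ?thesis ..
    qed
    show "b y u = 0" if R': "R' y" and u: "u \<in> set (map (proj p q) T)" for y u
    proof -
      obtain y0 s t where y: "R y0" "y = y0 + (s \<cdot> p + t \<cdot> q)"
        using R' by (auto simp: R'_def)
      obtain v where v: "v \<in> set T" "u = proj p q v" using u by auto
      have "b y0 v = 0" using NF_orth[OF NF y(1)] v by auto
      then show ?thesis
        using b_proj[OF g(2), of v] Rpq[OF y(1)] unfolding y v
        by (simp add: b_simps b_sym[of p "proj p q v"] b_sym[of q "proj p q v"])
          (simp add: proj_def b_simps)
    qed
    show "\<exists>y \<tau>. x = y + \<tau> \<and> R' y \<and> N y c \<and> in_span N (map (proj p q) T) \<tau> c" if "N x c" for x c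
      by (rule split[OF that])
    show "N y c" if R': "R' y" and test: "\<forall>x d. R' x \<longrightarrow> N x d \<longrightarrow> hge (b y x) (c + d)" for y c
    proof -
      obtain y0 s t where y: "R y0" "y = y0 + (s \<cdot> p + t \<cdot> q)"
        using R' by (auto simp: R'_def)
      have "R' p"
        unfolding R'_def using NF_R0[OF NF]
        by (rule_tac exI[of _ 0], rule_tac exI[of _ 1], rule_tac exI[of _ 0]) simp
      moreover have "R' q"
        unfolding R'_def using NF_R0[OF NF]
        by (rule_tac exI[of _ 0], rule_tac exI[of _ 0], rule_tac exI[of _ 1]) simp
      ultimately have "hge (b y p) (c + \<mu>)" "hge (b y q) (c + \<nu>)"
        using test[rule_format] pq by auto
      then have st: "hge s (c - \<mu>)" "hge t (c - \<nu>)"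
        using cf[OF y(1), where s = s and t = t] y(2) cf_bound[OF N P, of y c] cf_bound[OF N pair_sym[OF P], of y c] by auto
      have "N y0 c"
      proof (rule NF_dual[OF NF y(1)])
        fix x d assume x: "R x" "N x d"
        have "R' x" unfolding R'_def using x
          by (rule_tac exI[of _ x], rule_tac exI[of _ 0], rule_tac exI[of _ 0]) simp
        then have "hge (b y x) (c + d)" using test[rule_format] x by simp
        moreover have "b y x = b y0 x"
          using Rpq[OF x(1)] by (simp add: y b_simps b_sym[of p x] b_sym[of q x])
        ultimately show "hge (b y0 x) (c + d)" by simp
      qed
      then show ?thesis unfolding y using st pq
        by (intro norm_add[OF N] norm_scale'[OF N, of p \<mu>] norm_scale'[OF N, of q \<nu>]) auto
    qed
  qed
  then show ?thesis by (rule_tac exI[of _ R'])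
qed

section \<open>Gram determinants after projection\<close>

text \<open>Up to a factor 2, both sides are the Gram determinant of the span of \<open>z\<close>,
  \<open>w\<close>, \<open>v\<close>, computed once with \<open>p\<close> in place of
  \<open>z\<close>, a unipotent change of basis. The next two lemmas are the same computation for
  the span of \<open>z\<close>, \<open>y\<close>, \<open>w\<close> and of \<open>z\<close>,
  \<open>y\<close>, \<open>w\<close>, \<open>v\<close>.\<close>

lemma gram_proj_line:
  assumes "gram p w \<noteq> 0" "b w z = 0" "b v z = 0" "p = z + (\<alpha> \<cdot> w + \<gamma> \<cdot> v)"
  shows "Q (proj p w v) * gram p w = Q z * gram w v"
proof -
  have e: "b p w = 2 * \<alpha> * Q w + \<gamma> * b w v" "b v p = \<alpha> * b w v + 2 * \<gamma> * Q v"
    "Q p = Q z + \<alpha> * \<alpha> * Q w + \<gamma> * \<gamma> * Q v + \<alpha> * \<gamma> * b w v"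
    using assms(2,3) unfolding assms(4) by (simp_all add: Q_add Q_scale b_simps b_self b_sym[of z] b_sym[of v w])
  show ?thesis
    unfolding Q_proj[OF assms(1)] unfolding gram_def e b_sym[of v w] by (simp add: algebra_simps)
qed

lemma gram_proj_pair1:
  assumes "gram p q \<noteq> 0" "b w z = 0" "b w y = 0" "b y z = 0" "p = z + \<alpha> \<cdot> w" "q = y + \<gamma> \<cdot> w"
  shows "Q (proj p q w) * gram p q = 4 * Q w * Q z * Q y"
proof -
  have e: "b p q = 2 * \<alpha> * \<gamma> * Q w" "b w p = 2 * \<alpha> * Q w" "b w q = 2 * \<gamma> * Q w"
    "Q p = Q z + \<alpha> * \<alpha> * Q w" "Q q = Q y + \<gamma> * \<gamma> * Q w"
    using assms(2,3,4) unfolding assms(5,6)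
    by (simp_all add: Q_add Q_scale b_simps b_self b_sym[of z w] b_sym[of y w] b_sym[of z y])
  show ?thesis
    unfolding Q_proj[OF assms(1)] unfolding gram_def e by (simp add: algebra_simps)
qed

lemma gram_proj_pair2:
  assumes g: "gram p q \<noteq> 0" and "b w z = 0" "b w y = 0" "b y z = 0" "b v z = 0" "b v y = 0"
    and "p = z + (\<alpha> \<cdot> w + \<gamma> \<cdot> v)" "q = y + \<delta> \<cdot> w"
  shows "gram (proj p q w) (proj p q v) * gram p q = gram w v * (4 * Q z * Q y)"
proof -
  define x1 x2 y1 y2 m1 m2 m where
    defs: "x1 = b w p" "x2 = b w q" "y1 = b v p" "y2 = b v q" "m1 = Q p" "m2 = Q q" "m = b p q"
  define X where "X = m2 * x1 * x1 - m * x1 * x2 + m1 * x2 * x2"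
  define Y where "Y = m2 * y1 * y1 - m * y1 * y2 + m1 * y2 * y2"
  define Z where "Z = (2 * m2 * x1 - m * x2) * y1 + (2 * m1 * x2 - m * x1) * y2"
  have QX: "Q (proj p q w) * gram p q = Q w * gram p q - X"
    and QY: "Q (proj p q v) * gram p q = Q v * gram p q - Y"
    unfolding Q_proj[OF g] X_def Y_def defs by auto
  have QZ: "b (proj p q w) (proj p q v) * gram p q = b w v * gram p q - Z"
  proof -
    have "b (proj p q w) (proj p q v) * gram p q =
      b w v * gram p q - (cf p q w * gram p q) * b v p - (cf q p w * gram p q) * b v q"
      unfolding b_proj_proj[OF g] b_sym[of p v] b_sym[of q v]
      by (simp add: algebra_simps)
    then show ?thesis unfolding cf_gram[OF g] Z_def defs by (simp add: algebra_simps)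
  qed
  have g4: "gram p q = 4 * m1 * m2 - m * m" by (simp add: gram_def defs)
  \<comment> \<open>\<open>X\<close> and \<open>Y\<close> are the values of one binary quadratic
    form at (x1, x2) and (y1, y2), and \<open>Z\<close> is its polar value: this is how a
    discriminant transforms under substitution.\<close>
  have XYZ: "4 * X * Y - Z * Z = gram p q * (x1 * y2 - x2 * y1) * (x1 * y2 - x2 * y1)"
    unfolding X_def Y_def Z_def g4 by (simp add: algebra_simps)
  have "gram (proj p q w) (proj p q v) * gram p q * gram p q =
    4 * (Q (proj p q w) * gram p q) * (Q (proj p q v) * gram p q) -
    (b (proj p q w) (proj p q v) * gram p q) * (b (proj p q w) (proj p q v) * gram p q)"
    unfolding gram_def[of "proj p q w"] by (simp add: algebra_simps)
  also have "\<dots> = (gram w v * gram p q - 4 * Q w * Y - 4 * Q v * X + 2 * b w v * Z) * gram p q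
      + (4 * X * Y - Z * Z)"
    unfolding QX QY QZ gram_def[of w v] by (simp add: algebra_simps)
  also have "\<dots> = (gram w v * gram p q - 4 * Q w * Y - 4 * Q v * X + 2 * b w v * Z +
      (x1 * y2 - x2 * y1) * (x1 * y2 - x2 * y1)) * gram p q"
    unfolding XYZ by (simp add: algebra_simps)
  also have "gram w v * gram p q - 4 * Q w * Y - 4 * Q v * X + 2 * b w v * Z +
      (x1 * y2 - x2 * y1) * (x1 * y2 - x2 * y1) = gram w v * (4 * Q z * Q y)"
  proof -
    have e: "x1 = 2 * \<alpha> * Q w + \<gamma> * b w v" "x2 = 2 * \<delta> * Q w" "y1 = \<alpha> * b w v + 2 * \<gamma> * Q v"
      "y2 = \<delta> * b w v" "m1 = Q z + \<alpha> * \<alpha> * Q w + \<gamma> * \<gamma> * Q v + \<alpha> * \<gamma> * b w v"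
      "m2 = Q y + \<delta> * \<delta> * Q w" "m = 2 * \<alpha> * \<delta> * Q w + \<gamma> * \<delta> * b w v"
      using assms(2-6) unfolding defs assms(7,8)
      by (simp_all add: Q_add Q_scale b_simps b_self b_sym[of z] b_sym[of y w] b_sym[of y v] b_sym[of v w]
          algebra_simps)
    show ?thesis
      unfolding X_def Y_def Z_def g4 gram_def[of w v] unfolding e by (simp add: algebra_simps)
  qed
  finally show ?thesis using g by simp
qed

text \<open>Here \<open>y\<close> may vanish or already have an order above \<open>c\<close>; then
  \<gamma> = 0 serves.\<close>

lemma square_cancel':
  assumes "x \<noteq> 0" "hge y (2 * c)" "even (c + ord x)"
  shows "\<exists>\<gamma>. hge \<gamma> (c - ord x) \<and> hge (y + \<gamma> * \<gamma> * x) (2 * c + 2)"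
proof (cases "hge y (2 * c + 2)")
  case True
  then show ?thesis by (intro exI[of _ 0]) simp
next
  case False
  then have "y \<noteq> 0" "ord y = c" using assms(2) by (auto simp: hge_def)
  then show ?thesis
    using square_cancel[OF assms(1), of y] assms(3)
    by (metis add.commute hge_refl)
qed

text \<open>The three shapes of the normal form, \<open>D\<close> being the discriminant; in \<open>st2\<close> the flag tells
  whether the two lines are too close to orthogonal for their pairing to matter.\<close>

definition st0 :: "('v \<Rightarrow> int \<Rightarrow> bool) \<Rightarrow> 'a \<Rightarrow> bool" where
  "st0 N D \<longleftrightarrow> is_norm N \<and> (\<exists>R. NF N R []) \<and> D \<in> unramified_class"

definition st1 :: "('v \<Rightarrow> int \<Rightarrow> bool) \<Rightarrow> 'a \<Rightarrow> int \<Rightarrow> bool" where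
  "st1 N D \<kappa> \<longleftrightarrow> is_norm N \<and> (\<exists>R w. NF N R [w] \<and> isT N w \<kappa> \<and> D / Q w \<in> unramified_class)"

definition st2 :: "bool \<Rightarrow> ('v \<Rightarrow> int \<Rightarrow> bool) \<Rightarrow> 'a \<Rightarrow> bool" where
  "st2 \<beta> N D \<longleftrightarrow> is_norm N \<and> (\<exists>R w v \<kappa> \<mu>. NF N R [w, v] \<and> isT N w \<kappa> \<and> isT N v \<mu> \<and> odd (\<kappa> + \<mu>) \<and>
     (if \<beta> then hge (b w v) (\<kappa> + \<mu> + 3) else b w v \<noteq> 0 \<and> 2 * ord (b w v) = \<kappa> + \<mu> + 1) \<and>
     - D / gram w v \<in> unramified_class)"

text \<open>The two orders have different parity and the description is symmetric in the lines, so
  \<open>w\<close> can be taken to be the line that cancels leading terms of order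
  \<open>k\<close>.\<close>

lemma st2_parity:
  assumes "st2 \<beta> N D"
  shows "\<exists>R w v \<kappa> \<mu>. NF N R [w, v] \<and> isT N w \<kappa> \<and> isT N v \<mu> \<and> even (\<kappa> + k) \<and> odd (\<kappa> + \<mu>) \<and>
     (if \<beta> then hge (b w v) (\<kappa> + \<mu> + 3) else b w v \<noteq> 0 \<and> 2 * ord (b w v) = \<kappa> + \<mu> + 1) \<and>
     - D / gram w v \<in> unramified_class"
proof -
  obtain R w v \<kappa> \<mu> where *: "NF N R [w, v]" "isT N w \<kappa>" "isT N v \<mu>" "odd (\<kappa> + \<mu>)"
     "if \<beta> then hge (b w v) (\<kappa> + \<mu> + 3) else b w v \<noteq> 0 \<and> 2 * ord (b w v) = \<kappa> + \<mu> + 1"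
     "- D / gram w v \<in> unramified_class"
    using assms unfolding st2_def by blast
  show ?thesis
  proof (cases "even (\<kappa> + k)")
    case True
    show ?thesis
      by (rule exI[of _ R], rule exI[of _ w], rule exI[of _ v], rule exI[of _ \<kappa>], rule exI[of _ \<mu>])
        (use * True in auto)
  next
    case False
    then have "even (\<mu> + k)" using *(4) by auto
    then show ?thesis
      by (rule_tac exI[of _ R], rule_tac exI[of _ v], rule_tac exI[of _ w],
          rule_tac exI[of _ \<mu>], rule_tac exI[of _ \<kappa>])
        (use * NF_swap[OF *(1)] in \<open>auto simp: b_sym[of v w] gram_sym[of w v] ac_simps split: if_splits\<close>)
  qed
qed

section \<open>Adding a vector orthogonal to everything before\<close>

definition orth :: "('v \<Rightarrow> int \<Rightarrow> bool) \<Rightarrow> 'v \<Rightarrow> bool" where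
  "orth N z \<longleftrightarrow> (\<forall>x c. N x c \<longrightarrow> b x z = 0)"

lemma orthD: "orth N z \<Longrightarrow> N x c \<Longrightarrow> b x z = 0"
  by (auto simp: orth_def)

lemma orth_isT: "orth N z \<Longrightarrow> isT N w \<kappa> \<Longrightarrow> b w z = 0"
  using orthD by (auto simp: isT_def)

lemma orth_R: "orth N z \<Longrightarrow> NF N R T \<Longrightarrow> R y \<Longrightarrow> b y z = 0"
  using orthD NF_dom by metis

lemma step_0:
  assumes st: "st0 N D" and z: "orth N z" "Q z \<noteq> 0" "ord (Q z) = k"
  shows "st1 (ext N z k) (D * Q z) k"
proof -
  obtain R where N: "is_norm N" and NF: "NF N R []" and D: "D \<in> unramified_class"
    using st by (auto simp: st0_def)
  have N': "is_norm (ext N z k)"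
    by (rule is_norm_ext[OF N]) (use z orthD[OF z(1)] in \<open>auto simp: hge_def\<close>)
  have "NF (ext N z k) R [z]"
    by (rule NF_ext[OF N NF]) (rule orth_R[OF z(1) NF])
  moreover have "isT (ext N z k) z k"
    using z ext_new_1[OF N] by (simp add: isT_def)
  moreover have "D * Q z / Q z \<in> unramified_class" using D z by simp
  ultimately show ?thesis using N' unfolding st1_def by blast
qed

lemma step_1_odd:
  assumes st: "st1 N D \<kappa>" and z: "orth N z" "Q z \<noteq> 0" "ord (Q z) = k" and odd: "odd (\<kappa> + k)"
  shows "st2 True (ext N z k) (- 4 * D * Q z)"
proof -
  obtain R w where N: "is_norm N" and NF: "NF N R [w]" and w: "isT N w \<kappa>"
    and D: "D / Q w \<in> unramified_class"
    using st by (auto simp: st1_def)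
  have N': "is_norm (ext N z k)"
    by (rule is_norm_ext[OF N]) (use z orthD[OF z(1)] in \<open>auto simp: hge_def\<close>)
  have NF': "NF (ext N z k) R [z, w]"
    by (rule NF_ext[OF N NF]) (rule orth_R[OF z(1) NF])
  have zT: "isT (ext N z k) z k"
    using z ext_new_1[OF N] by (simp add: isT_def)
  have b0: "b z w = 0" using orth_isT[OF z(1) w] by (simp add: b_sym[of z w])
  have "- (- 4 * D * Q z) / gram z w = D / Q w"
    using z w by (simp add: gram_def b0 isT_def)
  then show ?thesis
    unfolding st2_def
    by (intro conjI N' exI[of _ R] exI[of _ z] exI[of _ w] exI[of _ k] exI[of _ \<kappa>])
      (use NF' zT isT_ext[OF w] odd b0 D in \<open>auto simp: ac_simps\<close>)
qed

text \<open>After cancellation along \<open>w\<close>, the vector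
  \<open>p = z + \<alpha> \<cdot> w\<close> has a product with \<open>w\<close> of doubled order
  \<open>k + \<kappa> + 2\<close>. If \<open>Q p\<close> has order exactly \<open>k + 1\<close>,
  then \<open>p\<close> is a second line, coupled to \<open>w\<close>. Otherwise \<open>p\<close>
  can carry weight \<open>k + 2\<close>, where it pairs with \<open>w\<close> and no line is left.
  The last clause keeps the option of the weight \<open>k + 1\<close> for \<open>p\<close>, in case
  another vector of order \<open>k\<close> follows.\<close>

lemma step_1_even:
  assumes st: "st1 N D \<kappa>" and z: "orth N z" "Q z \<noteq> 0" "ord (Q z) = k" and ev: "even (\<kappa> + k)"
  shows "\<exists>y. N y k \<and> (st2 False (ext N (z + y) (k + 1)) (- 4 * D * Q z) \<or>
    st0 (ext N (z + y) (k + 2)) (- 4 * D * Q z) \<and>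
    (\<forall>z'. orth N z' \<longrightarrow> b (z + y) z' = 0 \<longrightarrow> Q z' \<noteq> 0 \<longrightarrow> ord (Q z') = k \<longrightarrow>
      (\<exists>y'. N y' k \<and> (\<exists>\<kappa>. st1 (ext (ext N (z + y) (k + 1)) (z' + y') (k + 1)) (- 4 * D * Q z * Q z') \<kappa>))))"
proof -
  obtain R w where N: "is_norm N" and NF: "NF N R [w]" and w: "isT N w \<kappa>"
    and D: "D / Q w \<in> unramified_class"
    using st by (auto simp: st1_def)
  have w': "N w \<kappa>" "Q w \<noteq> 0" "ord (Q w) = \<kappa>" using w by (auto simp: isT_def)
  obtain \<alpha> where \<alpha>: "\<alpha> \<noteq> 0" "2 * ord \<alpha> = k - \<kappa>" "hge (Q z + \<alpha> * \<alpha> * Q w) (2 * k + 2)"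
    using square_cancel[of "Q w" "Q z"] w' z ev by auto
  define p where "p = z + \<alpha> \<cdot> w"
  have bw: "b w z = 0" "b z w = 0" using orth_isT[OF z(1) w] by (auto simp: b_sym[of z w])
  have Rw: "b y w = 0" if "R y" for y using NF_orth[OF NF that] by auto
  have Rp: "b y p = 0" if "R y" for y
    using Rw[OF that] orth_R[OF z(1) NF that] by (simp add: p_def b_simps)
  have Qp: "Q p = Q z + \<alpha> * \<alpha> * Q w" by (simp add: p_def Q_add Q_scale b_simps bw)
  have bwp: "b w p = 2 * \<alpha> * Q w" by (simp add: p_def b_simps b_self bw)
  have bwp': "b w p \<noteq> 0" "2 * ord (b w p) = k + \<kappa> + 2"
    using \<alpha> w' by (auto simp: bwp ord_mult)
  have Ny: "N (\<alpha> \<cdot> w) k"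
    by (rule norm_scale'[OF N w'(1)]) (use \<alpha> in \<open>auto simp: hge_def\<close>)
  have bound: "hge (b x p) (d + (k + a))" if "N x d" "a \<le> 2" for x d a
    by (rule NF_bound[OF N NF Rp _ that(1)])
      (use w bwp' that in \<open>auto simp: hge_def intro!: exI[of _ \<kappa>]\<close>)
  have gwp: "gram w p = 4 * Q w * Q z"
    by (simp add: gram_def bwp Qp algebra_simps)
  have De: "- (- 4 * D * Q z) / gram w p = D / Q w"
    using z w' by (simp add: gwp)
  show ?thesis
  proof (cases "hge (Q p) (2 * (k + 2))")
    case False
    have Q1: "hge (Q p) (2 * (k + 1))" using \<alpha>(3) by (simp add: Qp algebra_simps)
    have N': "is_norm (ext N p (k + 1))"
      by (rule is_norm_ext[OF N Q1]) (use bound[of _ _ 1] in simp)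
    have "NF (ext N p (k + 1)) R [p, w]" by (rule NF_ext[OF N NF Rp])
    then have NF': "NF (ext N p (k + 1)) R [w, p]" by (rule NF_swap)
    have pT: "isT (ext N p (k + 1)) p (k + 1)"
      using False Q1 ext_new_1[OF N] by (auto simp: isT_def hge_def)
    have "st2 False (ext N p (k + 1)) (- 4 * D * Q z)"
      unfolding st2_def
      by (intro conjI N' exI[of _ R] exI[of _ w] exI[of _ p] exI[of _ \<kappa>] exI[of _ "k + 1"])
        (use NF' pT isT_ext[OF w] ev bwp' De D in \<open>auto simp: ac_simps\<close>)
    then show ?thesis using Ny unfolding p_def by blast
  next
    case True
    have N': "is_norm (ext N p (k + 2))"
      by (rule is_norm_ext[OF N True]) (use bound[of _ _ 2] in simp)
    have NF': "NF (ext N p (k + 2)) R [p, w]" by (rule NF_ext[OF N NF Rp])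
    have P: "pair (ext N p (k + 2)) p (k + 2) w \<kappa>"
      using ext_new_1[OF N] ext_base[where N=N, OF w'(1)] bwp' by (simp add: pair_def b_sym[of p w])
    have "\<exists>R'. NF (ext N p (k + 2)) R' []"
      using NF_pair[OF N' NF' P] by simp
    moreover have "- 4 * D * Q z \<in> unramified_class"
    proof -
      have "- 4 * D * Q z = D / Q w * (- gram p w)"
        using w' by (simp add: gram_sym[of p w] gwp)
      then show ?thesis using unramified_class_mult[OF D pair_gram(1)[OF N' P]] by simp
    qed
    ultimately have 0: "st0 (ext N p (k + 2)) (- 4 * D * Q z)"
      using N' by (simp add: st0_def)
    have "\<exists>y'. N y' k \<and> (\<exists>\<kappa>. st1 (ext (ext N p (k + 1)) (z' + y') (k + 1)) (- 4 * D * Q z * Q z') \<kappa>)"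
      if z': "orth N z'" "b p z' = 0" "Q z' \<noteq> 0" "ord (Q z') = k" for z'
    proof -
      obtain \<gamma> where \<gamma>: "\<gamma> \<noteq> 0" "2 * ord \<gamma> = k - \<kappa>" "hge (Q z' + \<gamma> * \<gamma> * Q w) (2 * k + 2)"
        using square_cancel[of "Q w" "Q z'"] w' z' ev by auto
      define q where "q = z' + \<gamma> \<cdot> w"
      have bw': "b w z' = 0" "b z' w = 0" using orth_isT[OF z'(1) w] by (auto simp: b_sym[of z' w])
      have zz: "b z z' = 0" using z'(2) by (simp add: p_def b_simps bw')
      have Rq: "b y q = 0" if "R y" for y
        using Rw[OF that] orth_R[OF z'(1) NF that] by (simp add: q_def b_simps)
      have Qq: "hge (Q q) (2 * (k + 1))"
        using \<gamma>(3) by (simp add: q_def Q_add Q_scale b_simps bw' algebra_simps)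
      have Qp1: "hge (Q p) (2 * (k + 1))" using True by (rule hge_mono) simp
      have bwq: "b w q = 2 * \<gamma> * Q w" by (simp add: q_def b_simps b_self bw')
      \<comment> \<open>Both vectors contain a multiple of \<open>w\<close>, so their product has
        doubled order exactly \<open>2 * (k + 1)\<close>: with weights \<open>k + 1\<close> they
        pair with each other, and \<open>w\<close> survives as the line.\<close>
      have bpq: "b p q = 2 * \<alpha> * \<gamma> * Q w"
        by (simp add: p_def q_def b_simps b_self bw bw' zz)
      have bpq': "b p q \<noteq> 0" "2 * ord (b p q) = (k + 1) + (k + 1)"
        using \<alpha> \<gamma> w' by (auto simp: bpq ord_mult)
      have bwq': "b w q \<noteq> 0" "2 * ord (b w q) = k + \<kappa> + 2"
        using \<gamma> w' by (auto simp: bwq ord_mult)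
      have boundq: "hge (b x q) (d + (k + 1))" if "N x d" for x d
        by (rule NF_bound[OF N NF Rq _ that])
          (use w bwq' in \<open>auto simp: hge_def intro!: exI[of _ \<kappa>]\<close>)
      let ?N1 = "ext N p (k + 1)"
      let ?N2 = "ext ?N1 q (k + 1)"
      have N1: "is_norm ?N1"
        by (rule is_norm_ext[OF N Qp1]) (use bound[of _ _ 1] in simp)
      have N2: "is_norm ?N2"
      proof (rule is_norm_ext[OF N1 Qq])
        fix x d assume "?N1 x d"
        then show "hge (b x q) (d + (k + 1))"
          by (rule bound_ext[OF boundq, rotated 2]) (use bpq' in \<open>auto simp: hge_def\<close>)
      qed
      have "NF ?N1 R [p, w]" by (rule NF_ext[OF N NF Rp])
      then have NF2: "NF ?N2 R [q, p, w]" by (rule NF_ext[OF N1 _ Rq])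
      have P2: "pair ?N2 q (k + 1) p (k + 1)"
        using ext_new_1[OF N1] ext_base[where N="?N1", OF ext_new_1[OF N]] bpq' by (simp add: pair_def b_sym[of q p])
      have wT: "isT ?N2 w \<kappa>" by (intro isT_ext w)
      have "\<exists>R'. NF ?N2 R' [proj q p w]"
        using NF_pair[OF N2 NF2 P2] wT by auto
      moreover have "isT ?N2 (proj q p w) \<kappa>"
        by (rule proj_isT[OF N2 P2 wT]) (use bwp' bwq' in \<open>auto simp: hge_def\<close>)
      moreover have "- 4 * D * Q z * Q z' / Q (proj q p w) \<in> unramified_class"
      proof -
        have nz: "Q (proj q p w) \<noteq> 0" using \<open>isT ?N2 (proj q p w) \<kappa>\<close> by (simp add: isT_def)
        have "Q (proj q p w) * gram q p = 4 * Q w * Q z' * Q z"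
          by (rule gram_proj_pair1[OF pair_gram(2)[OF N2 P2] bw'(1) bw(1) zz q_def p_def])
        then have "- 4 * D * Q z * Q z' / Q (proj q p w) = D / Q w * (- gram q p)"
          using nz w' by (simp add: field_simps)
        then show ?thesis using unramified_class_mult[OF D pair_gram(1)[OF N2 P2]] by simp
      qed
      ultimately have "st1 ?N2 (- 4 * D * Q z * Q z') \<kappa>"
        unfolding st1_def using N2 by blast
      moreover have "N (\<gamma> \<cdot> w) k"
        by (rule norm_scale'[OF N w'(1)]) (use \<gamma> in \<open>auto simp: hge_def\<close>)
      ultimately show ?thesis unfolding q_def by blast
    qed
    then show ?thesis using Ny 0 unfolding p_def by blast
  qed
qed

text \<open>Cancellation along \<open>w\<close> makes \<open>p\<close> inherit the coupling of
  \<open>w\<close> with \<open>v\<close>: at weight \<open>k + 1\<close> it pairs with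
  \<open>v\<close>. What survives is \<open>w\<close>, whose order has the parity of
  \<open>k\<close>.\<close>

lemma step_2_coupled:
  assumes st: "st2 False N D" and z: "orth N z" "Q z \<noteq> 0" "ord (Q z) = k"
  shows "\<exists>y \<kappa>. N y k \<and> even (\<kappa> + k) \<and> st1 (ext N (z + y) (k + 1)) (D * Q z) \<kappa>"
proof -
  have N: "is_norm N" using st by (simp add: st2_def)
  obtain R w v \<kappa> \<mu> where NF: "NF N R [w, v]" and w: "isT N w \<kappa>" and v: "isT N v \<mu>"
    and ev: "even (\<kappa> + k)" and odd: "odd (\<kappa> + \<mu>)" and \<beta>: "b w v \<noteq> 0" "2 * ord (b w v) = \<kappa> + \<mu> + 1"
    and D: "- D / gram w v \<in> unramified_class"
    using st2_parity[OF st, of k] by auto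
  have w': "N w \<kappa>" "Q w \<noteq> 0" "ord (Q w) = \<kappa>" using w by (auto simp: isT_def)
  obtain \<alpha> where \<alpha>: "\<alpha> \<noteq> 0" "2 * ord \<alpha> = k - \<kappa>" "hge (Q z + \<alpha> * \<alpha> * Q w) (2 * k + 2)"
    using square_cancel[of "Q w" "Q z"] w' z ev by auto
  define p where "p = z + \<alpha> \<cdot> w"
  have bw: "b w z = 0" "b z w = 0" using orth_isT[OF z(1) w] by (auto simp: b_sym[of z w])
  have bv: "b v z = 0" "b z v = 0" using orth_isT[OF z(1) v] by (auto simp: b_sym[of z v])
  have Rp: "b y p = 0" if "R y" for y
    using NF_orth[OF NF that] orth_R[OF z(1) NF that] by (simp add: p_def b_simps)
  have Qp: "hge (Q p) (2 * (k + 1))"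
    using \<alpha>(3) by (simp add: p_def Q_add Q_scale b_simps bw algebra_simps)
  have bwp: "hge (b w p) (\<kappa> + (k + 1) + 1)"
    using \<alpha> w' by (auto simp: p_def b_simps b_self bw hge_def ord_mult)
  have bvp: "b p v \<noteq> 0" "2 * ord (b p v) = (k + 1) + \<mu>"
    using \<alpha> \<beta> by (auto simp: p_def b_simps bv ord_mult)
  have Ny: "N (\<alpha> \<cdot> w) k"
    by (rule norm_scale'[OF N w'(1)]) (use \<alpha> in \<open>auto simp: hge_def\<close>)
  let ?N = "ext N p (k + 1)"
  have N': "is_norm ?N"
  proof (rule is_norm_ext[OF N Qp])
    fix x d assume x: "N x d"
    show "hge (b x p) (d + (k + 1))"
    proof (rule NF_bound[OF N NF Rp _ x])
      fix u assume "u \<in> set [w, v]"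
      then consider "u = w" | "u = v" by auto
      then show "\<exists>\<kappa>. isT N u \<kappa> \<and> hge (b u p) (\<kappa> + (k + 1))"
      proof cases
        case 1
        then show ?thesis using w bwp by (intro exI[of _ \<kappa>]) (auto elim: hge_mono)
      next
        case 2
        then show ?thesis using v bvp by (intro exI[of _ \<mu>]) (auto simp: b_sym[of v p] hge_def)
      qed
    qed
  qed
  have "NF ?N R [p, w, v]" by (rule NF_ext[OF N NF Rp])
  then have NF': "NF ?N R [p, v, w]" by (rule NF_swap2)
  have wT: "isT ?N w \<kappa>" and vT: "isT ?N v \<mu>" by (intro isT_ext w v)+
  have P: "pair ?N p (k + 1) v \<mu>"
    using ext_new_1[OF N] vT bvp by (simp add: pair_def isT_def)
  have "\<exists>R'. NF ?N R' [proj p v w]"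
    using NF_pair[OF N' NF' P] wT by auto
  moreover have wT': "isT ?N (proj p v w) \<kappa>"
    by (rule proj_isT[OF N' P wT]) (use bwp \<beta> in \<open>auto simp: hge_def\<close>)
  moreover have "D * Q z / Q (proj p v w) \<in> unramified_class"
  proof -
    have nz: "Q (proj p v w) \<noteq> 0" using wT' by (simp add: isT_def)
    have "Q (proj p v w) * gram p v = Q z * gram v w"
      by (rule gram_proj_line[OF pair_gram(2)[OF N' P] bv(1) bw(1), where \<alpha> = 0 and \<gamma> = \<alpha>]) (simp add: p_def)
    moreover have "gram v w \<noteq> 0"
      using unramified_class_ord(1)[OF D] gram_sym[of v w] by auto
    ultimately have "D * Q z / Q (proj p v w) = - D / gram w v * (- gram p v)"
      using nz by (simp add: field_simps gram_sym[of w v])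
    then show ?thesis using unramified_class_mult[OF D pair_gram(1)[OF N' P]] by simp
  qed
  ultimately have "st1 ?N (D * Q z) \<kappa>" unfolding st1_def using N' by blast
  then show ?thesis using Ny ev unfolding p_def by blast
qed

text \<open>Both lines are used: \<open>\<alpha> \<cdot> w\<close> removes the term of order
  \<open>k\<close> and \<open>\<gamma> \<cdot> v\<close> the next one. At weight
  \<open>k + 2\<close> the result pairs with \<open>w\<close>, so the line \<open>v\<close> of the
  wrong parity survives. If a second vector of order \<open>k\<close> follows, the two new vectors
  pair with each other at weight \<open>k + 1\<close>, and both lines survive, still
  uncoupled.\<close>

lemma step_2_uncoupled:
  assumes st: "st2 True N D" and z: "orth N z" "Q z \<noteq> 0" "ord (Q z) = k"
  shows "\<exists>y \<kappa>. N y k \<and> odd (\<kappa> + k) \<and> st1 (ext N (z + y) (k + 2)) (D * Q z) \<kappa> \<and>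
    (\<forall>z'. orth N z' \<longrightarrow> b (z + y) z' = 0 \<longrightarrow> Q z' \<noteq> 0 \<longrightarrow> ord (Q z') = k \<longrightarrow>
      (\<exists>y'. N y' k \<and> st2 True (ext (ext N (z + y) (k + 1)) (z' + y') (k + 1)) (- 4 * D * Q z * Q z')))"
proof -
  have N: "is_norm N" using st by (simp add: st2_def)
  obtain R w v \<kappa> \<mu> where NF: "NF N R [w, v]" and w: "isT N w \<kappa>" and v: "isT N v \<mu>"
    and ev: "even (\<kappa> + k)" and odd: "odd (\<kappa> + \<mu>)" and \<beta>: "hge (b w v) (\<kappa> + \<mu> + 3)"
    and D: "- D / gram w v \<in> unramified_class"
    using st2_parity[OF st, of k] by auto
  have w': "N w \<kappa>" "Q w \<noteq> 0" "ord (Q w) = \<kappa>" using w by (auto simp: isT_def)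
  have v': "N v \<mu>" "Q v \<noteq> 0" "ord (Q v) = \<mu>" using v by (auto simp: isT_def)
  have \<beta>': "hge (b v w) (\<kappa> + \<mu> + 3)" using \<beta> by (simp add: b_sym[of v w])
  have gnz: "gram w v \<noteq> 0" using unramified_class_ord(1)[OF D] by auto
  obtain \<alpha> where \<alpha>: "\<alpha> \<noteq> 0" "2 * ord \<alpha> = k - \<kappa>" "hge (Q z + \<alpha> * \<alpha> * Q w) (2 * k + 2)"
    using square_cancel[of "Q w" "Q z"] w' z ev by auto
  have \<alpha>': "hge \<alpha> (k - \<kappa>)" using \<alpha> by (simp add: hge_def)
  have par: "even (k + 1 + \<mu>)" using ev odd by presburger
  obtain \<gamma> where \<gamma>: "hge \<gamma> (k + 1 - \<mu>)" "hge (Q z + \<alpha> * \<alpha> * Q w + \<gamma> * \<gamma> * Q v) (2 * (k + 1) + 2)"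
    using square_cancel'[of "Q v" "Q z + \<alpha> * \<alpha> * Q w" "k + 1"] v' \<alpha>(3) par by auto
  define p where "p = z + (\<alpha> \<cdot> w + \<gamma> \<cdot> v)"
  have bw: "b w z = 0" "b z w = 0" using orth_isT[OF z(1) w] by (auto simp: b_sym[of z w])
  have bv: "b v z = 0" "b z v = 0" using orth_isT[OF z(1) v] by (auto simp: b_sym[of z v])
  have Rp: "b y p = 0" if "R y" for y
    using NF_orth[OF NF that] orth_R[OF z(1) NF that] by (simp add: p_def b_simps)
  have Qe: "Q p = Q z + \<alpha> * \<alpha> * Q w + \<gamma> * \<gamma> * Q v + \<alpha> * (\<gamma> * b w v)"
    by (simp add: p_def Q_add Q_scale b_simps bw bv)
  \<comment> \<open>The bounds \<open>k - \<kappa>\<close>, \<open>k + 1 - \<mu>\<close> and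
    \<open>\<kappa> + \<mu> + 3\<close> add up exactly to the required value: this is what the gap
    of 3 in \<open>st2 True\<close> is for.\<close>
  have "hge (\<alpha> * (\<gamma> * b w v)) (2 * (k + 1) + 2)"
    by (rule hge_mult_le[OF \<alpha>' hge_mult[OF \<gamma>(1) \<beta>]]) simp
  from hge_add[OF \<gamma>(2) this] have Qp: "hge (Q p) (2 * (k + 2))"
    unfolding Qe by (rule hge_mono) simp
  have e: "b w p = 2 * \<alpha> * Q w + \<gamma> * b w v" "b v p = 2 * \<gamma> * Q v + \<alpha> * b w v"
    by (simp_all add: p_def b_simps b_self bw bv b_sym[of v w])
  have o: "2 * \<alpha> * Q w \<noteq> 0" "2 * ord (2 * \<alpha> * Q w) = k + \<kappa> + 2"
    using \<alpha> w' by (auto simp: ord_mult)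
  have "hge (\<gamma> * b w v) (2 * ord (2 * \<alpha> * Q w) + 1)"
    by (rule hge_mult_le[OF \<gamma>(1) \<beta>]) (simp add: o)
  from ord_add_dominant[OF o(1) this] o
  have bwp: "b w p \<noteq> 0" "2 * ord (b w p) = k + \<kappa> + 2"
    unfolding e by auto
  have bvp: "hge (b v p) (\<mu> + k + 3)"
    unfolding e
  proof (rule hge_add)
    have "hge (2 * \<gamma>) (2 + (k + 1 - \<mu>))" by (rule hge_mult[OF _ \<gamma>(1)]) simp
    then show "hge (2 * \<gamma> * Q v) (\<mu> + k + 3)"
      by (rule hge_mult_le[of _ _ _ "2 * \<mu>"]) (use v' in \<open>auto simp: hge_def\<close>)
    show "hge (\<alpha> * b w v) (\<mu> + k + 3)" by (rule hge_mult_le[OF \<alpha>' \<beta>]) simp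
  qed
  have Ny: "N (\<alpha> \<cdot> w + \<gamma> \<cdot> v) k"
    by (intro norm_add[OF N] norm_scale'[OF N w'(1)] norm_scale'[OF N v'(1)] \<alpha>' hge_mono[OF \<gamma>(1)]) simp
  have bound: "hge (b x p) (d + (k + a))" if x: "N x d" and a: "a \<le> 2" for x d a
  proof (rule NF_bound[OF N NF Rp _ x])
    fix u assume "u \<in> set [w, v]"
    then consider "u = w" | "u = v" by auto
    then show "\<exists>\<kappa>. isT N u \<kappa> \<and> hge (b u p) (\<kappa> + (k + a))"
    proof cases
      case 1
      then show ?thesis using w bwp a by (intro exI[of _ \<kappa>]) (auto simp: hge_def)
    next
      case 2
      then show ?thesis using v hge_mono[OF bvp] a by (intro exI[of _ \<mu>]) auto
    qed
  qed
  have First: "st1 (ext N p (k + 2)) (D * Q z) \<mu>"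
  proof -
    let ?N = "ext N p (k + 2)"
    have N': "is_norm ?N"
      by (rule is_norm_ext[OF N Qp]) (use bound[of _ _ 2] in simp)
    have NF': "NF ?N R [p, w, v]" by (rule NF_ext[OF N NF Rp])
    have wT: "isT ?N w \<kappa>" and vT: "isT ?N v \<mu>" by (intro isT_ext w v)+
    have P: "pair ?N p (k + 2) w \<kappa>"
      using ext_new_1[OF N] wT bwp by (simp add: pair_def isT_def b_sym[of p w])
    have "\<exists>R'. NF ?N R' [proj p w v]"
      using NF_pair[OF N' NF' P] vT by auto
    moreover have vT': "isT ?N (proj p w v) \<mu>"
      by (rule proj_isT[OF N' P vT]) (rule hge_mono[OF bvp] hge_mono[OF \<beta>'], simp)+
    moreover have "D * Q z / Q (proj p w v) \<in> unramified_class"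
    proof -
      have nz: "Q (proj p w v) \<noteq> 0" using vT' by (simp add: isT_def)
      have "Q (proj p w v) * gram p w = Q z * gram w v"
        by (rule gram_proj_line[OF pair_gram(2)[OF N' P] bw(1) bv(1) p_def])
      then have "D * Q z / Q (proj p w v) = - D / gram w v * (- gram p w)"
        using nz gnz by (simp add: field_simps)
      then show ?thesis using unramified_class_mult[OF D pair_gram(1)[OF N' P]] by simp
    qed
    ultimately show ?thesis unfolding st1_def using N' by blast
  qed
  have Second: "\<exists>y'. N y' k \<and> st2 True (ext (ext N p (k + 1)) (z' + y') (k + 1)) (- 4 * D * Q z * Q z')"
    if z': "orth N z'" "b p z' = 0" "Q z' \<noteq> 0" "ord (Q z') = k" for z'
  proof -
    obtain \<delta> where \<delta>: "\<delta> \<noteq> 0" "2 * ord \<delta> = k - \<kappa>" "hge (Q z' + \<delta> * \<delta> * Q w) (2 * k + 2)"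
      using square_cancel[of "Q w" "Q z'"] w' z' ev by auto
    have \<delta>': "hge \<delta> (k - \<kappa>)" using \<delta> by (simp add: hge_def)
    define q where "q = z' + \<delta> \<cdot> w"
    have bw': "b w z' = 0" "b z' w = 0" using orth_isT[OF z'(1) w] by (auto simp: b_sym[of z' w])
    have bv': "b v z' = 0" "b z' v = 0" using orth_isT[OF z'(1) v] by (auto simp: b_sym[of z' v])
    have zz: "b z z' = 0" "b z' z = 0"
      using z'(2) by (auto simp: p_def b_simps bw' bv' b_sym[of z' z])
    have Rq: "b y q = 0" if "R y" for y
      using NF_orth[OF NF that] orth_R[OF z'(1) NF that] by (simp add: q_def b_simps)
    have Qq: "hge (Q q) (2 * (k + 1))"
      using \<delta>(3) by (simp add: q_def Q_add Q_scale b_simps bw' algebra_simps)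
    have Qp1: "hge (Q p) (2 * (k + 1))" using Qp by (rule hge_mono) simp
    have bwq: "b w q \<noteq> 0" "2 * ord (b w q) = k + \<kappa> + 2"
      using \<delta> w' by (auto simp: q_def b_simps b_self bw' ord_mult)
    have bvq: "hge (b v q) (\<mu> + k + 3)"
    proof -
      have "b v q = \<delta> * b v w" by (simp add: q_def b_simps bv')
      then show ?thesis using hge_mult_le[OF \<delta>' \<beta>'] by simp
    qed
    have bpq: "b p q \<noteq> 0" "2 * ord (b p q) = (k + 1) + (k + 1)"
    proof -
      have "b p q = \<delta> * b w p"
        using zz(1) bw' bv' bw by (simp add: p_def q_def b_simps b_self b_sym[of v w] algebra_simps)
      then show "b p q \<noteq> 0" "2 * ord (b p q) = (k + 1) + (k + 1)"
        using \<delta> bwp by (auto simp: ord_mult)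
    qed
    have boundq: "hge (b x q) (d + (k + 1))" if x: "N x d" for x d
    proof (rule NF_bound[OF N NF Rq _ x])
      fix u assume "u \<in> set [w, v]"
      then consider "u = w" | "u = v" by auto
      then show "\<exists>\<kappa>. isT N u \<kappa> \<and> hge (b u q) (\<kappa> + (k + 1))"
      proof cases
        case 1
        then show ?thesis using w bwq by (intro exI[of _ \<kappa>]) (auto simp: hge_def)
      next
        case 2
        then show ?thesis using v hge_mono[OF bvq] by (intro exI[of _ \<mu>]) auto
      qed
    qed
    let ?N1 = "ext N p (k + 1)"
    let ?N2 = "ext ?N1 q (k + 1)"
    have N1: "is_norm ?N1"
      by (rule is_norm_ext[OF N Qp1]) (use bound[of _ _ 1] in simp)
    have N2: "is_norm ?N2"
    proof (rule is_norm_ext[OF N1 Qq])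
      fix x d assume "?N1 x d"
      then show "hge (b x q) (d + (k + 1))"
        by (rule bound_ext[OF boundq, rotated 2]) (use bpq in \<open>auto simp: hge_def\<close>)
    qed
    have "NF ?N1 R [p, w, v]" by (rule NF_ext[OF N NF Rp])
    then have NF2: "NF ?N2 R [q, p, w, v]" by (rule NF_ext[OF N1 _ Rq])
    then have NF2: "NF ?N2 R [p, q, w, v]" by (rule NF_swap)
    have P2: "pair ?N2 p (k + 1) q (k + 1)"
      using ext_new_1[OF N1] ext_base[where N="?N1", OF ext_new_1[OF N]] bpq by (simp add: pair_def)
    have wT: "isT ?N2 w \<kappa>" and vT: "isT ?N2 v \<mu>" by (intro isT_ext w v)+
    have NF3: "\<exists>R'. NF ?N2 R' [proj p q w, proj p q v]"
      using NF_pair[OF N2 NF2 P2] wT vT by auto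
    have wT': "isT ?N2 (proj p q w) \<kappa>"
      by (rule proj_isT[OF N2 P2 wT]) (use bwp bwq in \<open>auto simp: hge_def\<close>)
    have vT': "isT ?N2 (proj p q v) \<mu>"
      by (rule proj_isT[OF N2 P2 vT]) (rule hge_mono[OF bvp] hge_mono[OF bvq], simp)+
    \<comment> \<open>The products of \<open>v\<close> with \<open>p\<close> and \<open>q\<close>
      exceed the sum of the weights by 2, and the coefficients of \<open>w\<close> are no worse than
      its weight predicts, so projecting preserves the gap.\<close>
    have bb: "hge (b (proj p q w) (proj p q v)) (\<kappa> + \<mu> + 3)"
    proof -
      have "hge (cf p q w) (\<kappa> + 1 - (k + 1))"
        by (rule cf_bound[OF N2 P2]) (use bwp bwq in \<open>auto simp: hge_def\<close>)
      from hge_mult_le[OF this bvp, of "\<kappa> + \<mu> + 3"] have 1: "hge (cf p q w * b p v) (\<kappa> + \<mu> + 3)"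
        by (simp add: b_sym[of p v])
      have "hge (cf q p w) (\<kappa> + 1 - (k + 1))"
        by (rule cf_bound[OF N2 pair_sym[OF P2]]) (use bwp bwq in \<open>auto simp: hge_def\<close>)
      from hge_mult_le[OF this bvq, of "\<kappa> + \<mu> + 3"] have 2: "hge (cf q p w * b q v) (\<kappa> + \<mu> + 3)"
        by (simp add: b_sym[of q v])
      show ?thesis
        unfolding b_proj_proj[OF pair_gram(2)[OF N2 P2]] by (intro hge_diff 1 2 \<beta>)
    qed
    have "- (- 4 * D * Q z * Q z') / gram (proj p q w) (proj p q v) \<in> unramified_class"
    proof -
      have g: "gram (proj p q w) (proj p q v) * gram p q = gram w v * (4 * Q z * Q z')"
        by (rule gram_proj_pair2[OF pair_gram(2)[OF N2 P2] bw(1) bw'(1) zz(2) bv(1) bv'(1) p_def q_def])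
      have "gram (proj p q w) (proj p q v) \<noteq> 0"
        using g gnz z(2) z'(3) by auto
      then have "- (- 4 * D * Q z * Q z') / gram (proj p q w) (proj p q v) = - D / gram w v * (- gram p q)"
        using g gnz by (simp add: field_simps)
      then show ?thesis using unramified_class_mult[OF D pair_gram(1)[OF N2 P2]] by simp
    qed
    then have "st2 True ?N2 (- 4 * D * Q z * Q z')"
      unfolding st2_def if_True using N2 NF3 wT' vT' odd bb by blast
    moreover have "N (\<delta> \<cdot> w) k" by (rule norm_scale'[OF N w'(1) \<delta>'])
    ultimately show ?thesis unfolding q_def by blast
  qed
  have "odd (\<mu> + k)" using ev odd by presburger
  then show ?thesis
    using Ny First Second unfolding p_def by blast
qed

section \<open>Adding an even unimodular block\<close>

text \<open>\<open>f\<close> and \<open>g\<close> form a pair of weights \<open>k\<close>, and the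
  lines are orthogonal to both, so the projection leaves them alone.\<close>

lemma even_block_NF:
  assumes N: "is_norm N" and NF: "NF N R T" and T: "\<And>u. u \<in> set T \<Longrightarrow> \<exists>\<kappa>. isT N u \<kappa>"
    and f: "orth N f" "orth N g" "hge (Q f) (2 * k)" "hge (Q g) (2 * k)" "b f g \<noteq> 0" "ord (b f g) = k"
  defines "N' \<equiv> ext (ext N f k) g k"
  shows "is_norm N'" "\<exists>R'. NF N' R' T" "- gram f g \<in> unramified_class"
proof -
  have N1: "is_norm (ext N f k)"
    by (rule is_norm_ext[OF N f(3)]) (simp add: orthD[OF f(1)])
  show N2: "is_norm N'"
    unfolding N'_def
  proof (rule is_norm_ext[OF N1 f(4)])
    fix x d assume "ext N f k x d"
    then show "hge (b x g) (d + k)"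
      by (rule bound_ext[rotated 2]) (use orthD[OF f(2)] f(5,6) in \<open>auto simp: hge_def\<close>)
  qed
  have "NF (ext N f k) R (f # T)" by (rule NF_ext[OF N NF orth_R[OF f(1) NF]])
  then have NF2: "NF N' R (g # f # T)"
    unfolding N'_def by (rule NF_ext[OF N1 _ orth_R[OF f(2) NF]])
  have P: "pair N' g k f k"
    unfolding N'_def pair_def
    using ext_new_1[OF N1] ext_base[where N = "ext N f k", OF ext_new_1[OF N]] f(5,6)
    by (simp add: b_sym[of g f])
  have TN: "\<exists>\<kappa>. isT N' u \<kappa>" if "u \<in> set T" for u
    using T[OF that] unfolding N'_def by (metis isT_ext)
  have "map (proj g f) T = T"
  proof (rule map_idI)
    fix u assume "u \<in> set T"
    then obtain \<kappa> where "isT N u \<kappa>" using T by blast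
    then show "proj g f u = u"
      using orth_isT f(1,2) by (intro proj_eq) blast+
  qed
  then show "\<exists>R'. NF N' R' T"
    using NF_pair[OF N2 NF2 P TN] by simp
  show "- gram f g \<in> unramified_class"
    using pair_gram(1)[OF N2 P] by (simp add: gram_sym)
qed

section \<open>Regularity and ramification of the three normal forms\<close>

definition reg_at :: "('v \<Rightarrow> int \<Rightarrow> bool) \<Rightarrow> int \<Rightarrow> bool" where
  "reg_at N c \<longleftrightarrow> (\<forall>x. N x c \<longrightarrow> hge (Q x) (2 * c + 2) \<longrightarrow>
     (\<forall>y d. N y d \<longrightarrow> hge (b x y) (c + 1 + d)) \<longrightarrow> N x (c + 1))"

lemma in_span_orth: "in_span N T \<tau> c \<Longrightarrow> (\<And>u. u \<in> set T \<Longrightarrow> b y u = 0) \<Longrightarrow> b y \<tau> = 0"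
  by (induction T arbitrary: \<tau>) (auto simp: b_simps)

text \<open>On \<open>R\<close> the condition on products suffices, by duality. Subtracting that
  component passes the condition on \<open>Q\<close> to the lines, where products alone say too
  little because \<open>b u u = 2 * Q u\<close>.\<close>

lemma NF_reg_at:
  assumes N: "is_norm N" and NF: "NF N R T"
    and T: "\<And>\<tau>. in_span N T \<tau> c \<Longrightarrow> hge (Q \<tau>) (2 * c + 2) \<Longrightarrow> N \<tau> (c + 1)"
  shows "reg_at N c"
  unfolding reg_at_def
proof (intro allI impI)
  fix x assume x: "N x c" "hge (Q x) (2 * c + 2)"
    and test: "\<forall>y d. N y d \<longrightarrow> hge (b x y) (c + 1 + d)"
  obtain y \<tau> where y: "x = y + \<tau>" "R y" "N y c" "in_span N T \<tau> c"
    using NF_split[OF NF x(1)] by blast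
  have orth: "b y' \<tau> = 0" if "R y'" for y'
    by (rule in_span_orth[OF y(4)]) (rule NF_orth[OF NF that])
  have Ny: "N y (c + 1)"
  proof (rule NF_dual[OF NF y(2)])
    fix y' d assume y': "R y'" "N y' d"
    have "hge (b x y') (c + 1 + d)" using test[rule_format, OF y'(2)] .
    then show "hge (b y y') (c + 1 + d)"
      using orth[OF y'(1)] by (simp add: y b_simps b_sym[of \<tau> y'])
  qed
  have "Q \<tau> = Q x - Q y" using orth[OF y(2)] by (simp add: y Q_add)
  moreover have "hge (Q y) (2 * c + 2)"
    using norm_Q[OF N Ny] by (simp add: algebra_simps)
  ultimately have "hge (Q \<tau>) (2 * c + 2)" using hge_diff[OF x(2)] by simp
  then show "N x (c + 1)"
    unfolding y(1) using T[OF y(4)] Ny by (intro norm_add[OF N])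
qed

lemma isT_improve:
  assumes N: "is_norm N" and w: "isT N w \<kappa>" and q: "hge (Q (t \<cdot> w)) (2 * c)"
  shows "N (t \<cdot> w) c"
proof -
  have "hge (Q w * (t * t)) (2 * c)" using q by (simp add: Q_scale ac_simps)
  then have "hge (t * t) (2 * c - 2 * \<kappa>)"
    using w by (simp add: isT_def hge_mult_cancel)
  then have "hge t (c - \<kappa>)" using hge_square[of t "c - \<kappa>"] by (simp add: right_diff_distrib)
  then show ?thesis using w by (intro norm_scale'[OF N, of w \<kappa>]) (auto simp: isT_def)
qed

lemma isT_parity:
  assumes N: "is_norm N" and w: "isT N w \<kappa>" and t: "N (t \<cdot> w) c" and odd: "odd (c - \<kappa>)"
  shows "N (t \<cdot> w) (c + 1)"
proof -
  have "hge t (c + 1 - \<kappa>)"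
    by (rule hge_round_even) (use isT_coeff[OF N w t] odd in auto)
  then show ?thesis using w by (intro norm_scale'[OF N, of w \<kappa>]) (auto simp: isT_def)
qed

lemma st0_reg_at:
  assumes "st0 N D"
  shows "reg_at N c"
proof -
  from assms
  obtain R where R: "is_norm N" "NF N R []" by (auto simp: st0_def)
  show ?thesis by (rule NF_reg_at[OF R]) (simp add: norm_0[OF R(1)])
qed

lemma st1_reg_at:
  assumes "st1 N D \<kappa>"
  shows "reg_at N c"
proof -
  obtain R w where N: "is_norm N" and NF: "NF N R [w]" and w: "isT N w \<kappa>"
    using assms by (auto simp: st1_def)
  show ?thesis
  proof (rule NF_reg_at[OF N NF])
    fix \<tau> assume t: "in_span N [w] \<tau> c" "hge (Q \<tau>) (2 * c + 2)"
    then obtain t where "\<tau> = t \<cdot> w" by auto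
    then show "N \<tau> (c + 1)" using isT_improve[OF N w, of t "c + 1"] t(2) by (simp add: algebra_simps)
  qed
qed

text \<open>Norms on a line have the parity of its order, so in degree \<open>c\<close> a multiple
  of the line of the other parity already has norm \<open>c + 1\<close> and affects neither
  \<open>Q\<close> nor the cross term. The remaining line is settled by \<open>Q\<close>.\<close>

lemma st2_reg_at:
  assumes "st2 \<beta> N D"
  shows "reg_at N c"
proof -
  have N: "is_norm N" using assms by (simp add: st2_def)
  obtain R w v \<kappa> \<mu> where NF: "NF N R [w, v]" and w: "isT N w \<kappa>" and v: "isT N v \<mu>"
    and ev: "even (\<kappa> + c)" and odd: "odd (\<kappa> + \<mu>)"
    and \<beta>: "if \<beta> then hge (b w v) (\<kappa> + \<mu> + 3) else b w v \<noteq> 0 \<and> 2 * ord (b w v) = \<kappa> + \<mu> + 1"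
    using st2_parity[OF assms, of c] by auto
  have b1: "hge (b w v) (\<kappa> + \<mu> + 1)"
    using \<beta> by (auto simp: hge_def split: if_splits)
  show ?thesis
  proof (rule NF_reg_at[OF N NF])
    fix \<tau> assume asm: "in_span N [w, v] \<tau> c" "hge (Q \<tau>) (2 * c + 2)"
    then obtain t s where ts: "\<tau> = t \<cdot> w + s \<cdot> v" "N (t \<cdot> w) c" "N (s \<cdot> v) c" by auto
    have par: "odd (c - \<mu>)" using ev odd by presburger
    have s1: "N (s \<cdot> v) (c + 1)" by (rule isT_parity[OF N v ts(3) par])
    have "hge (t * (s * b w v)) (2 * c + 2)"
      by (rule hge_mult_le[OF isT_coeff[OF N w ts(2)] hge_mult[OF isT_coeff[OF N v s1] b1]]) simp
    then have "hge (b (t \<cdot> w) (s \<cdot> v)) (2 * c + 2)" by (simp add: b_simps ac_simps)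
    moreover have "hge (Q (s \<cdot> v)) (2 * c + 2)"
      using norm_Q[OF N s1] by (simp add: algebra_simps)
    ultimately have "hge (Q \<tau> - Q (s \<cdot> v) - b (t \<cdot> w) (s \<cdot> v)) (2 * c + 2)"
      using asm(2) by (rule_tac hge_diff, rule_tac hge_diff)
    moreover have "Q \<tau> - Q (s \<cdot> v) - b (t \<cdot> w) (s \<cdot> v) = Q (t \<cdot> w)"
      by (simp add: ts Q_add)
    ultimately have "hge (Q (t \<cdot> w)) (2 * (c + 1))" by (simp only: distrib_left mult_1_right)
    then show "N \<tau> (c + 1)"
      unfolding ts using isT_improve[OF N w] s1 by (intro norm_add[OF N])
  qed
qed

text \<open>As \<open>\<kappa> + \<mu>\<close> is odd and \<open>2 * ord (b w v)\<close> even, the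
  two flags separate the minimal order from all larger ones. If the order is larger,
  \<open>4 * Q w * Q v\<close> dominates \<open>gram w v\<close> and \<open>D\<close> has odd order.
  If it is minimal, the square of \<open>b w v\<close> dominates with a relative error of order
  exactly 1.\<close>

lemma st2_ramified:
  assumes "st2 \<beta> N D"
  shows "ramified_class D"
proof -
  obtain w v \<kappa> \<mu> where w: "isT N w \<kappa>" and v: "isT N v \<mu>" and odd: "odd (\<kappa> + \<mu>)"
    and \<beta>: "if \<beta> then hge (b w v) (\<kappa> + \<mu> + 3) else b w v \<noteq> 0 \<and> 2 * ord (b w v) = \<kappa> + \<mu> + 1"
    and D: "- D / gram w v \<in> unramified_class"
    using assms unfolding st2_def by blast
  have w': "Q w \<noteq> 0" "ord (Q w) = \<kappa>" using w by (auto simp: isT_def)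
  have v': "Q v \<noteq> 0" "ord (Q v) = \<mu>" using v by (auto simp: isT_def)
  have q4: "4 * Q w * Q v \<noteq> 0" "ord (4 * Q w * Q v) = \<kappa> + \<mu> + 2"
    using w' v' by (auto simp: ord_mult)
  have nz: "gram w v \<noteq> 0" using unramified_class_ord(1)[OF D] by auto
  show ?thesis
  proof (cases \<beta>)
    case True
    have "hge (b w v * b w v) (2 * ord (4 * Q w * Q v) + 1)"
      by (rule hge_mult_le[of _ "\<kappa> + \<mu> + 3" _ "\<kappa> + \<mu> + 3"]) (use \<beta> True q4 in auto)
    then have "ord (4 * Q w * Q v + - (b w v * b w v)) = \<kappa> + \<mu> + 2"
      using ord_add_dominant[of "4 * Q w * Q v" "- (b w v * b w v)"] q4 by simp
    then have g: "ord (gram w v) = \<kappa> + \<mu> + 2" by (simp add: gram_def)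
    have D0: "D \<noteq> 0" using unramified_class_ord(1)[OF D] by auto
    have "even (ord (- D / gram w v))" by (rule unramified_class_ord(2)[OF D])
    then have "odd (ord D)" using D0 nz g odd by (auto simp: ord_divide)
    then show ?thesis by (rule ramified_class_odd[OF D0])
  next
    case False
    then have b0: "b w v \<noteq> 0" "2 * ord (b w v) = \<kappa> + \<mu> + 1" using \<beta> by auto
    obtain s y where s: "s \<noteq> 0" "hge y 0" "- D / gram w v = s * s * (1 + 4 * y)"
      using D by (auto simp: unramified_class_def)
    define t where "t = - (4 * Q w * Q v) / (b w v * b w v)"
    have t: "t \<noteq> 0" "ord t = 1" using q4 b0 by (auto simp: t_def ord_divide ord_mult)
    have t1: "1 + t \<noteq> 0" "ord (1 + t) = 0"
      using ord_add_dominant[of 1 t] t by (auto simp: hge_def)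
    have "hge (4 * y) 4" by (rule hge_mult_le[of _ 4 _ 0]) (use s in auto)
    then have "hge (4 * y * (1 + t)) (2 * ord t + 1)"
      by (rule hge_mult_le[of _ _ _ 0]) (use t1 t in \<open>auto simp: hge_def\<close>)
    from ord_add_dominant[OF t(1) this]
    have t': "t + 4 * y * (1 + t) \<noteq> 0" "ord (t + 4 * y * (1 + t)) = 1" using t by auto
    have g: "- gram w v = b w v * b w v * (1 + t)"
      using b0 by (simp add: gram_def t_def field_simps)
    have "- D = gram w v * (s * s * (1 + 4 * y))"
      using s(3) nz by (metis nonzero_mult_div_cancel_left times_divide_eq_right)
    then have "D = - gram w v * (s * s * (1 + 4 * y))"
      by (metis minus_minus minus_mult_left)
    also have "\<dots> = (b w v * s) * (b w v * s) * (1 + (t + 4 * y * (1 + t)))"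
      unfolding g by (simp add: algebra_simps)
    finally show ?thesis
      using ramified_class_unit[of "b w v * s" D] b0 s(1) t' by simp
  qed
qed

lemma st1_ord:
  assumes "st1 N D \<kappa>"
  shows "D \<noteq> 0" "even (ord D + \<kappa>)"
proof -
  obtain w where w: "isT N w \<kappa>" and D: "D / Q w \<in> unramified_class"
    using assms unfolding st1_def by blast
  show D0: "D \<noteq> 0" using unramified_class_ord(1)[OF D] by auto
  have "even (ord (D / Q w))" by (rule unramified_class_ord(2)[OF D])
  then show "even (ord D + \<kappa>)" using D0 w by (auto simp: isT_def ord_divide)
qed

definition stt :: "nat \<Rightarrow> ('v \<Rightarrow> int \<Rightarrow> bool) \<Rightarrow> 'a \<Rightarrow> bool" where
  "stt m N D \<longleftrightarrow> (if even m then st0 N D \<or> st2 True N D \<or> st2 False N D else \<exists>\<kappa>. st1 N D \<kappa>)"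

text \<open>Some line has an order of the parity of \<open>k\<close>, so a new vector of order
  \<open>k\<close> can be corrected and receives at least the weight \<open>k + 1\<close>.\<close>

definition rad :: "nat \<Rightarrow> ('v \<Rightarrow> int \<Rightarrow> bool) \<Rightarrow> 'a \<Rightarrow> int \<Rightarrow> bool" where
  "rad m N D k \<longleftrightarrow>
     (if even m then st2 True N D \<or> st2 False N D else \<exists>\<kappa>. even (\<kappa> + k) \<and> st1 N D \<kappa>)"

text \<open>Change of \<open>D_inv\<close> when a vector of value \<open>q\<close> is added
  orthogonally: a new factor -4 appears only when the degree becomes even.\<close>

definition disc_step :: "nat \<Rightarrow> 'a \<Rightarrow> 'a \<Rightarrow> 'a" where
  "disc_step m D q = (if even m then D * q else - 4 * D * q)"

lemma stt_regular:
  assumes "stt m N D"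
  shows "is_norm N \<and> reg_at N c"
proof -
  consider "st0 N D" | \<beta> where "st2 \<beta> N D" | \<kappa> where "st1 N D \<kappa>"
    using assms unfolding stt_def by (metis (full_types))
  then show ?thesis
  proof cases
    case 1
    then show ?thesis using st0_reg_at by (simp add: st0_def)
  next
    case 2
    then show ?thesis using st2_reg_at[OF 2] by (simp add: st2_def)
  next
    case 3
    then show ?thesis using st1_reg_at[OF 3] by (simp add: st1_def)
  qed
qed

lemma even_block_stt:
  assumes st: "stt m N D"
    and f: "orth N f" "orth N g" "hge (Q f) (2 * k)" "hge (Q g) (2 * k)" "b f g \<noteq> 0" "ord (b f g) = k"
  shows "stt (Suc (Suc m)) (ext (ext N f k) g k) (D * (- gram f g))"
proof -
  let ?N = "ext (ext N f k) g k"
  have 0: "st0 ?N (D * (- gram f g))" if st: "st0 N D"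
  proof -
    obtain R where R: "is_norm N" "NF N R []" and D: "D \<in> unramified_class"
      using st by (auto simp: st0_def)
    have "\<exists>\<kappa>. isT N u \<kappa>" if "u \<in> set []" for u using that by simp
    note * = even_block_NF[OF R this f]
    show ?thesis unfolding st0_def using *(1,2) unramified_class_mult[OF D *(3)] by blast
  qed
  have 1: "st1 ?N (D * (- gram f g)) \<kappa>" if st: "st1 N D \<kappa>" for \<kappa>
  proof -
    obtain R w where R: "is_norm N" "NF N R [w]" and w: "isT N w \<kappa>" and D: "D / Q w \<in> unramified_class"
      using st by (auto simp: st1_def)
    have "\<exists>\<kappa>. isT N u \<kappa>" if "u \<in> set [w]" for u using w that by auto
    note * = even_block_NF[OF R this f]
    have "isT ?N w \<kappa>" by (intro isT_ext w)
    moreover have "D * (- gram f g) / Q w \<in> unramified_class"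
      using unramified_class_mult[OF D *(3)] by (simp add: field_simps)
    ultimately show ?thesis using *(1,2) unfolding st1_def by blast
  qed
  have 2: "st2 \<beta> ?N (D * (- gram f g))" if st: "st2 \<beta> N D" for \<beta>
  proof -
    obtain R w v \<kappa> \<mu> where R: "is_norm N" "NF N R [w, v]" and wv: "isT N w \<kappa>" "isT N v \<mu>"
      and rest: "odd (\<kappa> + \<mu>)"
        "if \<beta> then hge (b w v) (\<kappa> + \<mu> + 3) else b w v \<noteq> 0 \<and> 2 * ord (b w v) = \<kappa> + \<mu> + 1"
      and D: "- D / gram w v \<in> unramified_class"
      using st unfolding st2_def by blast
    have "\<exists>\<kappa>. isT N u \<kappa>" if "u \<in> set [w, v]" for u using wv that by auto
    note * = even_block_NF[OF R this f]
    have "isT ?N w \<kappa>" "isT ?N v \<mu>" by (intro isT_ext wv)+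
    moreover have "- (D * (- gram f g)) / gram w v \<in> unramified_class"
      using unramified_class_mult[OF D *(3)] by (simp add: field_simps)
    ultimately show ?thesis using *(1,2) rest unfolding st2_def by blast
  qed
  show ?thesis using st 0 1 2 unfolding stt_def by (auto split: if_splits)
qed

section \<open>Norms given by weighted vectors\<close>

primrec Nrm :: "(nat \<Rightarrow> 'v) \<Rightarrow> (nat \<Rightarrow> int) \<Rightarrow> nat \<Rightarrow> 'v \<Rightarrow> int \<Rightarrow> bool" where
  "Nrm e a 0 = (\<lambda>x c. x = 0)"
| "Nrm e a (Suc m) = ext (Nrm e a m) (e m) (a m)"

lemma Nrm_cong: "(\<And>i. i < m \<Longrightarrow> e i = e' i \<and> a i = a' i) \<Longrightarrow> Nrm e a m = Nrm e' a' m"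
  by (induction m) auto

lemma Nrm_iff: "Nrm e a m x c \<longleftrightarrow> (\<exists>t. x = (\<Sum>i<m. t i \<cdot> e i) \<and> (\<forall>i<m. hge (t i) (c - a i)))"
proof (induction m arbitrary: x)
  case (Suc m)
  show ?case
  proof
    assume "Nrm e a (Suc m) x c"
    then obtain x' s where x: "x = x' + s \<cdot> e m" "Nrm e a m x' c" "hge s (c - a m)"
      by (auto simp: ext_def)
    then obtain t where t: "x' = (\<Sum>i<m. t i \<cdot> e i)" "\<forall>i<m. hge (t i) (c - a i)"
      using Suc by auto
    show "\<exists>t. x = (\<Sum>i<Suc m. t i \<cdot> e i) \<and> (\<forall>i<Suc m. hge (t i) (c - a i))"
      using x t by (intro exI[of _ "t(m := s)"]) (auto simp: less_Suc_eq)
  next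
    assume "\<exists>t. x = (\<Sum>i<Suc m. t i \<cdot> e i) \<and> (\<forall>i<Suc m. hge (t i) (c - a i))"
    then obtain t where t: "x = (\<Sum>i<Suc m. t i \<cdot> e i)" "\<forall>i<Suc m. hge (t i) (c - a i)"
      by blast
    have "Nrm e a m (\<Sum>i<m. t i \<cdot> e i) c" using Suc t by auto
    then show "Nrm e a (Suc m) x c" using t by (auto simp: ext_def)
  qed
qed auto

lemma Nrm_0_stt: "stt 0 (Nrm e a 0) 1"
proof -
  have "is_norm (\<lambda>x c. x = 0)" by (simp add: is_norm_def)
  moreover have "NF (\<lambda>x c. x = 0) (\<lambda>x. x = 0) []" by (simp add: NF_def)
  moreover have "1 \<in> unramified_class" using unramified_class_square[of 1] by simp
  ultimately show ?thesis by (auto simp: stt_def st0_def)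
qed

text \<open>Regularity is required in degree \<open>c\<close> only on the span of the vectors of weight at most
  \<open>c\<close>.\<close>

definition crit :: "(nat \<Rightarrow> 'v) \<Rightarrow> (nat \<Rightarrow> int) \<Rightarrow> nat \<Rightarrow> bool" where
  "crit e a m \<longleftrightarrow> (\<forall>i j. i \<le> j \<longrightarrow> j < m \<longrightarrow> a i \<le> a j) \<and> (\<forall>i<m. 0 \<le> a i) \<and> is_norm (Nrm e a m) \<and>
     (\<forall>p c. p \<le> m \<longrightarrow> (p < m \<longrightarrow> c < a p) \<longrightarrow> (\<forall>i<p. a i \<le> c) \<longrightarrow> reg_at (Nrm e a p) c)"

lemma crit_reg: "crit e a m \<Longrightarrow> p \<le> m \<Longrightarrow> (p < m \<Longrightarrow> c < a p) \<Longrightarrow> (\<And>i. i < p \<Longrightarrow> a i \<le> c) \<Longrightarrow>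
    reg_at (Nrm e a p) c"
  unfolding crit_def by simp

text \<open>The new weight is the largest, so the spans occurring in lower degrees are the old ones;
  the full span is regular in every degree by its normal form.\<close>

lemma crit_extend:
  assumes cr: "crit e a m" and eq: "\<And>i. i < m \<Longrightarrow> e' i = e i \<and> a' i = a i"
    and le: "\<And>i. i < m \<Longrightarrow> a i \<le> a' m" and pos: "0 \<le> a' m"
    and st: "stt (Suc m) (Nrm e' a' (Suc m)) D"
  shows "crit e' a' (Suc m)"
proof -
  have N: "Nrm e' a' p = Nrm e a p" if "p \<le> m" for p
    using that eq by (intro Nrm_cong) auto
  have reg: "reg_at (Nrm e' a' p) c"
    if asm: "p \<le> Suc m" "p < Suc m \<longrightarrow> c < a' p" "\<forall>i<p. a' i \<le> c" for p c
  proof (cases "p = Suc m")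
    case True
    then show ?thesis using stt_regular[OF st] by blast
  next
    case False
    then have p: "p \<le> m" using asm by simp
    have "reg_at (Nrm e a p) c"
      by (rule crit_reg[OF cr p]) (use asm p eq in force)+
    then show ?thesis using N[OF p] by simp
  qed
  have mono: "a' i \<le> a' j" if "i \<le> j" "j < Suc m" for i j
    using that cr eq le unfolding crit_def
    by (cases "j = m"; cases "i = m") (auto simp: less_Suc_eq)
  have "0 \<le> a' i" if "i < Suc m" for i
    using that cr eq pos unfolding crit_def by (auto simp: less_Suc_eq)
  then show ?thesis
    unfolding crit_def
    using reg mono conjunct1[OF stt_regular[OF st]] by (intro conjI allI impI) blast+
qed

text \<open>With two equal last weights the span that omits only the last vector never occurs in the
  criterion, so no normal form is needed for it.\<close>

lemma crit_extend2:
  assumes cr: "crit e a m" and eq: "\<And>i. i < m \<Longrightarrow> e' i = e i \<and> a' i = a i"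
    and le: "\<And>i. i < m \<Longrightarrow> a i \<le> a' m" and pos: "0 \<le> a' m" and a2: "a' (Suc m) = a' m"
    and st: "stt (Suc (Suc m)) (Nrm e' a' (Suc (Suc m))) D"
  shows "crit e' a' (Suc (Suc m))"
proof -
  have N: "Nrm e' a' p = Nrm e a p" if "p \<le> m" for p
    using that eq by (intro Nrm_cong) auto
  have reg: "reg_at (Nrm e' a' p) c"
    if asm: "p \<le> Suc (Suc m)" "p < Suc (Suc m) \<longrightarrow> c < a' p" "\<forall>i<p. a' i \<le> c" for p c
  proof -
    consider "p = Suc (Suc m)" | "p = Suc m" | "p \<le> m" using asm(1) by linarith
    then show ?thesis
    proof cases
      case 1
      then show ?thesis using stt_regular[OF st] by blast
    next
      case 2
      then show ?thesis using asm a2 by force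
    next
      case 3
      have "reg_at (Nrm e a p) c"
        by (rule crit_reg[OF cr 3]) (use asm 3 eq in force)+
      then show ?thesis using N[OF 3] by simp
    qed
  qed
  have mono: "a' i \<le> a' j" if "i \<le> j" "j < Suc (Suc m)" for i j
  proof (cases "j < m")
    case True
    then show ?thesis using that cr eq unfolding crit_def by auto
  next
    case False
    then have j: "a' j = a' m" using that a2 by (auto simp: less_Suc_eq)
    show ?thesis
    proof (cases "i < m")
      case True
      then show ?thesis using eq le j by auto
    next
      case False
      then show ?thesis using that a2 j by (auto simp: less_Suc_eq le_Suc_eq)
    qed
  qed
  have "0 \<le> a' i" if "i < Suc (Suc m)" for i
    using that cr eq pos a2 unfolding crit_def by (auto simp: less_Suc_eq)
  then show ?thesis
    unfolding crit_def
    using reg mono conjunct1[OF stt_regular[OF st]] by (intro conjI allI impI) blast+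
qed

text \<open>The coefficients have doubled order at least -1, and doubled orders are even. This
  rounding is why earlier weights may exceed the order \<open>k\<close> of the new vector by 1, but
  not by 2.\<close>

lemma Nrm_integral:
  assumes "Nrm e a m y k" "\<And>i. i < m \<Longrightarrow> a i \<le> k + 1"
  shows "\<exists>t. y = (\<Sum>i<m. t i \<cdot> e i) \<and> (\<forall>i<m. hge (t i) 0)"
proof -
  obtain t where t: "y = (\<Sum>i<m. t i \<cdot> e i)" "\<forall>i<m. hge (t i) (k - a i)"
    using assms(1) by (auto simp: Nrm_iff)
  have "hge (t i) 0" if "i < m" for i
    by (rule hge_round_even) (use hge_mono[of "t i" "k - a i" "-1"] t assms(2)[OF that] that in auto)
  then show ?thesis using t by blast
qed

text \<open>What is needed to add a second vector \<open>z'\<close> of the same order \<open>k\<close>: the weights of the last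
  vector and of the new one both become \<open>k + 1\<close>.\<close>

definition low :: "(nat \<Rightarrow> 'v) \<Rightarrow> (nat \<Rightarrow> int) \<Rightarrow> nat \<Rightarrow> 'a \<Rightarrow> int \<Rightarrow> bool" where
  "low e a m D k \<longleftrightarrow> crit e a m \<and> (\<forall>i<m. a i \<le> k + 1) \<and>
     (\<forall>z'. orth (Nrm e a m) z' \<longrightarrow> b (e m) z' = 0 \<longrightarrow> Q z' \<noteq> 0 \<longrightarrow> ord (Q z') = k \<longrightarrow>
       (\<exists>y'. Nrm e a m y' k \<and> stt (Suc (Suc m)) (ext (ext (Nrm e a m) (e m) (k + 1)) (z' + y') (k + 1))
         (disc_step (Suc m) D (Q z'))))"

section \<open>Adding diagonal vectors\<close>

text \<open>State after a vector of order \<open>k\<close> was placed at index \<open>m\<close>,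
  with \<open>D0\<close> the discriminant before it. The weight \<open>k + 2\<close> occurs only
  when no line is left or when the surviving line has the wrong parity; in the latter case the
  ramification of \<open>D0\<close> is recorded, to be compared with \<xi> later.
  \<open>first\<close> announces that another vector of order \<open>k\<close> may follow.\<close>

definition tail :: "bool \<Rightarrow> (nat \<Rightarrow> 'v) \<Rightarrow> (nat \<Rightarrow> int) \<Rightarrow> nat \<Rightarrow> 'a \<Rightarrow> int \<Rightarrow> 'a \<Rightarrow> bool" where
  "tail first e a m D k D0 \<longleftrightarrow> crit e a (Suc m) \<and> stt (Suc m) (Nrm e a (Suc m)) D \<and>
     ((\<forall>i<Suc m. a i \<le> k + 1) \<and>
         (first \<longrightarrow> (\<forall>i<Suc m. a i \<le> k) \<or> rad (Suc m) (Nrm e a (Suc m)) D k) \<or>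
      (\<forall>i<Suc m. a i \<le> k + 2) \<and> odd m \<and> st0 (Nrm e a (Suc m)) D \<and> (first \<longrightarrow> low e a m D k) \<or>
      (\<forall>i<Suc m. a i \<le> k + 2) \<and> even m \<and> (\<exists>\<kappa>. odd (\<kappa> + k) \<and> st1 (Nrm e a (Suc m)) D \<kappa>) \<and>
         ramified_class D0 \<and> (first \<longrightarrow> low e a m D k))"

lemma tail_weaken: "tail True e a m D k D0 \<Longrightarrow> tail False e a m D k D0"
  unfolding tail_def by auto

text \<open>An earlier weight \<open>k + 1\<close> is harmless exactly when the new vector also
  receives at least \<open>k + 1\<close>, which \<open>rad\<close> guarantees.\<close>

lemma diagonal_step_first:
  assumes cr: "crit e a m" and st: "stt m (Nrm e a m) D"
    and z: "orth (Nrm e a m) z" "Q z \<noteq> 0" "ord (Q z) = k" "0 \<le> k"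
    and bd: "(\<forall>i<m. a i \<le> k) \<or> (\<forall>i<m. a i \<le> k + 1) \<and> rad m (Nrm e a m) D k"
  shows "\<exists>y \<alpha>. (\<exists>t. y = (\<Sum>i<m. t i \<cdot> e i) \<and> (\<forall>i<m. hge (t i) 0)) \<and>
    tail True (e(m := z + y)) (a(m := \<alpha>)) m (disc_step m D (Q z)) k D"
proof -
  let ?N = "Nrm e a m"
  let ?D = "disc_step m D (Q z)"
  have Nm: "Nrm (e(m := y)) (a(m := \<alpha>)) m = ?N" for y \<alpha>
    by (rule Nrm_cong) auto
  have NS: "Nrm (e(m := y)) (a(m := \<alpha>)) (Suc m) = ext ?N y \<alpha>" for y \<alpha>
    by (simp only: Nrm.simps Nm fun_upd_same)
  have crm: "crit (e(m := y)) (a(m := \<alpha>)) m" for y \<alpha>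
  proof -
    have "Nrm (e(m := y)) (a(m := \<alpha>)) p = Nrm e a p" if "p \<le> m" for p
      using that by (intro Nrm_cong) auto
    then show ?thesis using cr unfolding crit_def by auto
  qed
  have crS: "crit (e(m := y)) (a(m := \<alpha>)) (Suc m)"
    if "stt (Suc m) (ext ?N y \<alpha>) D'" "\<And>i. i < m \<Longrightarrow> a i \<le> \<alpha>" "0 \<le> \<alpha>" for y \<alpha> D'
    by (rule crit_extend[OF cr, where D = D']) (use that NS in auto)
  have bd1: "a i \<le> k + 1" if "i < m" for i using bd that by fastforce
  have int: "\<exists>t. y = (\<Sum>i<m. t i \<cdot> e i) \<and> (\<forall>i<m. hge (t i) 0)" if "?N y k" for y
    using Nrm_integral[OF that bd1] by blast
  have int0: "\<exists>t. 0 = (\<Sum>i<m. t i \<cdot> e i) \<and> (\<forall>i<m. hge (t i) 0)"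
    by (rule exI[of _ "\<lambda>_. 0"]) simp
  have low: "low (e(m := y)) (a(m := \<alpha>)) m ?D k"
    if "\<And>z'. orth ?N z' \<Longrightarrow> b y z' = 0 \<Longrightarrow> Q z' \<noteq> 0 \<Longrightarrow> ord (Q z') = k \<Longrightarrow>
       \<exists>y'. ?N y' k \<and> stt (Suc (Suc m)) (ext (ext ?N y (k + 1)) (z' + y') (k + 1))
         (disc_step (Suc m) ?D (Q z'))" for y \<alpha>
    unfolding low_def Nm fun_upd_same using crm bd1 that by auto
  \<comment> \<open>In (d) and (e) no line can correct \<open>z\<close>, and it keeps the weight
    \<open>k\<close>; the other three cases raise it.\<close>
  consider (a) "even m" "st2 True ?N D" | (b) "even m" "st2 False ?N D"
    | (c) \<kappa> where "odd m" "even (\<kappa> + k)" "st1 ?N D \<kappa>"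
    | (d) "even m" "st0 ?N D" "\<forall>i<m. a i \<le> k"
    | (e) \<kappa> where "odd m" "odd (\<kappa> + k)" "st1 ?N D \<kappa>" "\<forall>i<m. a i \<le> k"
    using st bd unfolding stt_def rad_def by (auto split: if_splits)
  then show ?thesis
  proof cases
    case a
    obtain y \<kappa> where y: "?N y k" "odd (\<kappa> + k)" "st1 (ext ?N (z + y) (k + 2)) (D * Q z) \<kappa>"
      "\<forall>z'. orth ?N z' \<longrightarrow> b (z + y) z' = 0 \<longrightarrow> Q z' \<noteq> 0 \<longrightarrow> ord (Q z') = k \<longrightarrow>
        (\<exists>y'. ?N y' k \<and> st2 True (ext (ext ?N (z + y) (k + 1)) (z' + y') (k + 1)) (- 4 * D * Q z * Q z'))"
      using step_2_uncoupled[OF a(2) z(1-3)] by blast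
    have D: "?D = D * Q z" using a by (simp add: disc_step_def)
    have st': "stt (Suc m) (ext ?N (z + y) (k + 2)) ?D"
      using a y(3) unfolding stt_def D by auto
    have "low (e(m := z + y)) (a(m := k + 2)) m ?D k"
    proof (rule low)
      fix z' assume "orth ?N z'" "b (z + y) z' = 0" "Q z' \<noteq> 0" "ord (Q z') = k"
      then obtain y' where "?N y' k"
        "st2 True (ext (ext ?N (z + y) (k + 1)) (z' + y') (k + 1)) (- 4 * D * Q z * Q z')"
        using y(4) by blast
      then show "\<exists>y'. ?N y' k \<and> stt (Suc (Suc m)) (ext (ext ?N (z + y) (k + 1)) (z' + y') (k + 1))
         (disc_step (Suc m) ?D (Q z'))"
        using a unfolding stt_def D by (intro exI[of _ y']) (simp add: disc_step_def mult.assoc)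
    qed
    moreover have "crit (e(m := z + y)) (a(m := k + 2)) (Suc m)"
      by (rule crS[OF st']) (use bd1 z in force)+
    moreover have "\<forall>i<Suc m. (a(m := k + 2)) i \<le> k + 2"
      using bd1 by (force simp: less_Suc_eq)
    ultimately have "tail True (e(m := z + y)) (a(m := k + 2)) m ?D k D"
      unfolding tail_def NS using a y(2,3) st' st2_ramified[OF a(2)] D by auto
    then show ?thesis using int[OF y(1)] by blast
  next
    case b
    obtain y \<kappa> where y: "?N y k" "even (\<kappa> + k)" "st1 (ext ?N (z + y) (k + 1)) (D * Q z) \<kappa>"
      using step_2_coupled[OF b(2) z(1-3)] by blast
    have D: "?D = D * Q z" using b by (simp add: disc_step_def)
    have st': "stt (Suc m) (ext ?N (z + y) (k + 1)) ?D"
      using b y(3) unfolding stt_def D by auto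
    have "crit (e(m := z + y)) (a(m := k + 1)) (Suc m)"
      by (rule crS[OF st']) (use bd1 z in force)+
    moreover have "\<forall>i<Suc m. (a(m := k + 1)) i \<le> k + 1"
      using bd1 by (force simp: less_Suc_eq)
    moreover have "rad (Suc m) (ext ?N (z + y) (k + 1)) ?D k"
      using b y unfolding rad_def D by auto
    ultimately have "tail True (e(m := z + y)) (a(m := k + 1)) m ?D k D"
      unfolding tail_def NS using st' by blast
    then show ?thesis using int[OF y(1)] by blast
  next
    case c
    have D: "?D = - 4 * D * Q z" using c by (simp add: disc_step_def)
    obtain y where y: "?N y k" "st2 False (ext ?N (z + y) (k + 1)) (- 4 * D * Q z) \<or>
      st0 (ext ?N (z + y) (k + 2)) (- 4 * D * Q z) \<and>
      (\<forall>z'. orth ?N z' \<longrightarrow> b (z + y) z' = 0 \<longrightarrow> Q z' \<noteq> 0 \<longrightarrow> ord (Q z') = k \<longrightarrow>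
      (\<exists>y'. ?N y' k \<and> (\<exists>\<kappa>. st1 (ext (ext ?N (z + y) (k + 1)) (z' + y') (k + 1)) (- 4 * D * Q z * Q z') \<kappa>)))"
      using step_1_even[OF c(3) z(1-3) c(2)] by blast
    from y(2) show ?thesis
    proof
      assume s: "st2 False (ext ?N (z + y) (k + 1)) (- 4 * D * Q z)"
      have st': "stt (Suc m) (ext ?N (z + y) (k + 1)) ?D"
        using c s unfolding stt_def D by auto
      have "crit (e(m := z + y)) (a(m := k + 1)) (Suc m)"
        by (rule crS[OF st']) (use bd1 z in force)+
      moreover have "\<forall>i<Suc m. (a(m := k + 1)) i \<le> k + 1"
        using bd1 by (force simp: less_Suc_eq)
      moreover have "rad (Suc m) (ext ?N (z + y) (k + 1)) ?D k"
        using c s unfolding rad_def D by auto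
      ultimately have "tail True (e(m := z + y)) (a(m := k + 1)) m ?D k D"
        unfolding tail_def NS using st' by blast
      then show ?thesis using int[OF y(1)] by blast
    next
      assume s: "st0 (ext ?N (z + y) (k + 2)) (- 4 * D * Q z) \<and>
        (\<forall>z'. orth ?N z' \<longrightarrow> b (z + y) z' = 0 \<longrightarrow> Q z' \<noteq> 0 \<longrightarrow> ord (Q z') = k \<longrightarrow>
        (\<exists>y'. ?N y' k \<and> (\<exists>\<kappa>. st1 (ext (ext ?N (z + y) (k + 1)) (z' + y') (k + 1)) (- 4 * D * Q z * Q z') \<kappa>)))"
      have st': "stt (Suc m) (ext ?N (z + y) (k + 2)) ?D"
        using c s unfolding stt_def D by auto
      have "low (e(m := z + y)) (a(m := k + 2)) m ?D k"
      proof (rule low)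
        fix z' assume "orth ?N z'" "b (z + y) z' = 0" "Q z' \<noteq> 0" "ord (Q z') = k"
        then obtain y' \<kappa> where "?N y' k"
          "st1 (ext (ext ?N (z + y) (k + 1)) (z' + y') (k + 1)) (- 4 * D * Q z * Q z') \<kappa>"
          using s by blast
        then show "\<exists>y'. ?N y' k \<and> stt (Suc (Suc m)) (ext (ext ?N (z + y) (k + 1)) (z' + y') (k + 1))
           (disc_step (Suc m) ?D (Q z'))"
          using c unfolding stt_def D by (intro exI[of _ y']) (auto simp add: disc_step_def)
      qed
      moreover have "crit (e(m := z + y)) (a(m := k + 2)) (Suc m)"
        by (rule crS[OF st']) (use bd1 z in force)+
      moreover have "\<forall>i<Suc m. (a(m := k + 2)) i \<le> k + 2"
        using bd1 by (force simp: less_Suc_eq)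
      ultimately have "tail True (e(m := z + y)) (a(m := k + 2)) m ?D k D"
        unfolding tail_def NS using c s st' D by auto
      then show ?thesis using int[OF y(1)] by blast
    qed
  next
    case d
    have D: "?D = D * Q z" using d by (simp add: disc_step_def)
    have s: "st1 (ext ?N z k) (D * Q z) k" by (rule step_0[OF d(2) z(1-3)])
    have st': "stt (Suc m) (ext ?N z k) ?D"
      using d s unfolding stt_def D by auto
    have "crit (e(m := z)) (a(m := k)) (Suc m)"
      by (rule crS[OF st']) (use d z in auto)
    moreover have "\<forall>i<Suc m. (a(m := k)) i \<le> k" using d by (auto simp: less_Suc_eq)
    moreover have "\<forall>i<Suc m. (a(m := k)) i \<le> k + 1" using d by (auto simp: less_Suc_eq)
    ultimately have "tail True (e(m := z)) (a(m := k)) m ?D k D"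
      unfolding tail_def NS using st' by blast
    then show ?thesis using int0 by (intro exI[of _ 0] exI[of _ k]) simp
  next
    case e
    have D: "?D = - 4 * D * Q z" using e by (simp add: disc_step_def)
    have s: "st2 True (ext ?N z k) (- 4 * D * Q z)" by (rule step_1_odd[OF e(3) z(1-3) e(2)])
    have st': "stt (Suc m) (ext ?N z k) ?D"
      using e s unfolding stt_def D by auto
    have "crit (e(m := z)) (a(m := k)) (Suc m)"
      by (rule crS[OF st']) (use e z in auto)
    moreover have "\<forall>i<Suc m. (a(m := k)) i \<le> k" using e by (auto simp: less_Suc_eq)
    moreover have "\<forall>i<Suc m. (a(m := k)) i \<le> k + 1" using e by (auto simp: less_Suc_eq)
    ultimately have "tail True (e(m := z)) (a(m := k)) m ?D k D"
      unfolding tail_def NS using st' by blast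
    then show ?thesis using int0 by (intro exI[of _ 0] exI[of _ k]) simp
  qed
qed

lemma Nrm_basis: "i < m \<Longrightarrow> Nrm e a m (e i) (a i)"
  unfolding Nrm_iff
proof (intro exI conjI)
  assume i: "i < m"
  show "e i = (\<Sum>j<m. (if j = i then 1 else 0) \<cdot> e j)"
    using i by (simp add: if_distrib[of "\<lambda>t. t \<cdot> _"] cong: if_cong)
qed (auto simp: hge_def)

text \<open>Unless the previous vector reached the weight \<open>k + 2\<close>, the new one is
  treated as a first one. Otherwise \<open>low\<close> goes back to the state before: the previous
  vector is kept, and its weight is lowered to \<open>k + 1\<close>.\<close>

lemma diagonal_step_second:
  assumes tl: "tail True e a m D k D0"
    and z: "orth (Nrm e a (Suc m)) z" "Q z \<noteq> 0" "ord (Q z) = k" "0 \<le> k"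
  shows "\<exists>y a'. (\<exists>t. y = (\<Sum>i<Suc m. t i \<cdot> e i) \<and> (\<forall>i<Suc m. hge (t i) 0)) \<and>
    tail False (e(Suc m := z + y)) a' (Suc m) (disc_step (Suc m) D (Q z)) k D"
proof -
  have cr: "crit e a (Suc m)" and st: "stt (Suc m) (Nrm e a (Suc m)) D"
    using tl by (auto simp: tail_def)
  have "low e a m D k \<or> (\<forall>i<Suc m. a i \<le> k) \<or>
      (\<forall>i<Suc m. a i \<le> k + 1) \<and> rad (Suc m) (Nrm e a (Suc m)) D k"
    using tl unfolding tail_def by auto
  then show ?thesis
  proof
    assume bd: "(\<forall>i<Suc m. a i \<le> k) \<or>
      (\<forall>i<Suc m. a i \<le> k + 1) \<and> rad (Suc m) (Nrm e a (Suc m)) D k"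
    show ?thesis
      using diagonal_step_first[OF cr st z bd] tail_weaken by blast
  next
    assume low: "low e a m D k"
    let ?N = "Nrm e a m"
    have crm: "crit e a m" and le: "\<And>i. i < m \<Longrightarrow> a i \<le> k + 1" using low by (auto simp: low_def)
    have "orth ?N z"
      unfolding orth_def
    proof (intro allI impI)
      fix x c assume "?N x c"
      then have "Nrm e a (Suc m) x c" by (simp add: ext_base)
      then show "b x z = 0" by (rule orthD[OF z(1)])
    qed
    moreover have "b (e m) z = 0"
      by (rule orthD[OF z(1) Nrm_basis]) simp
    ultimately obtain y where y: "?N y k"
      "stt (Suc (Suc m)) (ext (ext ?N (e m) (k + 1)) (z + y) (k + 1)) (disc_step (Suc m) D (Q z))"
      using low z(2,3) unfolding low_def by blast
    define e' where "e' = e(Suc m := z + y)"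
    define a' where "a' = a(m := k + 1, Suc m := k + 1)"
    have "Nrm e' a' m = ?N" by (rule Nrm_cong) (auto simp: e'_def a'_def)
    then have N: "Nrm e' a' (Suc (Suc m)) = ext (ext ?N (e m) (k + 1)) (z + y) (k + 1)"
      by (simp add: e'_def a'_def)
    have "crit e' a' (Suc (Suc m))"
      by (rule crit_extend2[OF crm, where D = "disc_step (Suc m) D (Q z)"])
        (use y le z(4) N in \<open>auto simp: e'_def a'_def\<close>)
    moreover have "\<forall>i<Suc (Suc m). a' i \<le> k + 1"
      using le by (auto simp: a'_def less_Suc_eq)
    ultimately have "tail False e' a' (Suc m) (disc_step (Suc m) D (Q z)) k D"
      unfolding tail_def N using y(2) by blast
    moreover obtain t where t: "y = (\<Sum>i<m. t i \<cdot> e i)" "\<forall>i<m. hge (t i) 0"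
      using Nrm_integral[OF y(1) le] by blast
    moreover have "y = (\<Sum>i<Suc m. (t(m := 0)) i \<cdot> e i)" "\<forall>i<Suc m. hge ((t(m := 0)) i) 0"
      using t by (auto simp: less_Suc_eq)
    ultimately show ?thesis unfolding e'_def by blast
  qed
qed

lemma even_block_step:
  assumes cr: "crit e a m" and st: "stt m (Nrm e a m) D" and le: "\<And>i. i < m \<Longrightarrow> a i \<le> k" and k: "0 \<le> k"
    and f: "orth (Nrm e a m) f" "orth (Nrm e a m) g" "hge (Q f) (2 * k)" "hge (Q g) (2 * k)"
      "b f g \<noteq> 0" "ord (b f g) = k"
  defines "e' \<equiv> e(m := f, Suc m := g)" and "a' \<equiv> a(m := k, Suc m := k)"
  shows "crit e' a' (Suc (Suc m))" "stt (Suc (Suc m)) (Nrm e' a' (Suc (Suc m))) (D * (- gram f g))"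
    "\<And>i. i < Suc (Suc m) \<Longrightarrow> a' i \<le> k"
proof -
  have "Nrm e' a' m = Nrm e a m" by (rule Nrm_cong) (auto simp: e'_def a'_def)
  then have N: "Nrm e' a' (Suc (Suc m)) = ext (ext (Nrm e a m) f k) g k"
    by (simp add: e'_def a'_def)
  show st': "stt (Suc (Suc m)) (Nrm e' a' (Suc (Suc m))) (D * (- gram f g))"
    unfolding N by (rule even_block_stt[OF st f])
  show "crit e' a' (Suc (Suc m))"
    by (rule crit_extend2[OF cr _ _ _ _ st']) (use le k in \<open>auto simp: e'_def a'_def\<close>)
  show "a' i \<le> k" if "i < Suc (Suc m)" for i
    using that le by (auto simp: a'_def less_Suc_eq)
qed

section \<open>Lexicographic maximality\<close>

lemma initial_segment:
  fixes a :: "nat \<Rightarrow> int"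
  assumes "\<And>i j. i \<le> j \<Longrightarrow> j < n \<Longrightarrow> a i \<le> a j"
  shows "\<exists>p\<le>n. \<forall>i<n. i < p \<longleftrightarrow> a i \<le> d"
  using assms
proof (induction n)
  case (Suc n)
  then obtain p where p: "p \<le> n" "\<forall>i<n. i < p \<longleftrightarrow> a i \<le> d" by fastforce
  show ?case
  proof (cases "a n \<le> d")
    case True
    have "a i \<le> d" if "i < Suc n" for i using Suc.prems[of i n] that True by simp
    then show ?thesis by (intro exI[of _ "Suc n"]) simp
  next
    case False
    then show ?thesis using p by (intro exI[of _ p]) (auto simp: less_Suc_eq)
  qed
qed simp

lemma b_sum_left: "b (\<Sum>i\<in>A. f i) y = (\<Sum>i\<in>A. b (f i) y)"
  by (induction A rule: infinite_finite_induct) (auto simp: b_simps)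

lemma b_sum_right: "b y (\<Sum>i\<in>A. f i) = (\<Sum>i\<in>A. b y (f i))"
  by (induction A rule: infinite_finite_induct) (auto simp: b_simps)

text \<open>\<open>g\<close> is the weight vector of a rival basis \<open>u\<close>, and
  \<open>k\<close> is the first place where it is larger. Regularity in degrees up to
  \<open>a k\<close> makes the base change respect ever finer truncations of the weights, until the
  columns from \<open>k\<close> on are too divisible for a unit determinant.\<close>

lemma GK_lex_maximal:
  fixes e :: "nat \<Rightarrow> 'v" and a g :: "nat \<Rightarrow> int"
  assumes cr: "crit e a n"
    and ind: "\<And>p x y. p \<le> n \<Longrightarrow> (\<Sum>i<p. x i \<cdot> e i) = (\<Sum>i<p. y i \<cdot> e i) \<Longrightarrow> \<forall>i<p. x i = y i"
    and U: "U \<in> carrier_mat n n" "\<And>i j. i < n \<Longrightarrow> j < n \<Longrightarrow> hge (U $$ (i, j)) 0"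
      "det U \<noteq> 0" "ord (det U) = 0"
    and u: "\<And>j. u j = (\<Sum>i<n. U $$ (i, j) \<cdot> e i)"
    and g: "\<And>j. j < n \<Longrightarrow> hge (Q (u j)) (2 * g j)"
      "\<And>i j. i < n \<Longrightarrow> j < n \<Longrightarrow> hge (b (u i) (u j)) (g i + g j)"
      "\<And>i j. i \<le> j \<Longrightarrow> j < n \<Longrightarrow> g i \<le> g j"
    and k: "k < n" "\<And>i. i < k \<Longrightarrow> g i = a i" "a k < g k"
  shows False
proof -
  have mono: "a i \<le> a j" if "i \<le> j" "j < n" for i j using cr that unfolding crit_def by blast
  have pos: "0 \<le> a i" if "i < n" for i using cr that unfolding crit_def by blast
  have N: "is_norm (Nrm e a n)" using cr unfolding crit_def by blast
  define W where "W = inverse (det U) \<cdot>\<^sub>m adj_mat U"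
  have W: "W \<in> carrier_mat n n" using adj_mat(1)[OF U(1)] by (simp add: W_def)
  have UW: "(\<Sum>m<n. U $$ (i, m) * W $$ (m, l)) = (if i = l then 1 else 0)" if "i < n" "l < n" for i l
  proof -
    have "U * W = inverse (det U) \<cdot>\<^sub>m (U * adj_mat U)"
      unfolding W_def using U(1) adj_mat(1)[OF U(1)] by (simp add: mult_smult_distrib)
    also have "\<dots> = 1\<^sub>m n"
      unfolding adj_mat(2)[OF U(1)] using U(3) by (intro eq_matI) auto
    finally have "(U * W) $$ (i, l) = (if i = l then 1 else 0)" using that by simp
    then show ?thesis
      using that U(1) W by (simp add: scalar_prod_def lessThan_atLeast0)
  qed
  have e_u: "e l = (\<Sum>m<n. W $$ (m, l) \<cdot> u m)" if l: "l < n" for l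
  proof -
    have "(\<Sum>m<n. W $$ (m, l) \<cdot> u m) = (\<Sum>m<n. \<Sum>i<n. (U $$ (i, m) * W $$ (m, l)) \<cdot> e i)"
      unfolding u scale_sum_right by (simp add: mult.commute)
    also have "\<dots> = (\<Sum>i<n. (\<Sum>m<n. U $$ (i, m) * W $$ (m, l)) \<cdot> e i)"
      by (subst sum.swap) (simp add: scale_sum_left)
    also have "\<dots> = (\<Sum>i<n. (if i = l then 1 else 0) \<cdot> e i)"
      using UW l by (intro sum.cong) auto
    also have "\<dots> = e l" using l by (simp add: if_distrib[of "\<lambda>t. t \<cdot> _"] cong: if_cong)
    finally show ?thesis by simp
  qed
  \<comment> \<open>\<open>U\<close> respects the weights cut off at \<open>d\<close>. For
    \<open>d = 0\<close> this is integrality, and \<open>d = a k\<close> is the goal of the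
    induction.\<close>
  define H where "H d \<longleftrightarrow> (\<forall>i j. i < n \<longrightarrow> j < n \<longrightarrow> hge (U $$ (i, j)) (min (a j) d - min (a i) d))" for d
  have HD: "hge (U $$ (i, j)) (min (a j) d - min (a i) d)" if "H d" "i < n" "j < n" for d i j
    using that by (simp add: H_def)
  \<comment> \<open>The part of \<open>u j\<close> in the span of the vectors of weight at most
    \<open>d\<close> satisfies the hypotheses of \<open>reg_at\<close> in degree \<open>d\<close>;
    hence its norm, and with it each of its coefficients, improves by 1.\<close>
  have strict: "hge (U $$ (i, j)) (d + 1 - a i)"
    if H: "H d" and j: "j < n" "d \<le> a j" "d < g j" "d \<le> a k" and i: "i < n" "a i \<le> d" for d i j
  proof -
    obtain p where p_le: "p \<le> n" and set: "\<And>l. l < n \<Longrightarrow> l < p \<longleftrightarrow> a l \<le> d"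
      using initial_segment[of n a d] mono by blast
    have ap: "a l \<le> d" if "l < p" for l using that set[of l] p_le by simp
    have ap': "d < a l" if "p \<le> l" "l < n" for l using that set[of l] by simp
    have g_ge: "min (a m) d \<le> g m" if m: "m < n" for m
    proof (cases "m < k")
      case True
      then show ?thesis using k(2) by simp
    next
      case False
      then have "g k \<le> g m" using g(3)[of k m] m by simp
      then show ?thesis using j(4) k(3) by linarith
    qed
    define x where "x = (\<Sum>i<p. U $$ (i, j) \<cdot> e i)"
    define r where "r = (\<Sum>i = p..<n. U $$ (i, j) \<cdot> e i)"
    have uxr: "u j = x + r"
      unfolding u x_def r_def using p_le
      by (metis (no_types, lifting) atLeast0LessThan le0 sum.atLeastLessThan_concat)
    have xc: "hge (U $$ (l, j)) (d - a l)" if "l < p" for l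
      using HD[OF H, of l j] j ap[OF that] that p_le by (simp add: min_def split: if_splits)
    have xN: "Nrm e a p x d" unfolding Nrm_iff x_def using xc by (intro exI[of _ "\<lambda>i. U $$ (i, j)"]) auto
    have up: "Nrm e a n y f" if y: "Nrm e a p y f" for y f
    proof -
      have "Nrm e a q y f" if "p \<le> q" for q
        using that
      proof (induction q rule: dec_induct)
        case base
        show ?case by (rule y)
      next
        case (step q)
        then show ?case by (simp add: ext_base)
      qed
      then show ?thesis using p_le by blast
    qed
    have xn: "Nrm e a n x d" by (rule up[OF xN])
    have rn: "Nrm e a n r (d + 1)"
      unfolding Nrm_iff
    proof (intro exI conjI allI impI)
      let ?t = "\<lambda>i. if i < p then 0 else U $$ (i, j)"
      have "(\<Sum>i<n. ?t i \<cdot> e i) = (\<Sum>i\<in>{..<n}. if i \<in> {p..<n} then U $$ (i, j) \<cdot> e i else 0)"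
        by (intro sum.cong) auto
      also have "\<dots> = (\<Sum>i\<in>{..<n} \<inter> {p..<n}. U $$ (i, j) \<cdot> e i)"
        by (rule sum.inter_restrict[symmetric]) simp
      also have "{..<n} \<inter> {p..<n} = {p..<n}" by auto
      finally show "r = (\<Sum>i<n. ?t i \<cdot> e i)" unfolding r_def by simp
      show "hge (?t l) (d + 1 - a l)" if "l < n" for l
        using hge_mono[OF U(2)[OF that j(1)]] ap'[of l] that by auto
    qed
    have "reg_at (Nrm e a p) d"
      by (rule crit_reg[OF cr p_le]) (use ap ap' in auto)
    moreover have "hge (Q x) (2 * d + 2)"
    proof -
      have "hge (Q (u j)) (2 * d + 2)" using g(1)[OF j(1)] j(3) by (auto elim!: hge_mono)
      moreover have "hge (Q r) (2 * d + 2)" using norm_Q[OF N rn] by (simp add: algebra_simps)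
      \<comment> \<open>The norms give only \<open>2 * d + 1\<close>; doubled orders are
        even.\<close>
      moreover have "hge (b x r) (2 * d + 2)"
        by (rule hge_round_even) (use norm_b[OF N xn rn] in \<open>auto simp: algebra_simps\<close>)
      ultimately have "hge (Q (u j) - Q r - b x r) (2 * d + 2)" by (intro hge_diff)
      moreover have "Q (u j) - Q r - b x r = Q x" by (simp add: uxr Q_add)
      ultimately show ?thesis by simp
    qed
    moreover have "hge (b x y) (d + 1 + f)" if y: "Nrm e a p y f" for y f
    proof -
      obtain t where t: "y = (\<Sum>l<p. t l \<cdot> e l)" "\<forall>l<p. hge (t l) (f - a l)"
        using y by (auto simp: Nrm_iff)
      \<comment> \<open>\<open>e l\<close> is expressed in the rival basis by the inverse matrix
        \<open>W\<close>, whose entries inherit the bounds of \<open>H d\<close>; the loss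
        \<open>min (a m) d\<close> in them is made up by the rival bound \<open>g m\<close>.\<close>
      have be: "hge (b (u j) (e l)) (d + 1 + a l)" if l: "l < p" for l
      proof -
        have ln: "l < n" using l p_le by simp
        have "hge (W $$ (m, l) * b (u j) (u m)) (d + 1 + a l)" if m: "m < n" for m
        proof -
          have "hge (adj_mat U $$ (m, l)) (min (a l) d - min (a m) d)"
            by (rule adj_bound[OF U(1)]) (use H m ln in \<open>auto simp: H_def\<close>)
          then have "hge (W $$ (m, l)) (0 + (a l - min (a m) d))"
            unfolding W_def using adj_mat(1)[OF U(1)] m ln ap[OF l] U(3,4)
            by (auto intro!: hge_mult simp: hge_def[of "inverse _"] ord_inverse simp del: add_0)
          moreover have "hge (b (u j) (u m)) (d + 1 + min (a m) d)"
            using g(2)[OF j(1) m] by (rule hge_mono) (use g_ge[OF m] j(3) in linarith)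
          ultimately show ?thesis by (rule hge_mult_le) simp
        qed
        then show ?thesis unfolding e_u[OF ln] b_sum_right b_scale_right
          by (intro hge_sum) auto
      qed
      have "hge (b (u j) y) (d + 1 + f)"
        unfolding t b_sum_right b_scale_right
      proof (rule hge_sum)
        fix l assume "l \<in> {..<p}"
        then show "hge (t l * b (u j) (e l)) (d + 1 + f)"
          using t be by (intro hge_mult_le[of "t l" "f - a l" _ "d + 1 + a l"]) auto
      qed
      moreover have "hge (b r y) (d + 1 + f)" by (rule norm_b[OF N rn up[OF y]])
      ultimately have "hge (b (u j) y - b r y) (d + 1 + f)" by (rule hge_diff)
      then show ?thesis by (simp add: uxr b_simps)
    qed
    ultimately have "Nrm e a p x (d + 1)"
      using xN unfolding reg_at_def by blast
    then obtain t where t: "x = (\<Sum>l<p. t l \<cdot> e l)" "\<forall>l<p. hge (t l) (d + 1 - a l)"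
      by (auto simp: Nrm_iff)
    have "\<forall>l<p. t l = U $$ (l, j)"
      by (rule ind[OF p_le]) (use t x_def in simp)
    moreover have "i < p" using i set by simp
    ultimately show ?thesis using t by metis
  qed
  have g_gt: "d < g j" if "j < n" "d < a j" "d \<le> a k" for d j
  proof (cases "j < k")
    case True
    then show ?thesis using k(2) that by simp
  next
    case False
    then have "g k \<le> g j" using g(3)[of k j] that by simp
    then show ?thesis using k(3) that by linarith
  qed
  have Hd: "H (int d)" if "int d \<le> a k" for d
    using that
  proof (induction d)
    case 0
    then show ?case using U(2) pos by (simp add: H_def)
  next
    case (Suc d)
    then have Hd: "H (int d)" by simp
    show ?case unfolding H_def
    proof (intro allI impI)
      fix i j assume ij: "i < n" "j < n"
      consider "int d < a i" | "a i \<le> int d" "a j \<le> int d" | "a i \<le> int d" "int d < a j" by linarith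
      then show "hge (U $$ (i, j)) (min (a j) (int (Suc d)) - min (a i) (int (Suc d)))"
      proof cases
        case 1
        then show ?thesis using hge_mono[OF U(2)[OF ij]] by simp
      next
        case 2
        then show ?thesis using HD[OF Hd ij] by (simp add: min_def split: if_splits)
      next
        case 3
        have "hge (U $$ (i, j)) (int d + 1 - a i)"
          by (rule strict[OF Hd ij(2)]) (use 3 ij Suc g_gt[of j "int d"] in auto)
        then show ?thesis by (rule hge_mono) (use 3 in auto)
      qed
    qed
  qed
  define c where "c = a k"
  have Hc: "H c" using Hd[of "nat c"] pos[OF k(1)] by (simp add: c_def)
  \<comment> \<open>Column weights against row weights. At index \<open>k\<close> they are
    \<open>c + 1\<close> and \<open>c\<close>, and nowhere is the column weight smaller, so the
    determinant would have positive order.\<close>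
  let ?s1 = "\<lambda>j. if j < k then a j else c + 1"
  let ?s2 = "\<lambda>i. min (a i) (c + 1)"
  have "hge (det U) (sum ?s1 {0..<n} - sum ?s2 {0..<n})"
  proof (rule det_bound[OF U(1)])
    fix i j assume ij: "i < n" "j < n"
    show "hge (U $$ (i, j)) (?s1 j - ?s2 i)"
    proof (cases "a i \<le> c")
      case False
      have "a j \<le> c" if "j < k" using mono[of j k] that k(1) by (simp add: c_def)
      then show ?thesis using False hge_mono[OF U(2)[OF ij]] by auto
    next
      case ai: True
      show ?thesis
      proof (cases "j < k")
        case True
        then have "a j \<le> c" using mono[of j k] k(1) by (simp add: c_def)
        then show ?thesis using HD[OF Hc ij] ai True by (simp add: min_def split: if_splits)
      next
        case False
        have "hge (U $$ (i, j)) (c + 1 - a i)"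
          by (rule strict[OF Hc ij(2)])
            (use False ai ij mono[of k j] g(3)[of k j] k(3) in \<open>auto simp: c_def\<close>)
        then show ?thesis using False ai by (simp add: min_def)
      qed
    qed
  qed
  moreover have "sum ?s2 {0..<n} < sum ?s1 {0..<n}"
  proof (rule sum_strict_mono_ex1)
    show "\<forall>i\<in>{0..<n}. ?s2 i \<le> ?s1 i" by auto
    show "\<exists>i\<in>{0..<n}. ?s2 i < ?s1 i" using k(1) by (intro bexI[of _ k]) (auto simp: c_def)
  qed simp
  ultimately show False using U(3,4) by (auto simp: hge_def)
qed

end

section \<open>The lattice of a matrix\<close>

definition vscale :: "'a::field \<Rightarrow> (nat \<Rightarrow> 'a) \<Rightarrow> nat \<Rightarrow> 'a" where
  "vscale c x = (\<lambda>i. c * x i)"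

text \<open>The factor 2 makes this the full polar form, so that \<open>Q (psi i)\<close> is the
  diagonal entry of \<open>B\<close>. Vectors are functions on all of nat, and coordinates from
  \<open>n\<close> on are ignored.\<close>

definition bil :: "nat \<Rightarrow> 'a::field mat \<Rightarrow> (nat \<Rightarrow> 'a) \<Rightarrow> (nat \<Rightarrow> 'a) \<Rightarrow> 'a" where
  "bil n B x y = (\<Sum>i<n. \<Sum>j<n. 2 * B $$ (i, j) * x i * y j)"

definition psi :: "nat \<Rightarrow> nat \<Rightarrow> 'a::field" where
  "psi i = (\<lambda>j. if j = i then 1 else 0)"

definition basis_mat :: "(nat \<Rightarrow> nat \<Rightarrow> 'a::field) \<Rightarrow> nat \<Rightarrow> 'a mat" where
  "basis_mat e m = mat m m (\<lambda>(i, j). e j i)"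

lemma sum_fun_eval: "(\<Sum>i\<in>A. f i) l = (\<Sum>i\<in>A. f i l)" for f :: "_ \<Rightarrow> nat \<Rightarrow> 'a::comm_monoid_add"
  by (induction A rule: infinite_finite_induct) auto

lemma gram_index:
  fixes A U :: "'a::comm_ring_1 mat"
  assumes "A \<in> carrier_mat m m" "U \<in> carrier_mat m m" "i < m" "j < m"
  shows "(transpose_mat U * A * U) $$ (i, j) = (\<Sum>k<m. \<Sum>l<m. U $$ (k, i) * A $$ (k, l) * U $$ (l, j))"
  using assms by (simp add: scalar_prod_def lessThan_atLeast0 sum_distrib_left mult.assoc)

lemma not_lex_le:
  assumes "length b = n" "length a = n" "\<not> lex_le b a"
  shows "\<exists>k<n. (\<forall>i<k. b ! i = a ! i) \<and> a ! k < b ! k"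
proof -
  have "\<exists>k. k < n \<and> b ! k \<noteq> a ! k"
    using assms nth_equalityI[of b a] by (auto simp: lex_le_def)
  then obtain k where k: "k < n" "b ! k \<noteq> a ! k" "\<And>i. i < k \<Longrightarrow> \<not> (i < n \<and> b ! i \<noteq> a ! i)"
    using exists_least_iff[of "\<lambda>k. k < n \<and> b ! k \<noteq> a ! k"] by blast
  then have eq: "b ! i = a ! i" if "i < k" for i using that by fastforce
  have "take k b = take k a"
    using k(1) assms eq by (intro nth_equalityI) auto
  then have "\<not> b ! k < a ! k"
    using assms k(1) by (auto simp: lex_le_def)
  then show ?thesis using k eq by (intro exI[of _ k]) auto
qed

locale dyadic_lattice = dyadic_field ord
  for ord :: "'a::field_char_0 \<Rightarrow> int" +
  fixes n :: nat and B :: "'a mat"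
  assumes symmetric: "\<And>i j. i < n \<Longrightarrow> j < n \<Longrightarrow> B $$ (i, j) = B $$ (j, i)"
begin

sublocale dyadic_quadratic_space ord vscale "bil n B"
proof unfold_locales
  show "bil n B x y = bil n B y x" for x y
  proof -
    have "bil n B x y = (\<Sum>j<n. \<Sum>i<n. 2 * B $$ (i, j) * x i * y j)"
      unfolding bil_def by (rule sum.swap)
    also have "\<dots> = bil n B y x"
      unfolding bil_def by (intro sum.cong refl) (auto simp: symmetric)
    finally show ?thesis .
  qed
  show "bil n B (x + y) z = bil n B x z + bil n B y z" for x y z
    by (simp add: bil_def algebra_simps sum.distrib)
  show "bil n B (vscale t x) y = t * bil n B x y" for t x y
    by (simp add: bil_def vscale_def sum_distrib_left algebra_simps)
qed (auto simp: vscale_def algebra_simps fun_eq_iff)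

lemma bil_psi_right: "l < n \<Longrightarrow> bil n B x (psi l) = (\<Sum>i<n. 2 * B $$ (i, l) * x i)"
  by (simp add: bil_def psi_def if_distrib[of "\<lambda>t. _ * t"] cong: if_cong)

lemma bil_psi_psi: "l < n \<Longrightarrow> m < n \<Longrightarrow> bil n B (psi m) (psi l) = 2 * B $$ (m, l)"
  by (simp add: bil_psi_right) (simp add: psi_def if_distrib[of "\<lambda>t. _ * t"] cong: if_cong)

lemma Q_psi: "l < n \<Longrightarrow> Q (psi l) = B $$ (l, l)"
  by (simp add: Q_def bil_psi_psi)

text \<open>Each vector is the corresponding standard vector plus an integral combination of earlier
  ones. This yields independence, a base change of determinant 1, and compatibility with the flag of
  spans all at once.\<close>

definition unitri :: "(nat \<Rightarrow> nat \<Rightarrow> 'a) \<Rightarrow> nat \<Rightarrow> bool" where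
  "unitri e m \<longleftrightarrow> (\<forall>i<m. e i i = 1 \<and> (\<forall>l>i. e i l = 0) \<and> (\<forall>l. hge (e i l) 0))"

lemma comb_apply: "(\<Sum>i\<in>A. vscale (x i) (e i)) l = (\<Sum>i\<in>A. x i * e i l)"
  by (simp add: sum_fun_eval vscale_def)

lemma unitri_independent:
  assumes "unitri e m" "p \<le> m" "(\<Sum>i<p. vscale (x i) (e i)) = (\<Sum>i<p. vscale (y i) (e i))"
  shows "\<forall>i<p. x i = y i"
  using assms(2,3)
proof (induction p)
  case (Suc p)
  have e: "e p p = 1" "\<And>i. i < p \<Longrightarrow> e i p = 0"
    using assms(1) Suc.prems(1) by (auto simp: unitri_def)
  have ev: "(\<Sum>i<Suc p. vscale (t i) (e i)) p = t p" for t
    unfolding comb_apply using e by simp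
  have "x p = (\<Sum>i<Suc p. vscale (x i) (e i)) p" by (rule ev[symmetric])
  also have "\<dots> = (\<Sum>i<Suc p. vscale (y i) (e i)) p" by (simp only: Suc.prems(2))
  also have "\<dots> = y p" by (rule ev)
  finally have p: "x p = y p" .
  then have "(\<Sum>i<p. vscale (x i) (e i)) = (\<Sum>i<p. vscale (y i) (e i))"
    using Suc.prems(2) unfolding sum.lessThan_Suc by (simp only: add_right_cancel)
  then show ?case using Suc p by (auto simp: less_Suc_eq)
qed simp

lemma unitri_extend:
  assumes "unitri e m" "\<forall>i<m. hge (t i) 0" "y = (\<Sum>i<m. vscale (t i) (e i))"
  shows "unitri (e(m := psi m + y)) (Suc m)"
proof -
  have y: "y l = (\<Sum>i<m. t i * e i l)" for l by (simp only: assms(3) comb_apply)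
  have "y l = 0" if "l \<ge> m" for l
    unfolding y using assms(1) that by (intro sum.neutral) (auto simp: unitri_def)
  moreover have "hge (y l) 0" for l
    unfolding y using assms(1,2) by (intro hge_sum hge_mult_0) (auto simp: unitri_def)
  ultimately have "(psi m + y) m = 1" "\<And>l. l > m \<Longrightarrow> (psi m + y) l = 0" "\<And>l. hge ((psi m + y) l) 0"
    by (auto simp: psi_def)
  then show ?thesis using assms(1) unfolding unitri_def by (auto simp: less_Suc_eq)
qed

lemma Nrm_support: "unitri e m \<Longrightarrow> Nrm e a m x c \<Longrightarrow> m \<le> l \<Longrightarrow> x l = 0"
  unfolding Nrm_iff by (auto simp: comb_apply unitri_def intro!: sum.neutral)

lemma basis_mat_GL:
  assumes "unitri e m"
  shows "basis_mat e m \<in> GL_o ord m"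
proof -
  have c: "basis_mat e m \<in> carrier_mat m m" by (simp add: basis_mat_def)
  have "upper_triangular (basis_mat e m)"
    using assms by (auto simp: basis_mat_def unitri_def)
  then have "det (basis_mat e m) = prod_list (diag_mat (basis_mat e m))"
    by (rule det_upper_triangular[OF _ c])
  also have "diag_mat (basis_mat e m) = map (\<lambda>_. 1) [0..<m]"
    using assms by (auto simp: diag_mat_def basis_mat_def unitri_def)
  also have "prod_list (map (\<lambda>_. 1) [0..<m]) = (1 :: 'a)"
    by (induction m) auto
  finally show ?thesis
    using c assms by (auto simp: GL_o_def is_unit_o_def in_o_def ordge_iff basis_mat_def unitri_def)
qed

lemma bil_restrict:
  assumes "m \<le> n" "\<And>l. m \<le> l \<Longrightarrow> x l = 0" "\<And>l. m \<le> l \<Longrightarrow> y l = 0"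
  shows "bil n B x y = (\<Sum>i<m. \<Sum>j<m. 2 * B $$ (i, j) * x i * y j)"
proof -
  have "bil n B x y = (\<Sum>i<m. \<Sum>j<n. 2 * B $$ (i, j) * x i * y j)"
    unfolding bil_def using assms by (intro sum.mono_neutral_right) auto
  also have "\<dots> = (\<Sum>i<m. \<Sum>j<m. 2 * B $$ (i, j) * x i * y j)"
    using assms by (intro sum.cong refl sum.mono_neutral_right) auto
  finally show ?thesis .
qed

text \<open>The weights are the GK invariant: they are attained by the basis itself, and a vector
  not below them in \<open>lex_le\<close> has a first place where it is larger, which
  \<open>GK_lex_maximal\<close> refutes. Only the corner \<open>A\<close> of \<open>B\<close>
  matters, since the first \<open>m\<close> vectors have no coordinates beyond it.\<close>

lemma optimal_of_crit:
  assumes m: "m \<le> n" and A: "A \<in> carrier_mat m m" "\<And>i j. i < m \<Longrightarrow> j < m \<Longrightarrow> A $$ (i, j) = B $$ (i, j)"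
    and e: "unitri e m" and cr: "crit e a m"
  shows "optimal_basis ord m A (basis_mat e m)"
proof -
  let ?U = "basis_mat e m"
  have Uc: "?U \<in> carrier_mat m m" by (simp add: basis_mat_def)
  define G where "G = transpose_mat ?U * A * ?U"
  have Gc: "G \<in> carrier_mat m m" using Uc A by (simp add: G_def)
  have G: "2 * G $$ (i, j) = bil n B (e i) (e j)" if ij: "i < m" "j < m" for i j
  proof -
    have "bil n B (e i) (e j) = (\<Sum>k<m. \<Sum>l<m. 2 * B $$ (k, l) * e i k * e j l)"
      by (rule bil_restrict[OF m]) (use e ij in \<open>auto simp: unitri_def\<close>)
    also have "\<dots> = 2 * (\<Sum>k<m. \<Sum>l<m. ?U $$ (k, i) * A $$ (k, l) * ?U $$ (l, j))"
      unfolding sum_distrib_left using ij A(2) by (intro sum.cong refl) (auto simp: basis_mat_def)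
    also have "\<dots> = 2 * G $$ (i, j)"
      unfolding G_def using gram_index[OF A(1) Uc ij] by simp
    finally show ?thesis by simp
  qed
  have GQ: "G $$ (i, i) = Q (e i)" if "i < m" for i
    using G[OF that that] by (simp add: Q_def field_simps)
  have N: "is_norm (Nrm e a m)" and mono: "\<And>i j. i \<le> j \<Longrightarrow> j < m \<Longrightarrow> a i \<le> a j"
    and pos: "\<And>i. i < m \<Longrightarrow> 0 \<le> a i"
    using cr unfolding crit_def by blast+
  define al where "al = map (\<lambda>i. nat (a i)) [0..<m]"
  have al: "length al = m" "\<And>i. i < m \<Longrightarrow> int (al ! i) = a i" using pos by (auto simp: al_def)
  have alS: "al \<in> GK_S ord m G"
    unfolding GK_S_def mem_Collect_eq
  proof (intro conjI allI impI)
    show "length al = m" by fact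
    show "sorted al"
      unfolding sorted_iff_nth_mono using al(1) mono by (auto simp: al_def intro!: nat_mono)
    show "ordge ord (G $$ (i, i)) (int (al ! i))" if "i < m" for i
      unfolding ordge_iff GQ[OF that] al(2)[OF that] by (rule norm_Q[OF N Nrm_basis[OF that]])
    show "2 * G $$ (i, j) = 0 \<or> int (al ! i) + int (al ! j) \<le> 2 * ord (2 * G $$ (i, j))"
      if "i < m" "j < m" for i j
      using norm_b[OF N Nrm_basis[OF that(1)] Nrm_basis[OF that(2)]]
      by (simp add: G[OF that] al(2) that hge_def)
  qed
  have "1\<^sub>m m \<in> GL_o ord m"
    by (auto simp: GL_o_def is_unit_o_def in_o_def ordge_iff hge_def)
  moreover have "transpose_mat (1\<^sub>m m) * G * 1\<^sub>m m = G" using Gc by simp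
  ultimately have alU: "al \<in> GK_union ord m G"
    unfolding GK_union_def using alS by (metis UN_I)
  have max: "lex_le g al" if gU: "g \<in> GK_union ord m G" for g
  proof (rule ccontr)
    assume nle: "\<not> lex_le g al"
    obtain V where V: "V \<in> GL_o ord m" and g: "g \<in> GK_S ord m (transpose_mat V * G * V)"
      using gU by (auto simp: GK_union_def)
    have V': "V \<in> carrier_mat m m" "\<And>i j. i < m \<Longrightarrow> j < m \<Longrightarrow> hge (V $$ (i, j)) 0"
      "det V \<noteq> 0" "ord (det V) = 0"
      using V by (auto simp: GL_o_def is_unit_o_def in_o_def ordge_iff)
    define u where "u j = (\<Sum>i<m. vscale (V $$ (i, j)) (e i))" for j
    have bu: "bil n B (u i) (u j) = 2 * (transpose_mat V * G * V) $$ (i, j)" if ij: "i < m" "j < m" for i j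
    proof -
      have "bil n B (u i) (u j) = (\<Sum>k<m. \<Sum>l<m. V $$ (k, i) * (V $$ (l, j) * bil n B (e k) (e l)))"
        unfolding u_def[of i] b_sum_left b_scale_left unfolding u_def[of j] b_sum_right b_scale_right
        by (simp add: sum_distrib_left)
      also have "\<dots> = 2 * (\<Sum>k<m. \<Sum>l<m. V $$ (k, i) * G $$ (k, l) * V $$ (l, j))"
        unfolding sum_distrib_left by (intro sum.cong refl) (auto simp flip: G)
      finally show ?thesis unfolding gram_index[OF Gc V'(1) ij] .
    qed
    have glen: "length g = m" and gs: "sorted g" using g by (auto simp: GK_S_def)
    obtain k where k: "k < m" "\<forall>i<k. g ! i = al ! i" "al ! k < g ! k"
      using not_lex_le[OF glen al(1) nle] by blast
    show False
    proof (rule GK_lex_maximal[OF cr _ V' u_def, where g = "\<lambda>i. int (g ! i)" and k = k])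
      show "\<forall>i<p. x i = y i" if "p \<le> m" "(\<Sum>i<p. vscale (x i) (e i)) = (\<Sum>i<p. vscale (y i) (e i))" for p x y
        by (rule unitri_independent[OF e that])
      show "hge (Q (u j)) (2 * int (g ! j))" if "j < m" for j
      proof -
        have "Q (u j) = (transpose_mat V * G * V) $$ (j, j)"
          using bu[OF that that] by (simp add: Q_def)
        then show ?thesis using g that by (simp add: GK_S_def ordge_iff)
      qed
      have le: "hge (bil n B (u i) (u j)) (int (g ! i) + int (g ! j))" if "i < m" "j < m" "i \<le> j" for i j
        using g that unfolding bu[OF that(1,2)] by (auto simp: GK_S_def hge_def)
      show "hge (bil n B (u i) (u j)) (int (g ! i) + int (g ! j))" if "i < m" "j < m" for i j
      proof (cases "i \<le> j")
        case True
        then show ?thesis using le that by blast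
      next
        case False
        then have "hge (bil n B (u j) (u i)) (int (g ! j) + int (g ! i))" using le that by simp
        then show ?thesis by (simp only: b_sym[of "u i"] add.commute)
      qed
      show "int (g ! i) \<le> int (g ! j)" if "i \<le> j" "j < m" for i j
        using gs glen that by (simp add: sorted_iff_nth_mono)
      show "k < m" by fact
      show "int (g ! i) = a i" if "i < k" for i using k that al(2)[of i] by simp
      show "a k < int (g ! k)" using k al(2)[of k] by simp
    qed
  qed
  show ?thesis
    unfolding optimal_basis_def optimal_def is_GK_def G_def[symmetric]
    using basis_mat_GL[OF e] alU alS max by blast
qed

end

section \<open>Block diagonal matrices\<close>

lemma det_two:
  fixes A :: "'a::comm_ring_1 mat"
  assumes A: "A \<in> carrier_mat 2 2"
  shows "det A = A $$ (0, 0) * A $$ (1, 1) - A $$ (0, 1) * A $$ (1, 0)"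
proof -
  have "mat_delete A i 0 \<in> carrier_mat 1 1" for i
    using mat_delete_carrier[OF A] by simp
  then have d: "det (mat_delete A i 0) = mat_delete A i 0 $$ (0, 0)" for i
    by (rule det_single)
  have "det A = (\<Sum>i<2. A $$ (i, 0) * cofactor A i 0)"
    by (rule laplace_expansion_column[OF A]) simp
  also have "\<dots> = A $$ (0, 0) * A $$ (1, 1) - A $$ (0, 1) * A $$ (1, 0)"
    using A by (simp add: numeral_2_eq_2 cofactor_def d) (simp add: mat_delete_def)
  finally show ?thesis .
qed

definition direct_sum :: "'a::zero mat \<Rightarrow> 'a mat \<Rightarrow> 'a mat" where
  "direct_sum X Y = four_block_mat X (0\<^sub>m (dim_row X) (dim_col Y)) (0\<^sub>m (dim_row Y) (dim_col X)) Y"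

text \<open>\<open>blockdiag\<close> recurses on the front block while the construction of the basis
  appends blocks at the end; associativity mediates.\<close>

lemma blockdiag_snoc: "blockdiag (As @ [A]) = direct_sum (blockdiag As) A"
proof (induction As)
  case Nil
  show ?case by (rule eq_matI) (auto simp: direct_sum_def Let_def)
next
  case (Cons X As)
  have "blockdiag ((X # As) @ [A]) = direct_sum X (blockdiag (As @ [A]))"
    by (simp add: direct_sum_def Let_def)
  also have "\<dots> = direct_sum (direct_sum X (blockdiag As)) A"
    unfolding Cons unfolding direct_sum_def by (rule assoc_four_block_mat)
  also have "direct_sum X (blockdiag As) = blockdiag (X # As)"
    by (simp add: direct_sum_def Let_def)
  finally show ?case .
qed

lemma direct_sum_carrier:
  "X \<in> carrier_mat p p \<Longrightarrow> Y \<in> carrier_mat q q \<Longrightarrow> direct_sum X Y \<in> carrier_mat (p + q) (p + q)"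
  by (auto simp: direct_sum_def)

lemma direct_sum_index:
  assumes "X \<in> carrier_mat p p" "Y \<in> carrier_mat q q" "i < p + q" "j < p + q"
  shows "direct_sum X Y $$ (i, j) = (if i < p \<and> j < p then X $$ (i, j)
    else if p \<le> i \<and> p \<le> j then Y $$ (i - p, j - p) else 0)"
  using assms by (auto simp: direct_sum_def)

lemma det_direct_sum:
  fixes X Y :: "'a::idom mat"
  assumes "X \<in> carrier_mat p p" "Y \<in> carrier_mat q q"
  shows "det (direct_sum X Y) = det X * det Y"
  unfolding direct_sum_def
  by (rule det_four_block_mat_lower_left_zero[of _ p _ q]) (use assms in auto)

section \<open>Induction along a pre-optimal form\<close>

locale pre_optimal_form = dyadic_field ord
  for ord :: "'a::field_char_0 \<Rightarrow> int" +
  fixes bs :: "(nat \<times> 'a mat) list"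
  assumes pre_optimal: "pre_optimal ord bs"
begin

abbreviation d :: "nat \<Rightarrow> nat" where "d \<equiv> degB bs"
abbreviation Bp :: "nat \<Rightarrow> 'a mat" where "Bp \<equiv> Bpart bs"
abbreviation r :: nat where "r \<equiv> length bs"
abbreviation dg :: "nat \<Rightarrow> bool" where "dg \<equiv> isdiag ord bs"
abbreviation \<kappa> :: "nat \<Rightarrow> int" where "\<kappa> i \<equiv> int (kk bs i)"
abbreviation w :: "nat \<Rightarrow> nat" where "w i \<equiv> dim_row (CC bs i)"

lemma block_cases:
  assumes "1 \<le> i" "i \<le> r"
  shows "unimod_diag ord (CC bs i) \<or> half_even_unimod ord (CC bs i)"
proof -
  have "bs ! (i - 1) \<in> set bs" using assms by simp
  then show ?thesis
    using pre_optimal unfolding pre_optimal_def block_form_def CC_def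
    by (auto split: prod.splits dest!: bspec simp: case_prod_beta)
qed

lemma block_carrier:
  assumes "1 \<le> i" "i \<le> r"
  shows "CC bs i \<in> carrier_mat (w i) (w i)" "1 \<le> w i"
  using block_cases[OF assms] by (auto simp: unimod_diag_def half_even_unimod_def)

lemma Bp_Suc:
  assumes "j < r"
  shows "Bp (Suc j) = direct_sum (Bp j) ((2 ^ kk bs (Suc j)) \<cdot>\<^sub>m CC bs (Suc j))"
  using assms
  by (simp add: Bpart_def take_Suc_conv_app_nth blockdiag_snoc kk_def CC_def case_prod_beta)

lemma scaled_block_carrier:
  "j < r \<Longrightarrow> (2 ^ kk bs (Suc j)) \<cdot>\<^sub>m CC bs (Suc j) \<in> carrier_mat (w (Suc j)) (w (Suc j))"
  by (rule smult_carrier_mat, rule block_carrier(1)) simp_all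

lemma d_0 [simp]: "d 0 = 0"
  by (simp add: degB_def Bpart_def)

lemma Bp_carrier_d_Suc:
  "Bp 0 \<in> carrier_mat (d 0) (d 0)"
  "j < r \<Longrightarrow> Bp j \<in> carrier_mat (d j) (d j) \<Longrightarrow>
    Bp (Suc j) \<in> carrier_mat (d (Suc j)) (d (Suc j)) \<and> d (Suc j) = d j + w (Suc j)"
proof -
  show "Bp 0 \<in> carrier_mat (d 0) (d 0)" by (simp add: Bpart_def)
  assume j: "j < r" and B: "Bp j \<in> carrier_mat (d j) (d j)"
  have *: "Bp (Suc j) \<in> carrier_mat (d j + w (Suc j)) (d j + w (Suc j))"
    unfolding Bp_Suc[OF j] by (rule direct_sum_carrier[OF B scaled_block_carrier[OF j]])
  have "d (Suc j) = d j + w (Suc j)"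
    unfolding degB_def[of bs "Suc j"] by (rule carrier_matD(1)[OF *])
  then show "Bp (Suc j) \<in> carrier_mat (d (Suc j)) (d (Suc j)) \<and> d (Suc j) = d j + w (Suc j)"
    using * by metis
qed

lemma Bp_carrier: "j \<le> r \<Longrightarrow> Bp j \<in> carrier_mat (d j) (d j)"
proof (induction j)
  case 0
  show ?case by (rule Bp_carrier_d_Suc(1))
next
  case (Suc j)
  show ?case
    by (rule conjunct1[OF Bp_carrier_d_Suc(2)[of j]]) (use Suc in simp_all)
qed

lemma d_Suc: "j < r \<Longrightarrow> d (Suc j) = d j + w (Suc j)"
  by (rule conjunct2[OF Bp_carrier_d_Suc(2)[OF _ Bp_carrier]]) simp_all

lemma Bp_Suc_index:
  assumes "j < r" "i < d (Suc j)" "l < d (Suc j)"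
  shows "Bp (Suc j) $$ (i, l) = (if i < d j \<and> l < d j then Bp j $$ (i, l)
    else if d j \<le> i \<and> d j \<le> l then 2 ^ kk bs (Suc j) * CC bs (Suc j) $$ (i - d j, l - d j) else 0)"
proof -
  have B: "Bp j \<in> carrier_mat (d j) (d j)" using Bp_carrier assms(1) by simp
  have C: "CC bs (Suc j) \<in> carrier_mat (w (Suc j)) (w (Suc j))"
    by (rule block_carrier(1)) (use assms(1) in simp_all)
  have idx: "((2 ^ kk bs (Suc j)) \<cdot>\<^sub>m CC bs (Suc j)) $$ (p, q) = 2 ^ kk bs (Suc j) * CC bs (Suc j) $$ (p, q)"
    if "p < w (Suc j)" "q < w (Suc j)" for p q
    using that carrier_matD(2)[OF C] by (intro index_smult_mat(1)) simp_all
  show ?thesis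
    unfolding Bp_Suc[OF assms(1)]
    using assms(2,3) unfolding d_Suc[OF assms(1)]
    by (subst direct_sum_index[OF B scaled_block_carrier[OF assms(1)]]) (auto simp: idx)
qed

lemma det_Bp_Suc:
  assumes "j < r"
  shows "det (Bp (Suc j)) = det (Bp j) * det ((2 ^ kk bs (Suc j)) \<cdot>\<^sub>m CC bs (Suc j))"
  unfolding Bp_Suc[OF assms]
  by (rule det_direct_sum[OF Bp_carrier scaled_block_carrier[OF assms]]) (use assms in simp)

lemma d_mono: "i \<le> j \<Longrightarrow> j \<le> r \<Longrightarrow> d i \<le> d j"
  by (induction j) (auto simp: le_Suc_eq d_Suc)

lemma Bp_agree: "i \<le> j \<Longrightarrow> j \<le> r \<Longrightarrow> p < d i \<Longrightarrow> q < d i \<Longrightarrow> Bp j $$ (p, q) = Bp i $$ (p, q)"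
proof (induction j)
  case (Suc j)
  show ?case
  proof (cases "i = Suc j")
    case False
    then have "i \<le> j" using Suc.prems by simp
    then have "p < d j" "q < d j" using d_mono[of i j] Suc.prems by auto
    then show ?thesis
      using Suc \<open>i \<le> j\<close> Bp_Suc_index[of j p q] by (simp add: d_Suc)
  qed simp
qed simp

lemma Bp_symmetric: "j \<le> r \<Longrightarrow> p < d j \<Longrightarrow> q < d j \<Longrightarrow> Bp j $$ (p, q) = Bp j $$ (q, p)"
proof (induction j)
  case (Suc j)
  have "CC bs (Suc j) $$ (i, l) = CC bs (Suc j) $$ (l, i)" if il: "i < w (Suc j)" "l < w (Suc j)" for i l
  proof -
    consider "unimod_diag ord (CC bs (Suc j))" | "half_even_unimod ord (CC bs (Suc j))"
      using block_cases[of "Suc j"] Suc.prems by auto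
    then show ?thesis
    proof cases
      case 1
      then show ?thesis using il by (cases "i = l") (auto simp: unimod_diag_def)
    next
      case 2
      then have c: "CC bs (Suc j) \<in> carrier_mat 2 2" and t: "transpose_mat (2 \<cdot>\<^sub>m CC bs (Suc j)) = 2 \<cdot>\<^sub>m CC bs (Suc j)"
        by (auto simp: half_even_unimod_def Let_def)
      have "(2 \<cdot>\<^sub>m CC bs (Suc j)) $$ (i, l) = (2 \<cdot>\<^sub>m CC bs (Suc j)) $$ (l, i)"
        using arg_cong[OF t, of "\<lambda>M. M $$ (l, i)"] c il by simp
      then show ?thesis using c il by simp
    qed
  qed
  then show ?case
    using Suc Bp_Suc_index[of j p q] Bp_Suc_index[of j q p] d_Suc[of j] by auto
qed simp

sublocale dyadic_lattice ord "d r" "Bp r"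
  by unfold_locales (rule Bp_symmetric, auto)

lemma B_block:
  assumes "j < r" "i < d (Suc j)" "l < d (Suc j)"
  shows "Bp r $$ (i, l) = (if i < d j \<and> l < d j then Bp j $$ (i, l)
    else if d j \<le> i \<and> d j \<le> l then 2 ^ kk bs (Suc j) * CC bs (Suc j) $$ (i - d j, l - d j) else 0)"
  using Bp_agree[of "Suc j" r i l] Bp_Suc_index[OF assms] assms by simp

lemma orth_psi:
  assumes "unitri e m" "l < d r" "\<And>i. i < m \<Longrightarrow> Bp r $$ (i, l) = 0"
  shows "orth (Nrm e a m) (psi l)"
  unfolding orth_def
proof (intro allI impI)
  fix x c assume x: "Nrm e a m x c"
  have "2 * Bp r $$ (i, l) * x i = 0" for i
    using assms(3)[of i] Nrm_support[OF assms(1) x, of i] by (cases "i < m") auto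
  then show "bil (d r) (Bp r) x (psi l) = 0"
    unfolding bil_psi_right[OF assms(2)] by (intro sum.neutral) blast
qed

definition D :: "nat \<Rightarrow> 'a" where "D j = D_inv (d j) (Bp j)"

lemma D_0: "D 0 = 1"
  using Bp_carrier[of 0] by (simp add: D_def D_inv_def)

lemma D_ord: "D j \<noteq> 0 \<Longrightarrow> even (ord (D j)) \<longleftrightarrow> even (orddetB ord bs j)"
proof -
  assume "D j \<noteq> 0"
  then have "ord (D j) = int (d j div 2) * 2 + orddetB ord bs j"
    by (simp add: D_def D_inv_def orddetB_def ord_mult ord_power)
  then show ?thesis by simp
qed

lemma xi_st0: "st0 N (D j) \<Longrightarrow> xiB ord bs j \<noteq> 0"
  unfolding xiB_def D_def st0_def by (auto dest: xi_unramified)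

lemma xi_ram: "ramified_class (D j) \<Longrightarrow> xiB ord bs j = 0"
  unfolding xiB_def D_def by (rule xi_ramified)

text \<open>Exactly here \<open>PO1\<close> leaves room for one more diagonal entry of the same
  order, so the possibility of lowering a weight must be kept open.\<close>

definition first_diag :: "nat \<Rightarrow> bool" where
  "first_diag j \<longleftrightarrow> w j = 1 \<and> (\<forall>i. 1 \<le> i \<longrightarrow> i < j \<longrightarrow> dg i \<longrightarrow> kk bs i \<noteq> kk bs j)"

text \<open>\<open>D0\<close> is tied to the preceding discriminant only for blocks of degree 1.
  \<open>PO5\<close>, where this information is used, speaks only of such blocks; in a block of
  degree 2 the vector before the last one belongs to the same block.\<close>

definition invariant :: "nat \<Rightarrow> (nat \<Rightarrow> nat \<Rightarrow> 'a) \<Rightarrow> (nat \<Rightarrow> int) \<Rightarrow> bool" where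
  "invariant j e a \<longleftrightarrow> unitri e (d j) \<and> crit e a (d j) \<and> stt (d j) (Nrm e a (d j)) (D j) \<and>
     (1 \<le> j \<longrightarrow> (if dg j
       then \<exists>m first D0. d j = Suc m \<and> tail first e a m (D j) (\<kappa> j) D0 \<and>
         (first_diag j \<longrightarrow> first) \<and> (w j = 1 \<longrightarrow> D0 = D (j - 1))
       else \<forall>i<d j. a i \<le> \<kappa> j))"

lemma invariant_0: "invariant 0 e a"
  using Nrm_0_stt[of e a] stt_regular[OF Nrm_0_stt, of e a]
  by (auto simp: invariant_def unitri_def crit_def D_0 simp del: Nrm.simps)

lemma PO2_cases:
  assumes "1 \<le> i" "i < j" "j \<le> r"
  shows "dg i \<Longrightarrow> dg j \<Longrightarrow> \<kappa> i \<le> \<kappa> j" "\<not> dg i \<Longrightarrow> \<not> dg j \<Longrightarrow> \<kappa> i \<le> \<kappa> j"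
    "dg i \<Longrightarrow> \<not> dg j \<Longrightarrow> \<kappa> i \<le> \<kappa> j - 1" "\<not> dg i \<Longrightarrow> dg j \<Longrightarrow> \<kappa> i \<le> \<kappa> j + 1"
proof -
  have P: "PO2 ord bs" using pre_optimal by (simp add: pre_optimal_def)
  note P = P[unfolded PO2_def, rule_format, OF assms(2), of "kk bs i" "kk bs j"]
  have mem: "i \<in> Dset ord bs (kk bs i) \<longleftrightarrow> dg i" "i \<in> Eset ord bs (kk bs i) \<longleftrightarrow> \<not> dg i"
    "j \<in> Dset ord bs (kk bs j) \<longleftrightarrow> dg j" "j \<in> Eset ord bs (kk bs j) \<longleftrightarrow> \<not> dg j"
    using assms by (auto simp: Dset_def Eset_def)
  show "dg i \<Longrightarrow> dg j \<Longrightarrow> \<kappa> i \<le> \<kappa> j" "\<not> dg i \<Longrightarrow> \<not> dg j \<Longrightarrow> \<kappa> i \<le> \<kappa> j"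
    "dg i \<Longrightarrow> \<not> dg j \<Longrightarrow> \<kappa> i \<le> \<kappa> j - 1" "\<not> dg i \<Longrightarrow> dg j \<Longrightarrow> \<kappa> i \<le> \<kappa> j + 1"
    using P unfolding mem by auto
qed

lemma diag_dims:
  assumes "X \<subseteq> {i. 1 \<le> i \<and> i \<le> r \<and> dg i \<and> kk bs i = m}"
  shows "sum w X \<le> 2"
proof -
  have "finite (Dset ord bs m)"
    by (rule finite_subset[of _ "{..r}"]) (auto simp: Dset_def)
  then have "sum w X \<le> sum w (Dset ord bs m)"
    using assms by (intro sum_mono2) (auto simp: Dset_def)
  also have "\<dots> \<le> 2" using pre_optimal by (simp add: pre_optimal_def PO1_def)
  finally show ?thesis .
qed

text \<open>\<open>PO1\<close> bounds the total degree of diagonal blocks of one order by 2, and two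
  such blocks exhaust it.\<close>

lemma adjacent_equal:
  assumes "1 \<le> j" "j < r" "dg j" "dg (Suc j)" "kk bs j = kk bs (Suc j)"
  shows "first_diag j" "w (Suc j) = 1"
proof -
  have "sum w {j, Suc j} \<le> 2" by (rule diag_dims[of _ "kk bs j"]) (use assms in auto)
  then have ws: "w j = 1" "w (Suc j) = 1"
    using block_carrier(2)[of j] block_carrier(2)[of "Suc j"] assms by auto
  show "w (Suc j) = 1" by fact
  have "kk bs i \<noteq> kk bs j" if i: "1 \<le> i" "i < j" "dg i" for i
  proof
    assume "kk bs i = kk bs j"
    then have "sum w {i, j, Suc j} \<le> 2"
      by (intro diag_dims[of _ "kk bs j"]) (use assms i in auto)
    moreover have "sum w {i, j, Suc j} = w i + w j + w (Suc j)" using i by simp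
    ultimately show False using ws block_carrier(2)[of i] i assms by simp
  qed
  then show "first_diag j" using ws by (auto simp: first_diag_def)
qed

text \<open>An even block takes its own order as weight, so no earlier weight may exceed it. The
  only danger is a diagonal block of order one less whose last vector reached its order plus 2, and
  \<open>PO5\<close> excludes this: without lines the determinant would have even order, and with
  one line of the wrong parity the preceding form would have \<xi> = 0.\<close>

lemma even_block_bound:
  assumes j: "j < r" and I: "invariant j e a" and nd: "\<not> dg (Suc j)" and i: "i < d j"
  shows "a i \<le> \<kappa> (Suc j)"
proof (cases "1 \<le> j")
  case False
  then have "j = 0" by simp
  then show ?thesis using i by simp
next
  case j1: True
  show ?thesis
  proof (cases "dg j")
    case False
    then have "a i \<le> \<kappa> j" using I i j1 by (auto simp: invariant_def)
    then show ?thesis using PO2_cases(2)[of j "Suc j"] False nd j j1 by simp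
  next
    case True
    obtain m first D0 where m: "d j = Suc m" and tl: "tail first e a m (D j) (\<kappa> j) D0"
      and D0: "w j = 1 \<longrightarrow> D0 = D (j - 1)"
      using I True j1 by (auto simp: invariant_def)
    have k: "\<kappa> j \<le> \<kappa> (Suc j) - 1" using PO2_cases(3)[of j "Suc j"] True nd j j1 by simp
    show ?thesis
    proof (rule ccontr)
      assume neg: "\<not> a i \<le> \<kappa> (Suc j)"
      then have n1: "\<not> (\<forall>i<Suc m. a i \<le> \<kappa> j + 1)" using i m k by fastforce
      have tl': "(\<forall>i<Suc m. a i \<le> \<kappa> j + 2) \<and> (odd m \<and> st0 (Nrm e a (Suc m)) (D j) \<or>
          even m \<and> ramified_class D0)"
        using tl n1 unfolding tail_def by blast
      have ki: "\<kappa> j = \<kappa> (Suc j) - 1"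
        using tl' neg i m k by fastforce
      have "PO5 ord bs" using pre_optimal by (simp add: pre_optimal_def)
      then have PO5: "w j = 1" "even (d j) \<and> odd (orddetB ord bs j) \<or>
          odd (d j) \<and> (j \<ge> 2 \<longrightarrow> xiB ord bs (j - 1) \<noteq> 0)"
        using ki True nd j j1 unfolding PO5_def by (auto dest!: spec[of _ j])
      from tl' consider "odd m" "st0 (Nrm e a (Suc m)) (D j)" | "even m" "ramified_class D0" by blast
      then show False
      proof cases
        case 1
        have "D j \<in> unramified_class" using 1 by (simp add: st0_def)
        then have "even (orddetB ord bs j)"
          using D_ord[of j] unramified_class_ord by blast
        then show False using PO5(2) m 1 by simp
      next
        case 2
        have R: "ramified_class (D (j - 1))" using 2 D0 PO5(1) by simp
        \<comment> \<open>The empty form has discriminant 1, a square, which is not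
          ramified.\<close>
        have "j \<ge> 2"
        proof (rule ccontr)
          assume "\<not> j \<ge> 2"
          then have "j - 1 = 0" by simp
          then have "ramified_class 1" using R D_0 by simp
          moreover have "is_square (1 :: 'a)" unfolding is_square_def by (intro exI[of _ 1]) simp
          ultimately show False by (simp add: ramified_class_def)
        qed
        then show False using PO5(2) m 2 xi_ram[OF R] by simp
      qed
    qed
  qed
qed

lemma rad_of_xi:
  assumes "stt m N (D j)" "even m" "xiB ord bs j = 0"
  shows "rad m N (D j) k"
  using assms xi_st0 by (auto simp: stt_def rad_def)

lemma rad_of_ord:
  assumes "stt m N (D j)" "odd m" "even (orddetB ord bs j + k)"
  shows "rad m N (D j) k"
proof -
  obtain \<mu> where l: "st1 N (D j) \<mu>" using assms by (auto simp: stt_def)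
  have "even (\<mu> + k)" using st1_ord[OF l] D_ord[of j] assms(3) by auto
  then show ?thesis using l assms(2) by (auto simp: rad_def)
qed

lemma diag_entry:
  assumes "j < r" "dg (Suc j)" "i < w (Suc j)"
  shows "Q (psi (d j + i)) \<noteq> 0" "ord (Q (psi (d j + i))) = \<kappa> (Suc j)"
    "Bp r $$ (d j + i, d j + i) = 2 ^ kk bs (Suc j) * CC bs (Suc j) $$ (i, i)"
proof -
  have u: "is_unit_o ord (CC bs (Suc j) $$ (i, i))"
    using assms unfolding isdiag_def unimod_diag_def by auto
  show e: "Bp r $$ (d j + i, d j + i) = 2 ^ kk bs (Suc j) * CC bs (Suc j) $$ (i, i)"
    using B_block[OF assms(1), of "d j + i" "d j + i"] d_Suc[OF assms(1)] assms(3) by simp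
  have "d j + i < d r" using d_mono[of "Suc j" r] assms d_Suc[OF assms(1)] by simp
  then have "Q (psi (d j + i)) = 2 ^ kk bs (Suc j) * CC bs (Suc j) $$ (i, i)"
    using Q_psi e by simp
  then show "Q (psi (d j + i)) \<noteq> 0" "ord (Q (psi (d j + i))) = \<kappa> (Suc j)"
    using u by (auto simp: is_unit_o_def ord_mult ord_power)
qed

lemma det_diag_block:
  assumes "j < r" "dg (Suc j)"
  shows "det ((2 ^ kk bs (Suc j)) \<cdot>\<^sub>m CC bs (Suc j)) = (\<Prod>i<w (Suc j). Q (psi (d j + i)))"
proof -
  let ?M = "(2 ^ kk bs (Suc j)) \<cdot>\<^sub>m CC bs (Suc j)"
  have c: "?M \<in> carrier_mat (w (Suc j)) (w (Suc j))" by (rule scaled_block_carrier[OF assms(1)])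
  have "upper_triangular ?M"
    using assms c unfolding isdiag_def unimod_diag_def by auto
  then have "det ?M = prod_list (diag_mat ?M)" by (rule det_upper_triangular[OF _ c])
  also have "\<dots> = (\<Prod>i<w (Suc j). ?M $$ (i, i))"
    using c by (simp add: prod_list_diag_prod lessThan_atLeast0)
  also have "\<dots> = (\<Prod>i<w (Suc j). Q (psi (d j + i)))"
  proof (intro prod.cong refl)
    fix i assume i: "i \<in> {..<w (Suc j)}"
    then have "d j + i < d r" using d_mono[of "Suc j" r] assms d_Suc[OF assms(1)] by simp
    then show "?M $$ (i, i) = Q (psi (d j + i))"
      using diag_entry(3)[OF assms, of i] i carrier_matD[OF c] by (simp add: Q_psi)
  qed
  finally show ?thesis .
qed

lemma disc_step_D: "disc_step m ((- 4) ^ (m div 2) * x) q = (- 4) ^ (Suc m div 2) * (x * q)"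
  by (auto simp: disc_step_def elim!: evenE oddE)

lemma D_Suc_1:
  assumes "j < r" "dg (Suc j)" "w (Suc j) = 1"
  shows "D (Suc j) = disc_step (d j) (D j) (Q (psi (d j)))"
  using assms det_diag_block[OF assms(1,2)]
  by (simp add: D_def D_inv_def disc_step_D det_Bp_Suc d_Suc)

lemma D_Suc_2:
  assumes "j < r" "dg (Suc j)" "w (Suc j) = 2"
  shows "D (Suc j) = disc_step (Suc (d j)) (disc_step (d j) (D j) (Q (psi (d j)))) (Q (psi (Suc (d j))))"
proof -
  have "det ((2 ^ kk bs (Suc j)) \<cdot>\<^sub>m CC bs (Suc j)) = Q (psi (d j)) * Q (psi (Suc (d j)))"
    unfolding det_diag_block[OF assms(1,2)] assms(3) by (simp add: numeral_2_eq_2)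
  then show ?thesis
    unfolding D_def D_inv_def det_Bp_Suc[OF assms(1)] d_Suc[OF assms(1)] assms(3) disc_step_D
    by (simp only: mult.assoc add_2_eq_Suc')
qed

lemma orddet_Suc_1:
  assumes "j < r" "dg (Suc j)" "w (Suc j) = 1" "D j \<noteq> 0"
  shows "orddetB ord bs (Suc j) = orddetB ord bs j + \<kappa> (Suc j)"
  using assms det_diag_block[OF assms(1,2)] diag_entry(1,2)[OF assms(1,2), of 0]
  by (simp add: orddetB_def det_Bp_Suc ord_mult D_def D_inv_def)

lemma stt_nonzero:
  assumes "stt m N E"
  shows "E \<noteq> 0"
proof -
  consider "st0 N E" | \<beta> where "st2 \<beta> N E" | \<mu> where "st1 N E \<mu>"
    using assms unfolding stt_def by (metis (full_types))
  then show ?thesis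
  proof cases
    case 1
    then show ?thesis using unramified_class_ord(1) by (simp add: st0_def)
  next
    case 2
    then show ?thesis using st2_ramified[OF 2] by (simp add: ramified_class_def)
  next
    case 3
    then show ?thesis by (rule st1_ord(1))
  qed
qed

text \<open>There are two sources of weights above \<open>k\<close>. An even block of order
  \<open>k + 1\<close> just before: \<open>PO3\<close> and \<open>PO4\<close> then ensure a line
  with the parity of \<open>k\<close>. Or a diagonal vector of order \<open>k - 1\<close> with
  weight \<open>k + 1\<close>: \<open>PO6\<close> excludes that no line is left, and the surviving
  line, of the wrong parity for \<open>k - 1\<close>, has the right one for
  \<open>k\<close>.\<close>

lemma diagonal_block_bound:
  assumes j: "j < r" and I: "invariant j e a" and dj: "dg (Suc j)"
    and ne: "\<not> (1 \<le> j \<and> dg j \<and> kk bs j = kk bs (Suc j))"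
  defines "k \<equiv> \<kappa> (Suc j)"
  shows "(\<forall>i<d j. a i \<le> k) \<or> (\<forall>i<d j. a i \<le> k + 1) \<and> rad (d j) (Nrm e a (d j)) (D j) k"
proof (cases "1 \<le> j")
  case False
  then have "j = 0" by simp
  then show ?thesis by simp
next
  case j1: True
  have st: "stt (d j) (Nrm e a (d j)) (D j)" using I by (simp add: invariant_def)
  have PO: "PO3 ord bs" "PO4 ord bs" "PO6 ord bs" using pre_optimal by (simp_all add: pre_optimal_def)
  show ?thesis
  proof (cases "dg j")
    case False
    then have aj: "\<forall>i<d j. a i \<le> \<kappa> j" using I j1 by (auto simp: invariant_def)
    have le: "\<kappa> j \<le> k + 1" using PO2_cases(4)[of j "Suc j"] False dj j j1 by (simp add: k_def)
    show ?thesis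
    proof (cases "\<kappa> j = k + 1")
      case False
      then show ?thesis using aj le by fastforce
    next
      case True
      have "w (Suc j) = 2 \<or> w (Suc j) = 1 \<and> (even (d (Suc j)) \<and> even (orddetB ord bs (Suc j)) \<or>
          odd (d (Suc j)) \<and> xiB ord bs j = 0)"
        using PO(2) True False dj j j1 unfolding PO4_def k_def by (auto dest!: spec[of _ "Suc j"])
      then have "rad (d j) (Nrm e a (d j)) (D j) k"
      proof
        assume w2: "w (Suc j) = 2"
        then have "even (d (Suc j)) \<and> xiB ord bs j = 0 \<or> odd (d j) \<and> even (orddetB ord bs j + k)"
          using PO(1) dj j j1 unfolding PO3_def k_def by (auto dest!: spec[of _ "Suc j"])
        then show ?thesis
          using rad_of_xi[OF st] rad_of_ord[OF st] w2 d_Suc[OF j] by auto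
      next
        assume w1: "w (Suc j) = 1 \<and> (even (d (Suc j)) \<and> even (orddetB ord bs (Suc j)) \<or>
          odd (d (Suc j)) \<and> xiB ord bs j = 0)"
        then show ?thesis
          using rad_of_xi[OF st] rad_of_ord[OF st] d_Suc[OF j] orddet_Suc_1[OF j dj _ stt_nonzero[OF st]]
          by (auto simp: k_def)
      qed
      then show ?thesis using aj True by auto
    qed
  next
    case True
    obtain m first D0 where m: "d j = Suc m" and tl: "tail first e a m (D j) (\<kappa> j) D0"
      using I True j1 by (auto simp: invariant_def)
    have k: "\<kappa> j \<le> k - 1"
      using PO2_cases(1)[of j "Suc j"] True dj j j1 ne by (simp add: k_def)
    show ?thesis
    proof (cases "\<forall>i<d j. a i \<le> k")
      case n1: False
      then have n2: "\<not> (\<forall>i<Suc m. a i \<le> \<kappa> j + 1)" using m k by fastforce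
      have tl': "(\<forall>i<Suc m. a i \<le> \<kappa> j + 2) \<and> (odd m \<and> st0 (Nrm e a (Suc m)) (D j) \<or>
          even m \<and> (\<exists>\<mu>. odd (\<mu> + \<kappa> j) \<and> st1 (Nrm e a (Suc m)) (D j) \<mu>))"
        using tl n2 unfolding tail_def by blast
      have ki: "\<kappa> j = k - 1" using tl' n1 m k by fastforce
      have "even m \<and> (\<exists>\<mu>. odd (\<mu> + \<kappa> j) \<and> st1 (Nrm e a (Suc m)) (D j) \<mu>)"
      proof (rule ccontr)
        assume "\<not> ?thesis"
        then have s: "odd m" "st0 (Nrm e a (Suc m)) (D j)" using tl' by auto
        have "xiB ord bs j = 0"
          using PO(3) s m ki True dj j j1 unfolding PO6_def k_def by (auto dest!: spec[of _ j])
        then show False using xi_st0[OF s(2)] by simp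
      qed
      then obtain \<mu> where "even m" "odd (\<mu> + \<kappa> j)" "st1 (Nrm e a (Suc m)) (D j) \<mu>" by blast
      then have "rad (d j) (Nrm e a (d j)) (D j) k"
        unfolding rad_def m ki by (auto intro!: exI[of _ \<mu>])
      moreover have "a i \<le> k + 1" if "i < d j" for i
        using conjunct1[OF tl'] ki m that by force
      ultimately show ?thesis by blast
    qed simp
  qed
qed

text \<open>The vectors chosen before are kept and only weights may change; this is what makes the
  optimal bases of successive forms nested.\<close>

lemma invariant_step:
  assumes j: "j < r" and I: "invariant j e a"
  shows "\<exists>e' a'. invariant (Suc j) e' a' \<and> (\<forall>i<d j. e' i = e i)"
proof -
  let ?m = "d j"
  let ?k = "\<kappa> (Suc j)"
  have tri: "unitri e ?m" and cr: "crit e a ?m" and st: "stt ?m (Nrm e a ?m) (D j)"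
    using I by (auto simp: invariant_def)
  have dr: "d (Suc j) \<le> d r" using d_mono[of "Suc j" r] j by simp
  have off: "Bp r $$ (i, ?m + l) = 0" if "i < ?m" "l < w (Suc j)" for i l
    using B_block[OF j, of i "?m + l"] that d_Suc[OF j] by simp
  show ?thesis
  proof (cases "dg (Suc j)")
    case nd: False
    let ?C = "CC bs (Suc j)"
    have he: "half_even_unimod ord ?C"
      using nd block_cases[of "Suc j"] j by (auto simp: isdiag_def)
    then have C: "?C \<in> carrier_mat 2 2" and S: "\<And>i. i < 2 \<Longrightarrow> hge (2 * ?C $$ (i, i)) 2"
      "is_unit_o ord (det (2 \<cdot>\<^sub>m ?C))" "\<And>i l. i < 2 \<Longrightarrow> l < 2 \<Longrightarrow> hge (2 * ?C $$ (i, l)) 0"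
      by (auto simp: half_even_unimod_def Let_def ordge_iff in_o_def)
    have w2: "w (Suc j) = 2" using C by simp
    have d2: "d (Suc j) = Suc (Suc ?m)" using d_Suc[OF j] w2 by simp
    have lt: "?m < d r" "Suc ?m < d r" using dr d2 by auto
    let ?f = "psi ?m :: nat \<Rightarrow> 'a" and ?g = "psi (Suc ?m) :: nat \<Rightarrow> 'a"
    have Be: "Bp r $$ (?m + i, ?m + l) = 2 ^ kk bs (Suc j) * ?C $$ (i, l)" if "i < 2" "l < 2" for i l
      using B_block[OF j, of "?m + i" "?m + l"] that d2 by simp
    have Bs: "Bp r $$ (Suc ?m, ?m) = Bp r $$ (?m, Suc ?m)"
      using Bp_symmetric[of r] lt by simp
    have s01: "?C $$ (1, 0) = ?C $$ (0, 1)"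
      using Be[of 1 0] Be[of 0 1] Bs by simp
    have Qf: "Q ?f = 2 ^ kk bs (Suc j) * ?C $$ (0, 0)" and Qg: "Q ?g = 2 ^ kk bs (Suc j) * ?C $$ (1, 1)"
      and bfg: "bil (d r) (Bp r) ?f ?g = 2 ^ kk bs (Suc j) * (2 * ?C $$ (0, 1))"
      using Be[of 0 0] Be[of 1 1] Be[of 0 1] lt by (auto simp: Q_psi bil_psi_psi)
    have p2: "hge (2 ^ kk bs (Suc j) :: 'a) (2 * ?k)" by (simp add: hge_def ord_power)
    have int: "hge (?C $$ (i, i)) 0" if "i < 2" for i
      using S(1)[OF that] by (simp add: hge_mult_cancel)
    \<comment> \<open>The diagonal entries of \<open>2 \<cdot>\<^sub>m ?C\<close> have positive
      order, so a unit determinant forces a unit off the diagonal.\<close>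
    have unit: "2 * ?C $$ (0, 1) \<noteq> 0 \<and> ord (2 * ?C $$ (0, 1)) = 0"
    proof (rule ccontr)
      assume "\<not> ?thesis"
      then have "hge (2 * ?C $$ (0, 1)) 1" using S(3)[of 0 1] by (auto simp: hge_def)
      then have "hge ((2 * ?C $$ (0, 1)) * (2 * ?C $$ (0, 1))) 1"
        by (rule hge_mult_le[OF _ S(3)]) auto
      moreover have "hge ((2 * ?C $$ (0, 0)) * (2 * ?C $$ (1, 1))) 1"
        by (rule hge_mult_le[OF S(1) S(1)]) auto
      ultimately have "hge ((2 * ?C $$ (0, 0)) * (2 * ?C $$ (1, 1)) - (2 * ?C $$ (0, 1)) * (2 * ?C $$ (0, 1))) 1"
        by (rule_tac hge_diff)
      moreover have "det (2 \<cdot>\<^sub>m ?C) = (2 * ?C $$ (0, 0)) * (2 * ?C $$ (1, 1)) - (2 * ?C $$ (0, 1)) * (2 * ?C $$ (0, 1))"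
        using C s01 by (subst det_two) auto
      ultimately show False using S(2) by (auto simp: is_unit_o_def hge_def)
    qed
    have fg: "orth (Nrm e a ?m) ?f" "orth (Nrm e a ?m) ?g" "hge (Q ?f) (2 * ?k)" "hge (Q ?g) (2 * ?k)"
      "bil (d r) (Bp r) ?f ?g \<noteq> 0" "ord (bil (d r) (Bp r) ?f ?g) = ?k"
    proof -
      show "orth (Nrm e a ?m) ?f" by (rule orth_psi[OF tri lt(1)]) (use off[of _ 0] w2 in simp)
      show "orth (Nrm e a ?m) ?g" by (rule orth_psi[OF tri lt(2)]) (use off[of _ 1] w2 in simp)
      show "hge (Q ?f) (2 * ?k)" unfolding Qf by (rule hge_mult_le[OF p2 int]) auto
      show "hge (Q ?g) (2 * ?k)" unfolding Qg by (rule hge_mult_le[OF p2 int]) auto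
      show "bil (d r) (Bp r) ?f ?g \<noteq> 0" unfolding bfg using unit by simp
      show "ord (bil (d r) (Bp r) ?f ?g) = ?k"
        unfolding bfg using unit by (subst ord_mult) (auto simp: ord_power)
    qed
    let ?e = "e(?m := ?f, Suc ?m := ?g)" and ?a = "a(?m := ?k, Suc ?m := ?k)"
    note step = even_block_step[OF cr st even_block_bound[OF j I nd] _ fg]
    \<comment> \<open>Two more dimensions contribute one factor -4, which is absorbed because
      \<open>gram\<close> is 4 times the determinant of the block.\<close>
    have DS: "D (Suc j) = D j * (- gram ?f ?g)"
    proof -
      define \<Delta> where "\<Delta> = det ((2 ^ kk bs (Suc j)) \<cdot>\<^sub>m ?C)"
      have \<Delta>: "\<Delta> = Q ?f * Q ?g -
          (2 ^ kk bs (Suc j) * ?C $$ (0, 1)) * (2 ^ kk bs (Suc j) * ?C $$ (0, 1))"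
        unfolding \<Delta>_def using C s01 by (subst det_two) (auto simp: Qf Qg)
      have "- gram ?f ?g = - 4 * \<Delta>"
        unfolding gram_def bfg \<Delta> by (simp add: algebra_simps)
      moreover have "D (Suc j) = D j * (- 4 * \<Delta>)"
        unfolding D_def D_inv_def det_Bp_Suc[OF j] d2 \<Delta>_def[symmetric] by simp
      ultimately show ?thesis by simp
    qed
    have "unitri (e(?m := psi ?m + 0)) (Suc ?m)"
      by (rule unitri_extend[OF tri, of "\<lambda>_. 0"]) (auto simp: fun_eq_iff comb_apply)
    then have t1: "unitri (e(?m := ?f)) (Suc ?m)" by simp
    have "unitri ((e(?m := ?f))(Suc ?m := psi (Suc ?m) + 0)) (Suc (Suc ?m))"
      by (rule unitri_extend[OF t1, of "\<lambda>_. 0"]) (auto simp: fun_eq_iff comb_apply)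
    then have "unitri ?e (d (Suc j))" using d2 by simp
    then have "invariant (Suc j) ?e ?a"
      unfolding invariant_def using nd step d2 DS by simp
    moreover have "\<forall>i<?m. ?e i = e i" by simp
    ultimately show ?thesis by blast
  next
    case dj: True
    have w12: "w (Suc j) = 1 \<or> w (Suc j) = 2"
      using block_carrier(2)[of "Suc j"] diag_dims[of "{Suc j}" "kk bs (Suc j)"] j dj by auto
    have lt: "?m < d r" using dr d_Suc[OF j] w12 by auto
    have z: "orth (Nrm e a ?m) (psi ?m)" "Q (psi ?m) \<noteq> 0" "ord (Q (psi ?m)) = ?k" "0 \<le> ?k"
      using orth_psi[OF tri lt] off[of _ 0] diag_entry[OF j dj, of 0] w12 by auto
    show ?thesis
    \<comment> \<open>If the previous block is diagonal of the same order, its last vector may have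
      the weight \<open>k + 2\<close>, and the new vector must be added as a second one.\<close>
    proof (cases "1 \<le> j \<and> dg j \<and> kk bs j = kk bs (Suc j)")
      case same: True
      note adj = adjacent_equal[OF _ j, OF _ _ dj]
      have fj: "first_diag j" and w1: "w (Suc j) = 1" using adj same by auto
      obtain m D0 where m: "?m = Suc m" and tl: "tail True e a m (D j) (\<kappa> j) D0"
        using I same fj by (auto simp: invariant_def)
      obtain y a' t where y: "y = (\<Sum>i<Suc m. vscale (t i) (e i))" "\<forall>i<Suc m. hge (t i) 0"
        and tl': "tail False (e(Suc m := psi ?m + y)) a' (Suc m)
          (disc_step (Suc m) (D j) (Q (psi ?m))) (\<kappa> j) (D j)"
        using diagonal_step_second[OF tl, of "psi ?m"] z same m by auto
      let ?e = "e(?m := psi ?m + y)"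
      have DS: "D (Suc j) = disc_step (Suc m) (D j) (Q (psi ?m))"
        using D_Suc_1[OF j dj w1] m by simp
      have d1: "d (Suc j) = Suc ?m" using d_Suc[OF j] w1 by simp
      have tl'': "tail False ?e a' ?m (D (Suc j)) ?k (D j)"
        using tl' same unfolding m DS by simp
      have "unitri ?e (Suc ?m)" by (rule unitri_extend[OF tri]) (use y m in auto)
      moreover have "\<not> first_diag (Suc j)" using same by (auto simp: first_diag_def)
      moreover have "crit ?e a' (Suc ?m)" "stt (Suc ?m) (Nrm ?e a' (Suc ?m)) (D (Suc j))"
        using tl'' by (auto simp: tail_def simp del: Nrm.simps)
      ultimately have "invariant (Suc j) ?e a'"
        unfolding invariant_def d1 using dj tl'' by auto
      then show ?thesis by (intro exI[of _ ?e] exI[of _ a']) auto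
    next
      case ns: False
      obtain y \<alpha> t where y: "y = (\<Sum>i<?m. vscale (t i) (e i))" "\<forall>i<?m. hge (t i) 0"
        and tl: "tail True (e(?m := psi ?m + y)) (a(?m := \<alpha>)) ?m (disc_step ?m (D j) (Q (psi ?m))) ?k (D j)"
        using diagonal_step_first[OF cr st z diagonal_block_bound[OF j I dj ns]] by blast
      let ?e = "e(?m := psi ?m + y)" and ?a = "a(?m := \<alpha>)"
      have tri1: "unitri ?e (Suc ?m)" by (rule unitri_extend[OF tri y(2,1)])
      from w12 show ?thesis
      proof
        assume w1: "w (Suc j) = 1"
        have DS: "D (Suc j) = disc_step ?m (D j) (Q (psi ?m))" by (rule D_Suc_1[OF j dj w1])
        have d1: "d (Suc j) = Suc ?m" using d_Suc[OF j] w1 by simp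
        have "crit ?e ?a (Suc ?m)" "stt (Suc ?m) (Nrm ?e ?a (Suc ?m)) (D (Suc j))"
          using tl DS by (auto simp: tail_def simp del: Nrm.simps)
        then have "invariant (Suc j) ?e ?a"
          unfolding invariant_def d1 using dj tl tri1 DS by auto
        then show ?thesis by (intro exI[of _ ?e] exI[of _ ?a]) auto
      next
        assume w2: "w (Suc j) = 2"
        have d2: "d (Suc j) = Suc (Suc ?m)" using d_Suc[OF j] w2 by simp
        have lt2: "Suc ?m < d r" using dr d2 by simp
        have o2: "orth (Nrm ?e ?a (Suc ?m)) (psi (Suc ?m))"
        proof (rule orth_psi[OF tri1 lt2])
          fix i assume "i < Suc ?m"
          then consider "i < ?m" | "i = ?m" by linarith
          then show "Bp r $$ (i, Suc ?m) = 0"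
          proof cases
            case 1
            then show ?thesis using off[of i 1] w2 by simp
          next
            case 2
            have "CC bs (Suc j) $$ (0, 1) = 0"
              using dj w2 unfolding isdiag_def unimod_diag_def by auto
            then show ?thesis using B_block[OF j, of ?m "Suc ?m"] d2 2 by simp
          qed
        qed
        have z2: "Q (psi (Suc ?m)) \<noteq> 0" "ord (Q (psi (Suc ?m))) = ?k"
          using diag_entry[OF j dj, of 1] w2 by auto
        obtain y2 a2 t2 where y2: "y2 = (\<Sum>i<Suc ?m. vscale (t2 i) (?e i))" "\<forall>i<Suc ?m. hge (t2 i) 0"
          and tl2: "tail False (?e(Suc ?m := psi (Suc ?m) + y2)) a2 (Suc ?m)
            (disc_step (Suc ?m) (disc_step ?m (D j) (Q (psi ?m))) (Q (psi (Suc ?m)))) ?k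
            (disc_step ?m (D j) (Q (psi ?m)))"
          using diagonal_step_second[OF tl o2 z2 z(4)] by blast
        let ?e2 = "?e(Suc ?m := psi (Suc ?m) + y2)"
        have DS: "D (Suc j) = disc_step (Suc ?m) (disc_step ?m (D j) (Q (psi ?m))) (Q (psi (Suc ?m)))"
          by (rule D_Suc_2[OF j dj w2])
        have tri2: "unitri ?e2 (Suc (Suc ?m))" by (rule unitri_extend[OF tri1 y2(2,1)])
        have "crit ?e2 a2 (Suc (Suc ?m))" "stt (Suc (Suc ?m)) (Nrm ?e2 a2 (Suc (Suc ?m))) (D (Suc j))"
          using tl2 unfolding DS by (auto simp: tail_def simp del: Nrm.simps)
        moreover have "\<not> first_diag (Suc j)" using w2 by (simp add: first_diag_def)
        ultimately have "invariant (Suc j) ?e2 a2"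
          unfolding invariant_def d2 using dj tl2 tri2 w2 unfolding DS[symmetric] by auto
        then show ?thesis by (intro exI[of _ ?e2] exI[of _ a2]) auto
      qed
    qed
  qed
qed

lemma invariant_exists: "j \<le> r \<Longrightarrow> \<exists>e a. invariant j e a"
proof (induction j)
  case 0
  show ?case using invariant_0 by blast
next
  case (Suc j)
  then show ?case using invariant_step by (meson Suc_le_lessD less_imp_le_nat)
qed

lemma optimal_of_invariant:
  assumes "j \<le> r" "invariant j e a"
  shows "optimal_basis ord (d j) (Bp j) (basis_mat e (d j))"
proof (rule optimal_of_crit)
  show "d j \<le> d r" using d_mono assms by simp
  show "Bp j \<in> carrier_mat (d j) (d j)" by (rule Bp_carrier[OF assms(1)])
  show "Bp j $$ (p, q) = Bp r $$ (p, q)" if "p < d j" "q < d j" for p q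
    using Bp_agree[of j r p q] assms that by simp
  show "unitri e (d j)" "crit e a (d j)" using assms(2) by (auto simp: invariant_def)
qed

end

theorem theorem4p1:
  fixes ord :: "'a::field_char_0 \<Rightarrow> int"
    and bs :: "(nat \<times> 'a mat) list"
  assumes "unram_ext_Q2 ord"
    and "bs \<noteq> []"
    and "pre_optimal ord bs"
  defines "r \<equiv> length bs"
  defines "B \<equiv> Bpart bs r"
  defines "n \<equiv> degB bs r"
  defines "nr \<equiv> dim_row (CC bs r)"
  shows "\<exists>U. optimal_basis ord n B U \<and>
             (\<forall>i j. n - nr \<le> i \<and> i < n \<and> j < n - nr \<longrightarrow> U $$ (i, j) = 0) \<and>
             optimal_basis ord (n - nr) (Bpart bs (r - 1)) (top_left (n - nr) U)"
proof -
  interpret pre_optimal_form ord bs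
    using assms(1,3) by unfold_locales
  obtain s where s: "r = Suc s" using assms(2) by (cases bs) (auto simp: r_def)
  have sr: "s < length bs" using s by (simp add: r_def)
  \<comment> \<open>The basis of the smaller form is fixed first and then extended by one step; two
    independent existence statements would not give a common initial segment.\<close>
  obtain e a where I: "invariant s e a" using invariant_exists[of s] sr by auto
  obtain e' a' where I': "invariant r e' a'" and ee: "\<forall>i<degB bs s. e' i = e i"
    using invariant_step[OF sr I] s by auto
  have m: "n - nr = degB bs s" using d_Suc[OF sr] by (simp add: n_def nr_def s)
  have le: "degB bs s \<le> n" using d_mono[of s r] sr s by (simp add: n_def r_def)
  have "optimal_basis ord n B (basis_mat e' n)"
    unfolding n_def B_def by (rule optimal_of_invariant[OF _ I']) (simp add: r_def)
  moreover have "basis_mat e' n $$ (i, j) = 0" if "n - nr \<le> i" "i < n" "j < n - nr" for i j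
    using I' that m by (auto simp: invariant_def basis_mat_def unitri_def n_def)
  moreover have "top_left (n - nr) (basis_mat e' n) = basis_mat e (degB bs s)"
    unfolding m using ee le by (intro eq_matI) (auto simp: top_left_def basis_mat_def)
  moreover have "optimal_basis ord (degB bs s) (Bpart bs (r - 1)) (basis_mat e (degB bs s))"
    using optimal_of_invariant[OF _ I] sr s by simp
  ultimately show ?thesis
    using m by (intro exI[of _ "basis_mat e' n"]) auto
qed

end
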